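(* Fix $\theta\ge 0$ and a non-negative integer $\alpha$. For each $n\ge 2$ let $m=n+\alpha$, let $\mathbf v\in\mathbb C^n$ be a non-random vector with $\|\mathbf v\|=1$, let $\mathbf W\sim\mathcal{CW}_n(m,\mathbf I_n+\theta\,\mathbf v\mathbf v^\dagger)$, and let $\mathbf u_1$ be a unit eigenvector corresponding to the smallest eigenvalue of $\mathbf W$. Then, as $m,n\to\infty$ with $m-n=\alpha$ fixed, the scaled random variable $nZ_1^{(n)}=n|\mathbf v^\dagger\mathbf u_1|^2$ converges in distribution to $\dfrac{\chi_2^2}{2(1+\theta)}$, where $\chi_2^2$ is a chi-squared random variable with two degrees of freedom.
   Context: $(\cdot)^\dagger$ is the conjugate transpose. $\mathcal{CW}_n(m,\boldsymbol\Sigma)$ with $m\ge n$ denotes the complex Wishart distribution: the law of $\mathbf W=\mathbf X\mathbf X^\dagger$ where $\mathbf X\in\mathbb C^{n\times m}$ has i.i.d. columns distributed as $\mathcal{CN}_n(\mathbf 0,\boldsymbol\Sigma)$ (circularly symmetric complex Gaussian with covariance $\boldsymbol\Sigma$); its density is $\dfrac{\det^{m-n}(\mathbf W)}{\tilde\Gamma_n(m)\det^m(\boldsymbol\Sigma)}e^{-\mathrm{tr}(\boldsymbol\Sigma^{-1}\mathbf W)}$ on Hermitian positive definite matrices, with $\tilde\Gamma_n(a)=\pi^{n(n-1)/2}\prod_{j=1}^n\Gamma(a-j+1)$. The eigenvalues are almost surely distinct. The vector $\mathbf v$ (which depends on $n$) may be chosen arbitrarily among unit vectors for each $n$. *)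

theory Defs
  imports
    "HOL-Probability.Probability"
    "Jordan_Normal_Form.Gauss_Jordan_Elimination"
    "Jordan_Normal_Form.Schur_Decomposition"
    "Jordan_Normal_Form.Spectral_Radius"
begin

hide_type (open) Finite_Cartesian_Product.vec
hide_const (open) Finite_Cartesian_Product.vec Finite_Cartesian_Product.mat
  Finite_Cartesian_Product.vec_nth Finite_Cartesian_Product.row
  Determinants.det
no_notation Finite_Cartesian_Product.vec_nth (infixl "$" 90)
no_notation Inner_Product.real_inner_class.inner (infix "\<bullet>" 70)

section \<open>Random complex vectors and matrices\<close>

text \<open>The Borel spaces of \<open>\<complex>\<^sup>n\<close> and \<open>\<complex>\<^sup>n\<^sup>\<times>\<^sup>m\<close>: the carriers with the
  \<open>\<sigma>\<close>-algebra generated by the entries.\<close>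

definition borel_cvec :: "nat \<Rightarrow> complex vec measure" where
  "borel_cvec n = vimage_algebra (carrier_vec n) (\<lambda>x. \<lambda>i\<in>{..<n}. x $ i)
     (PiM {..<n} (\<lambda>_. borel))"

definition borel_cmat :: "nat \<Rightarrow> nat \<Rightarrow> complex mat measure" where
  "borel_cmat n m = vimage_algebra (carrier_mat n m) (\<lambda>A. \<lambda>p\<in>{..<n} \<times> {..<m}. A $$ p)
     (PiM ({..<n} \<times> {..<m}) (\<lambda>_. borel))"

definition lborel_cvec :: "nat \<Rightarrow> complex vec measure" where
  "lborel_cvec n = distr (PiM {..<n} (\<lambda>_. lborel)) (borel_cvec n) (vec n)"

definition outer_prod :: "complex vec \<Rightarrow> complex vec \<Rightarrow> complex mat" where
  "outer_prod x y = mat (dim_vec x) (dim_vec y) (\<lambda>(i, j). x $ i * cnj (y $ j))"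

text \<open>\<open>\<C>\<N>\<^sub>n(0, \<Sigma>)\<close>, for Hermitian positive definite \<open>\<Sigma>\<close>, by its density
  \<open>exp (- x\<^sup>\<dagger> \<Sigma>\<^sup>-\<^sup>1 x) / (\<pi>\<^sup>n det \<Sigma>)\<close> with respect to Lebesgue measure; the covariance is
  \<open>E (x x\<^sup>\<dagger>) = \<Sigma>\<close>. Note that \<open>u \<bullet>c x\<close> conjugates its second argument, so it is \<open>x\<^sup>\<dagger> u\<close>.\<close>

definition complex_normal :: "nat \<Rightarrow> complex mat \<Rightarrow> complex vec measure" where
  "complex_normal n S = density (lborel_cvec n)
     (\<lambda>x. ennreal (exp (- Re ((the (mat_inverse S) *\<^sub>v x) \<bullet>c x)) / (pi ^ n * Re (det S))))"

text \<open>\<open>\<C>\<W>\<^sub>n(m, \<Sigma>)\<close>: the law of \<open>X X\<^sup>\<dagger>\<close>, where the \<open>m\<close> columns of \<open>X\<close> are i.i.d.\<close>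

definition complex_wishart :: "nat \<Rightarrow> nat \<Rightarrow> complex mat \<Rightarrow> complex mat measure" where
  "complex_wishart n m S = distr (PiM {..<m} (\<lambda>_. complex_normal n S)) (borel_cmat n n)
     (\<lambda>x. let X = mat_of_cols n (map x [0..<m]) in X * mat_adjoint X)"

text \<open>Meaningful for Hermitian matrices of positive dimension, whose spectrum is a finite
  nonempty set of real numbers.\<close>

definition smallest_eigenvalue :: "complex mat \<Rightarrow> real" where
  "smallest_eigenvalue A = Min {l. eigenvalue A (complex_of_real l)}"

definition chi_squared :: "nat \<Rightarrow> real measure" where
  "chi_squared k = distr (PiM {..<k} (\<lambda>_. density lborel std_normal_density)) borel
     (\<lambda>x. \<Sum>i<k. (x i)\<^sup>2)"

text \<open>Measurability of the maps above, without which \<open>density\<close> and \<open>distr\<close> would be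
  degenerate.\<close>

lemma space_borel_cvec: "space (borel_cvec n) = carrier_vec n"
  by (simp add: borel_cvec_def)

lemma space_borel_cmat: "space (borel_cmat n m) = carrier_mat n m"
  by (simp add: borel_cmat_def)

lemma borel_cvec_index: "i < n \<Longrightarrow> (\<lambda>x. x $ i) \<in> borel_measurable (borel_cvec n)"
proof -
  assume i: "i < n"
  have "(\<lambda>x. \<lambda>i\<in>{..<n}. x $ i) \<in> borel_cvec n \<rightarrow>\<^sub>M PiM {..<n} (\<lambda>_. borel)"
    unfolding borel_cvec_def by (rule measurable_vimage_algebra1) (auto simp: space_PiM)
  from measurable_compose[OF this measurable_component_singleton[of i]] i
  show ?thesis by simp
qed

lemma measurable_borel_cvecI:
  assumes "\<And>x. x \<in> space M \<Longrightarrow> f x \<in> carrier_vec n"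
    and "\<And>i. i < n \<Longrightarrow> (\<lambda>x. f x $ i) \<in> borel_measurable M"
  shows "f \<in> M \<rightarrow>\<^sub>M borel_cvec n"
  unfolding borel_cvec_def using assms
  by (intro measurable_vimage_algebra2 measurable_restrict) auto

lemma measurable_borel_cmatI:
  assumes "\<And>x. x \<in> space M \<Longrightarrow> f x \<in> carrier_mat n m"
    and "\<And>i j. i < n \<Longrightarrow> j < m \<Longrightarrow> (\<lambda>x. f x $$ (i, j)) \<in> borel_measurable M"
  shows "f \<in> M \<rightarrow>\<^sub>M borel_cmat n m"
  unfolding borel_cmat_def using assms
  by (intro measurable_vimage_algebra2 measurable_restrict) auto

lemma vec_measurable: "vec n \<in> PiM {..<n} (\<lambda>_. lborel) \<rightarrow>\<^sub>M borel_cvec n"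
  by (rule measurable_borel_cvecI) auto

lemma borel_measurable_cnj:
  assumes "f \<in> borel_measurable M"
  shows "(\<lambda>x. cnj (f x)) \<in> borel_measurable M"
  using measurable_compose[OF assms borel_measurable_continuous_onI[OF continuous_on_cnj[OF continuous_on_id]]]
  by simp

lemma quadratic_form_measurable:
  assumes "B \<in> carrier_mat n n"
  shows "(\<lambda>x. (B *\<^sub>v x) \<bullet>c x) \<in> borel_measurable (borel_cvec n)"
proof -
  have "(\<lambda>x. \<Sum>i<n. (\<Sum>j<n. B $$ (i, j) * x $ j) * cnj (x $ i)) \<in> borel_measurable (borel_cvec n)"
    by (intro borel_measurable_sum borel_measurable_times borel_measurable_const
        borel_measurable_cnj borel_cvec_index) auto
  then show ?thesis
    by (rule measurable_cong[THEN iffD1, rotated])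
       (use assms in \<open>auto simp: space_borel_cvec scalar_prod_def atLeast0LessThan
          intro!: sum.cong\<close>)
qed

lemma gram_measurable:
  "(\<lambda>x. let X = mat_of_cols n (map x [0..<m]) in X * mat_adjoint X)
     \<in> PiM {..<m} (\<lambda>_. complex_normal n S) \<rightarrow>\<^sub>M borel_cmat n n"
proof (rule measurable_borel_cmatI)
  fix i j assume ij: "i < n" "j < n"
  let ?P = "PiM {..<m} (\<lambda>_. complex_normal n S)"
  have c: "(\<lambda>x. x k $ i) \<in> borel_measurable ?P" if "k < m" "i < n" for k i
  proof (rule measurable_compose[OF measurable_component_singleton])
    show "(\<lambda>x. x $ i) \<in> borel_measurable (complex_normal n S)"
      using borel_cvec_index[OF that(2)] unfolding complex_normal_def lborel_cvec_def by simp
  qed (use that in auto)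
  have "(\<lambda>x. \<Sum>k<m. x k $ i * cnj (x k $ j)) \<in> borel_measurable ?P"
    by (intro borel_measurable_sum borel_measurable_times borel_measurable_cnj c)
       (use ij in auto)
  then show "(\<lambda>x. (let X = mat_of_cols n (map x [0..<m]) in X * mat_adjoint X) $$ (i, j)) \<in>
      borel_measurable ?P"
  proof (rule measurable_cong[THEN iffD1, rotated])
    fix x assume "x \<in> space ?P"
    then have "\<And>k. k < m \<Longrightarrow> x k \<in> carrier_vec n"
      by (auto simp: space_PiM complex_normal_def lborel_cvec_def space_borel_cvec)
    then have "\<And>k. k < m \<Longrightarrow> dim_vec (x k) = n" by auto
    then show "(\<Sum>k<m. x k $ i * cnj (x k $ j)) =
        (let X = mat_of_cols n (map x [0..<m]) in X * mat_adjoint X) $$ (i, j)"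
      using ij by (auto simp: Let_def mat_adjoint_def scalar_prod_def atLeast0LessThan
          mat_of_cols_index mat_of_rows_index intro!: sum.cong)
  qed
qed (auto simp: Let_def mat_adjoint_def)

end

(*
  Let c = \<theta> / (1 + \<theta>), let R = v\<^sup>\<dagger> W v, and let \<lambda> be the smallest eigenvalue of W. For 0 \<le> a < 1,

    P (|v\<^sup>\<dagger> u|\<^sup>2 > a) = (1 - a)^(n-1) E (exp (- c a (R - \<lambda>))).

  Indeed, the law of the columns has density (1 + \<theta>)^(-m) exp (c R) with respect to standard Gaussian
  columns, whose law is unitarily invariant, so v may be averaged over the unit sphere. For fixed W, the
  map q \<mapsto> a e_u + (1 - a) q on squared moduli in an eigenbasis carries the sphere onto the cap
  |u\<^sup>\<dagger> q|\<^sup>2 > a, has Jacobian (1 - a)^(n-1), and turns R into a \<lambda> + (1 - a) R.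

  Since c R / n \<rightarrow> \<theta>, with exact Laplace transform E (exp (- s R)) = (1 + s (1 + \<theta>))^(-m), and since
  E \<lambda> \<le> \<alpha> + 2, taking a = t / n gives the limiting tail exp (- (1 + \<theta>) t).
*)
theory Submission
  imports Defs
    "HOL-Real_Asymp.Real_Asymp"
    "HOL-Computational_Algebra.Field_as_Ring"
    "Subresultants.Subresultant_Gcd"
begin

section \<open>Gaussian integrals over the complex plane\<close>

text \<open>Three obstacles shape the proof. The eigenvector is given only almost surely and up to a
  phase, while integration needs measurable functions of \<open>W\<close>. Overlap and smallest
  eigenvalue are therefore rewritten as limits of rational functions of the entries, meaningful once
  the spectrum is simple; simplicity is almost sure because the discriminant is a nonzero polynomial
  in the real and imaginary parts of the Gaussian entries. Averaging over the sphere is done by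
  normalizing an independent Gaussian vector, so that the cap map becomes a translation of one
  squared modulus and a scaling of the other coordinates. The invariance behind it is that under
  products of planar rotations, each made of three shears; they carry every unit vector to the first
  axis up to a phase. Finally \<lambda> is correlated with \<open>R\<close>, but enters only as an
  error: \<open>exp (- s R) \<le> exp (- s (R - \<lambda>)) \<le> exp (- s R) + s \<lambda>\<close>
  with \<open>s = c a\<close> of order 1 / n, so a bounded mean suffices. The bound \<alpha> + 2
  counts the columns left over by a test vector orthogonal to \<open>v\<close> and to n - 2 of the n
  + \<alpha> columns.\<close>

lemma distr_cmod_square:
  "distr lborel borel (\<lambda>z::complex. (cmod z)\<^sup>2) = density lborel (\<lambda>r. ennreal pi * indicator {0..} r)"
    (is "?M = ?N")
proof (rule measure_eqI_generator_eq[where E = "range (\<lambda>a::real. {..a})" and \<Omega> = UNIV and A = "\<lambda>i::nat. {..real i}"])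
  \<comment> \<open>The disc of radius \<open>sqrt a\<close> has area \<open>pi * a\<close>, which
    is linear in \<open>a\<close>; hence the constant density. This takes the place of polar
    coordinates.\<close>
  have M: "emeasure ?M {..a} = ennreal (pi * max 0 a)" for a
  proof -
    have "(\<lambda>z::complex. (cmod z)\<^sup>2) -` {..a} = (if a \<ge> 0 then cball 0 (sqrt a) else {})"
      by (auto simp: real_le_rsqrt sqrt_ge_absD real_sqrt_le_iff power2_le_iff_abs_le
          intro!: real_le_rsqrt dest: order_trans[OF zero_le_power2])
    then show ?thesis
      by (subst emeasure_distr) (auto simp: emeasure_cball unit_ball_vol_numeral max_def)
  qed
  have N: "emeasure ?N {..a} = ennreal (pi * max 0 a)" for a
  proof -
    have "emeasure ?N {..a} = (\<integral>\<^sup>+r. ennreal pi * indicator {0..a} r \<partial>lborel)"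
      by (subst emeasure_density) (auto intro!: nn_integral_cong simp: indicator_def)
    also have "\<dots> = ennreal pi * emeasure lborel {0..a}"
      by (subst nn_integral_cmult) auto
    finally show ?thesis by (auto simp: max_def ennreal_mult[symmetric])
  qed
  show "\<And>X. X \<in> range (\<lambda>a::real. {..a}) \<Longrightarrow> emeasure ?M X = emeasure ?N X"
    using M N by auto
  show "emeasure ?M {..real i} \<noteq> \<infinity>" for i using M by auto
  show "Int_stable (range (\<lambda>a::real. {..a}))" by (auto simp: Int_stable_def)
  show "(\<Union>i. {..real i}) = UNIV" using real_arch_simple by auto
  show "sets ?M = sigma_sets UNIV (range (\<lambda>a::real. {..a}))"
    by (simp, subst borel_eq_atMost) (simp add: sets_measure_of)
  then show "sets ?N = sigma_sets UNIV (range (\<lambda>a::real. {..a}))" by simp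
qed auto

lemma nn_integral_cmod_square:
  assumes [measurable]: "h \<in> borel_measurable borel"
  shows "(\<integral>\<^sup>+(z::complex). h ((cmod z)\<^sup>2) \<partial>lborel) = ennreal pi * (\<integral>\<^sup>+r. h r * indicator {0..} r \<partial>lborel)"
proof -
  have "(\<integral>\<^sup>+(z::complex). h ((cmod z)\<^sup>2) \<partial>lborel)
      = integral\<^sup>N (distr lborel borel (\<lambda>z::complex. (cmod z)\<^sup>2)) h"
    by (subst nn_integral_distr) auto
  also have "\<dots> = (\<integral>\<^sup>+r. ennreal pi * indicator {0..} r * h r \<partial>lborel)"
    unfolding distr_cmod_square by (subst nn_integral_density) auto
  also have "\<dots> = ennreal pi * (\<integral>\<^sup>+r. h r * indicator {0..} r \<partial>lborel)"
    by (subst nn_integral_cmult[symmetric]) (auto intro!: nn_integral_cong simp: mult_ac)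
  finally show ?thesis .
qed

lemma nn_integral_exp_tail:
  assumes "0 < b"
  shows "(\<integral>\<^sup>+r. ennreal (exp (- b * r)) * indicator {a..} r \<partial>lborel) = ennreal (exp (- b * a) / b)"
proof -
  have "(\<integral>\<^sup>+r. ennreal (exp (- b * r)) * indicator {a..} r \<partial>lborel) = ennreal (0 - (- exp (- b * a) / b))"
  proof (rule nn_integral_FTC_atLeast)
    show "((\<lambda>x. - exp (- b * x) / b) has_real_derivative exp (- b * x)) (at x)" for x
      using assms by (auto intro!: derivative_eq_intros)
    have "((\<lambda>x. exp (- b * x)) \<longlongrightarrow> 0) at_top"
      using assms by real_asymp
    from tendsto_divide[OF tendsto_minus[OF this] tendsto_const, of b]
    show "((\<lambda>x. - exp (- b * x) / b) \<longlongrightarrow> 0) at_top" using assms by simp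
  qed auto
  then show ?thesis by simp
qed

lemma nn_integral_complex_gaussian:
  assumes "0 < b"
  shows "(\<integral>\<^sup>+(z::complex). ennreal (exp (- b * (cmod z)\<^sup>2)) \<partial>lborel) = ennreal (pi / b)"
  using nn_integral_cmod_square[of "\<lambda>r. ennreal (exp (- b * r))"] nn_integral_exp_tail[OF assms, of 0] assms
  by (simp add: ennreal_mult[symmetric])

lemma nn_integral_complex_gaussian_moment:
  "(\<integral>\<^sup>+(z::complex). ennreal ((cmod z)\<^sup>2 * exp (- (cmod z)\<^sup>2)) \<partial>lborel) = ennreal pi"
proof -
  have "(\<integral>\<^sup>+r. ennreal (r * exp (- r)) * indicator {0..} r \<partial>lborel) = ennreal (0 - (- (0 + 1) * exp (- 0)))"
  proof (rule nn_integral_FTC_atLeast)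
    show "((\<lambda>x. - (x + 1) * exp (- x)) has_real_derivative x * exp (- x)) (at x)" for x :: real
      by (auto intro!: derivative_eq_intros simp: algebra_simps)
    show "((\<lambda>x::real. - (x + 1) * exp (- x)) \<longlongrightarrow> 0) at_top" by real_asymp
  qed auto
  then show ?thesis
    using nn_integral_cmod_square[of "\<lambda>r. ennreal (r * exp (- r))"] by simp
qed

section \<open>Zero sets of polynomials\<close>

text \<open>Fubini, one coordinate at a time: if along every coordinate line \<open>f\<close> either
  vanishes identically or is almost everywhere nonzero, one point with \<open>f a \<noteq> 0\<close>
  excludes the first alternative almost everywhere. It is applied on three nested levels: the
  columns of a matrix, the entries of a column, the real and imaginary part of an entry.\<close>

lemma AE_PiM_nonzero:
  fixes f :: "('i \<Rightarrow> 'a) \<Rightarrow> complex"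
  assumes "product_sigma_finite M" "finite I"
    and "f \<in> borel_measurable (PiM I M)"
    and "\<And>x i. x \<in> space (PiM I M) \<Longrightarrow> i \<in> I \<Longrightarrow>
        (\<forall>t\<in>space (M i). f (x(i := t)) = 0) \<or> (AE t in M i. f (x(i := t)) \<noteq> 0)"
    and "a \<in> space (PiM I M)" "f a \<noteq> 0"
  shows "AE x in PiM I M. f x \<noteq> 0"
proof -
  interpret product_sigma_finite M by fact
  show ?thesis using assms(2-)
  proof (induction I arbitrary: f a rule: finite_induct)
    case empty
    then show ?case by (auto simp: space_PiM PiM_empty AE_count_space)
  next
    case (insert i I)
    note [measurable] = insert.prems(1)
    interpret I: finite_product_sigma_finite M I by standard fact
    have upd: "x(i := t) \<in> space (PiM (insert i I) M)" if "x \<in> space (PiM I M)" "t \<in> space (M i)" for x t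
      using that by (auto simp: space_PiM PiE_iff extensional_def)
    have ai: "a i \<in> space (M i)" using insert.prems(3) by (auto simp: space_PiM)
    let ?r = "a(i := undefined)"
    have r: "?r \<in> space (PiM I M)" using insert.prems(3) insert.hyps by (auto simp: space_PiM PiE_iff extensional_def)
    have meas: "(\<lambda>x. x(i := t)) \<in> PiM I M \<rightarrow>\<^sub>M PiM (insert i I) M" if "t \<in> space (M i)" for t
      using that by (intro measurable_fun_upd[where J = I]) auto
    \<comment> \<open>Coordinate \<open>i\<close> is frozen at its value in the witness
      \<open>a\<close>. For almost every remaining \<open>x\<close> the line through
      \<open>x\<close> in direction \<open>i\<close> then contains a nonzero value, namely at
      \<open>a i\<close>.\<close>
    have h1: "AE x in PiM I M. f (x(i := a i)) \<noteq> 0"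
    proof (rule insert.IH)
      show "(\<lambda>x. f (x(i := a i))) \<in> borel_measurable (PiM I M)"
        by (rule measurable_compose[OF meas[OF ai] insert.prems(1)])
      show "?r \<in> space (PiM I M)" by (rule r)
      show "f (?r(i := a i)) \<noteq> 0" using insert.prems(4) by simp
      fix x j assume x: "x \<in> space (PiM I M)" and j: "j \<in> I"
      then have "j \<noteq> i" using insert.hyps by auto
      then have "x(j := t, i := a i) = (x(i := a i))(j := t)" for t by auto
      then show "(\<forall>t\<in>space (M j). f (x(j := t, i := a i)) = 0) \<or> (AE t in M j. f (x(j := t, i := a i)) \<noteq> 0)"
        using insert.prems(2)[OF upd[OF x ai], of j] j by (simp del: fun_upd_apply)
    qed
    have h2: "(AE t in M i. f (x(i := t)) \<noteq> 0)" if x: "x \<in> space (PiM I M)" and "f (x(i := a i)) \<noteq> 0" for x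
      using insert.prems(2)[OF upd[OF x ai], of i] that ai by (auto simp del: fun_upd_apply)
    have *: "AE x in PiM I M. AE t in M i. f (x(i := t)) \<noteq> 0"
      by (rule AE_mp[OF h1], rule AE_I2, rule impI, rule h2)
    have "(\<integral>\<^sup>+x. indicator {x. f x = 0} x \<partial>PiM (insert i I) M)
        = (\<integral>\<^sup>+x. (\<integral>\<^sup>+t. indicator {x. f x = 0} (x(i := t)) \<partial>M i) \<partial>PiM I M)"
      by (rule product_nn_integral_insert) (use insert.hyps in \<open>auto simp: indicator_def\<close>)
    also have "\<dots> = (\<integral>\<^sup>+x. 0 \<partial>PiM I M)"
    proof (rule nn_integral_cong_AE, use * in \<open>rule AE_mp\<close>, rule AE_I2, rule impI)
      fix x assume x: "x \<in> space (PiM I M)" and ae: "AE t in M i. f (x(i := t)) \<noteq> 0"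
      have "(\<integral>\<^sup>+t. indicator {x. f x = 0} (x(i := t)) \<partial>M i) = (\<integral>\<^sup>+t. 0 \<partial>M i)"
        by (rule nn_integral_cong_AE, use ae in \<open>rule AE_mp\<close>) (auto simp: indicator_def)
      then show "(\<integral>\<^sup>+t. indicator {x. f x = 0} (x(i := t)) \<partial>M i) = 0" by simp
    qed
    finally have "(\<integral>\<^sup>+x. indicator {x. f x = 0} x \<partial>PiM (insert i I) M) = 0" by simp
    then have "AE x in PiM (insert i I) M. indicator {x. f x = 0} x = (0::ennreal)"
      by (subst (asm) nn_integral_0_iff_AE) (auto simp: indicator_def)
    then show ?case by (rule AE_mp) (auto simp: indicator_def)
  qed
qed

text \<open>The polynomials in \<open>z\<close> and \<open>cnj z\<close> are polynomial along every real line.\<close>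

definition line_poly :: "(complex \<Rightarrow> complex) \<Rightarrow> bool" where
  "line_poly g \<longleftrightarrow> (\<forall>w b. \<exists>p. \<forall>t::real. g (w + of_real t * b) = poly p (of_real t))"

lemma line_poly_const: "line_poly (\<lambda>z. c)"
  unfolding line_poly_def by (auto intro!: exI[of _ "[:c:]"])

lemma line_poly_ident: "line_poly (\<lambda>z. z)"
  unfolding line_poly_def by (auto intro!: exI[of _ "[:w, b:]" for w b])

lemma line_poly_add: "line_poly f \<Longrightarrow> line_poly g \<Longrightarrow> line_poly (\<lambda>z. f z + g z)"
  unfolding line_poly_def by (metis poly_add)

lemma line_poly_mult: "line_poly f \<Longrightarrow> line_poly g \<Longrightarrow> line_poly (\<lambda>z. f z * g z)"
  unfolding line_poly_def by (metis poly_mult)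

text \<open>The line parameter \<open>t\<close> is real, so conjugating the value only conjugates
  the coefficients. This is why lines are real and not complex.\<close>

lemma line_poly_cnj: 
  assumes "line_poly f" shows "line_poly (\<lambda>z. cnj (f z))"
  unfolding line_poly_def
proof (intro allI)
  fix w b
  obtain p where p: "\<And>t::real. f (w + of_real t * b) = poly p (of_real t)"
    using assms unfolding line_poly_def by metis
  have "cnj (f (w + of_real t * b)) = poly (map_poly cnj p) (of_real t)" for t :: real
    unfolding p by (induction p) (auto simp: map_poly_pCons)
  then show "\<exists>p. \<forall>t::real. cnj (f (w + of_real t * b)) = poly p (of_real t)" by blast
qed

lemma line_poly_sum: "(\<And>i. i \<in> I \<Longrightarrow> line_poly (f i)) \<Longrightarrow> line_poly (\<lambda>z. \<Sum>i\<in>I. f i z)"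
  by (induction I rule: infinite_finite_induct) (auto intro: line_poly_const line_poly_add)

text \<open>A polynomial in \<open>z\<close> and \<open>cnj z\<close> may vanish on a whole curve,
  so finiteness of the zeros is available only on lines. Horizontal and vertical lines suffice, with
  the two real coordinates of the plane as product space.\<close>

lemma AE_line_poly_nonzero:
  assumes g: "line_poly g" and [measurable]: "g \<in> borel_measurable borel"
    and "g a \<noteq> 0"
  shows "AE z in lborel. g z \<noteq> 0"
proof -
  let ?S = "\<lambda>f::complex \<Rightarrow> real. \<Sum>b\<in>Basis. f b *\<^sub>R b"
  let ?P = "\<Pi>\<^sub>M b\<in>(Basis::complex set). (lborel::real measure)"
  interpret product_sigma_finite "\<lambda>_::complex. lborel::real measure" by standard
  have S[measurable]: "?S \<in> ?P \<rightarrow>\<^sub>M borel" by measurable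
  have "AE x in ?P. g (?S x) \<noteq> 0"
  proof (rule AE_PiM_nonzero[where a = "\<lambda>b\<in>Basis. inner a b"])
    show "product_sigma_finite (\<lambda>_::complex. lborel::real measure)" by standard
    have "?S (\<lambda>b\<in>Basis. inner a b) = a"
      by (simp add: euclidean_representation cong: sum.cong)
    then show "g (?S (\<lambda>b\<in>Basis. inner a b)) \<noteq> 0" using assms(3) by simp
    fix x :: "complex \<Rightarrow> real" and i :: complex assume i: "i \<in> Basis"
    let ?w = "\<Sum>b\<in>Basis - {i}. x b *\<^sub>R b"
    have eq: "?S (x(i := t)) = ?w + of_real t * i" for t
      using i by (subst sum.remove[of _ i]) (auto simp: scaleR_conv_of_real)
    obtain p where p: "\<And>t::real. g (?w + of_real t * i) = poly p (of_real t)"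
      using g unfolding line_poly_def by metis
    show "(\<forall>t\<in>space lborel. g (?S (x(i := t))) = 0) \<or> (AE t in lborel. g (?S (x(i := t))) \<noteq> 0)"
    proof (cases "p = 0")
      case False
      then have "finite {z. poly p z = 0}" by (rule poly_roots_finite)
      then have "finite (of_real -` {z. poly p z = 0} :: real set)"
        by (rule finite_vimageI) (auto intro: inj_onI)
      then have "of_real -` {z. poly p z = 0} \<in> null_sets (lborel :: real measure)"
        by (intro countable_imp_null_set_lborel countable_finite)
      then have "AE t::real in lborel. poly p (of_real t) \<noteq> 0"
        by (rule AE_I') auto
      then show ?thesis unfolding eq p by simp
    qed (simp add: eq p del: fun_upd_apply)
  qed (auto simp: space_PiM)
  then have "AE z in distr ?P borel ?S. g z \<noteq> 0"
    by (subst AE_distr_iff) auto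
  then show ?thesis
    unfolding lborel_def[where 'a=complex] by (simp only: lborel_eq_real[symmetric])
qed

section \<open>Volume-preserving rotations of complex space\<close>

declare index_mult_mat_vec [simp del]

lemma cscalar_prod_sum:
  "y \<in> carrier_vec n \<Longrightarrow> x \<bullet>c y = (\<Sum>i<n. x $ i * cnj (y $ i))"
  by (auto simp: scalar_prod_def atLeast0LessThan)

lemma mult_mat_vec_sum:
  "A \<in> carrier_mat n m \<Longrightarrow> x \<in> carrier_vec m \<Longrightarrow> i < n \<Longrightarrow> (A *\<^sub>v x) $ i = (\<Sum>j<m. A $$ (i, j) * x $ j)"
  by (auto simp: index_mult_mat_vec scalar_prod_def atLeast0LessThan)

lemma space_lborel_cvec [simp]: "space (lborel_cvec n) = carrier_vec n"
  by (simp add: lborel_cvec_def space_borel_cvec)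

lemma sets_lborel_cvec [measurable_cong]: "sets (lborel_cvec n) = sets (borel_cvec n)"
  by (simp add: lborel_cvec_def)

interpretation lborel_product: product_sigma_finite "\<lambda>_::nat. lborel :: complex measure"
  by standard

lemma nn_integral_lborel_cvec:
  assumes "f \<in> borel_measurable (borel_cvec n)"
  shows "(\<integral>\<^sup>+x. f x \<partial>lborel_cvec n) = (\<integral>\<^sup>+x. f (vec n x) \<partial>PiM {..<n} (\<lambda>_. lborel))"
  unfolding lborel_cvec_def using assms vec_measurable by (subst nn_integral_distr) auto

lemma mult_mat_vec_measurable:
  assumes "A \<in> carrier_mat n n"
  shows "(\<lambda>x. A *\<^sub>v x) \<in> borel_cvec n \<rightarrow>\<^sub>M borel_cvec n"
proof (rule measurable_borel_cvecI)
  fix i assume i: "i < n"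
  have "(\<lambda>x. \<Sum>j<n. A $$ (i, j) * x $ j) \<in> borel_measurable (borel_cvec n)"
    by (intro borel_measurable_sum borel_measurable_times borel_measurable_const borel_cvec_index) auto
  then show "(\<lambda>x. (A *\<^sub>v x) $ i) \<in> borel_measurable (borel_cvec n)"
    by (rule measurable_cong[THEN iffD1, rotated]) (simp add: mult_mat_vec_sum[OF assms _ i] space_borel_cvec)
qed (use assms in \<open>auto simp: space_borel_cvec\<close>)

section \<open>Volume-preserving linear maps\<close>

definition volume_preserving :: "nat \<Rightarrow> complex mat \<Rightarrow> bool" where
  "volume_preserving n A \<longleftrightarrow> A \<in> carrier_mat n n \<and>
     (\<forall>f \<in> borel_measurable (borel_cvec n). (\<integral>\<^sup>+x. f (A *\<^sub>v x) \<partial>lborel_cvec n) = (\<integral>\<^sup>+x. f x \<partial>lborel_cvec n))"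

lemma volume_preservingD:
  assumes "volume_preserving n A" "f \<in> borel_measurable (borel_cvec n)"
  shows "(\<integral>\<^sup>+x. f (A *\<^sub>v x) \<partial>lborel_cvec n) = (\<integral>\<^sup>+x. f x \<partial>lborel_cvec n)"
  using assms by (auto simp: volume_preserving_def)

lemma volume_preserving_one: "volume_preserving n (1\<^sub>m n)"
  by (auto simp: volume_preserving_def intro!: nn_integral_cong)

lemma volume_preserving_mult:
  assumes A: "volume_preserving n A" and B: "volume_preserving n B"
  shows "volume_preserving n (A * B)"
  unfolding volume_preserving_def
proof (intro conjI ballI)
  have AB: "A \<in> carrier_mat n n" "B \<in> carrier_mat n n" using assms by (auto simp: volume_preserving_def)
  then show "A * B \<in> carrier_mat n n" by simp
  fix f :: "complex vec \<Rightarrow> ennreal" assume f: "f \<in> borel_measurable (borel_cvec n)"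
  have "(\<integral>\<^sup>+x. f (A * B *\<^sub>v x) \<partial>lborel_cvec n) = (\<integral>\<^sup>+x. f (A *\<^sub>v (B *\<^sub>v x)) \<partial>lborel_cvec n)"
    using AB by (intro nn_integral_cong) auto
  also have "\<dots> = (\<integral>\<^sup>+x. f (A *\<^sub>v x) \<partial>lborel_cvec n)"
    by (rule volume_preservingD[OF B measurable_compose[OF mult_mat_vec_measurable[OF AB(1)] f]])
  also have "\<dots> = (\<integral>\<^sup>+x. f x \<partial>lborel_cvec n)" by (rule volume_preservingD[OF A f])
  finally show "(\<integral>\<^sup>+x. f (A * B *\<^sub>v x) \<partial>lborel_cvec n) = (\<integral>\<^sup>+x. f x \<partial>lborel_cvec n)" .
qed

lemma addrow_mat_vec:
  fixes x :: "complex vec"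
  assumes "x \<in> carrier_vec n" "k < n" "l < n" "k \<noteq> l" "i < n"
  shows "(addrow_mat n a k l *\<^sub>v x) $ i = (if i = k then x $ k + a * x $ l else x $ i)"
proof -
  have "(addrow_mat n a k l *\<^sub>v x) $ i = (\<Sum>j<n. addrow_mat n a k l $$ (i, j) * x $ j)"
    using assms by (intro mult_mat_vec_sum[of _ n n]) auto
  also have "\<dots> = (\<Sum>j<n. (if j = i then x $ j else 0) + (if j = l then (if i = k then a * x $ l else 0) else 0))"
    using assms by (intro sum.cong) auto
  also have "\<dots> = (if i = k then x $ k + a * x $ l else x $ i)"
    unfolding sum.distrib using assms by (auto simp: sum.delta)
  finally show ?thesis .
qed

text \<open>With all other coordinates fixed, a shear translates coordinate \<open>k\<close> by
  \<open>a * x l\<close>; translation invariance of \<open>lborel\<close> and Fubini give the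
  claim.\<close>

lemma volume_preserving_shear:
  assumes kl: "k < n" "l < n" "k \<noteq> l"
  shows "volume_preserving n (addrow_mat n a k l)"
  unfolding volume_preserving_def
proof (intro conjI ballI)
  let ?A = "addrow_mat n a k l"
  show A: "?A \<in> carrier_mat n n" by simp
  fix f :: "complex vec \<Rightarrow> ennreal" assume f: "f \<in> borel_measurable (borel_cvec n)"
  let ?P = "\<lambda>I. PiM I (\<lambda>_::nat. lborel :: complex measure)"
  have ins: "?P {..<n} = ?P (insert k ({..<n} - {k}))" using kl by (simp add: insert_absorb)
  have fv: "(\<lambda>x. f (vec n x)) \<in> borel_measurable (?P (insert k ({..<n} - {k})))"
    using measurable_compose[OF vec_measurable f] unfolding ins .
  have fAv: "(\<lambda>x. f (?A *\<^sub>v vec n x)) \<in> borel_measurable (?P (insert k ({..<n} - {k})))"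
    using measurable_compose[OF vec_measurable measurable_compose[OF mult_mat_vec_measurable[OF A] f]]
    unfolding ins .
  have upd: "(\<lambda>t. x(k := t)) \<in> lborel \<rightarrow>\<^sub>M ?P (insert k ({..<n} - {k}))" if "x \<in> space (?P ({..<n} - {k}))" for x
    using that by (intro measurable_fun_upd[where J = "{..<n} - {k}"]) auto
  have "?A *\<^sub>v vec n (x(k := t)) = vec n (x(k := t + a * x l))" for x t
  proof (rule eq_vecI)
    fix i assume "i < dim_vec (vec n (x(k := t + a * x l)))"
    then have i: "i < n" by simp
    show "(?A *\<^sub>v vec n (x(k := t))) $ i = vec n (x(k := t + a * x l)) $ i"
      using addrow_mat_vec[OF _ kl i, of "vec n (x(k := t))" a] i kl by auto
  qed simp
  then have eq: "f (?A *\<^sub>v vec n (x(k := t))) = f (vec n (x(k := t + a * x l)))" for x t by simp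
  have "(\<integral>\<^sup>+x. f (?A *\<^sub>v x) \<partial>lborel_cvec n) = (\<integral>\<^sup>+x. f (?A *\<^sub>v vec n x) \<partial>?P {..<n})"
    by (rule nn_integral_lborel_cvec[OF measurable_compose[OF mult_mat_vec_measurable[OF A] f]])
  also have "\<dots> = (\<integral>\<^sup>+x. \<integral>\<^sup>+t. f (?A *\<^sub>v vec n (x(k := t))) \<partial>lborel \<partial>?P ({..<n} - {k}))"
    unfolding ins by (rule lborel_product.product_nn_integral_insert[OF _ _ fAv]) auto
  also have "\<dots> = (\<integral>\<^sup>+x. \<integral>\<^sup>+t. f (vec n (x(k := t))) \<partial>lborel \<partial>?P ({..<n} - {k}))"
    unfolding eq
  proof (rule nn_integral_cong)
    fix x assume x: "x \<in> space (?P ({..<n} - {k}))"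
    have m: "(\<lambda>t. f (vec n (x(k := t)))) \<in> borel_measurable lborel"
      by (rule measurable_compose[OF upd[OF x] fv])
    have "(\<integral>\<^sup>+t. f (vec n (x(k := t))) \<partial>lborel) = (\<integral>\<^sup>+t. f (vec n (x(k := t))) \<partial>distr lborel borel (\<lambda>t. a * x l + t))"
      by (rule arg_cong[where f = "\<lambda>M. integral\<^sup>N M _"]) (simp add: lborel_distr_plus)
    also have "\<dots> = (\<integral>\<^sup>+t. f (vec n (x(k := a * x l + t))) \<partial>lborel)"
      using m by (subst nn_integral_distr) auto
    finally show "(\<integral>\<^sup>+t. f (vec n (x(k := t + a * x l))) \<partial>lborel) = (\<integral>\<^sup>+t. f (vec n (x(k := t))) \<partial>lborel)"
      by (simp add: add.commute)
  qed
  also have "\<dots> = (\<integral>\<^sup>+x. f (vec n x) \<partial>?P {..<n})"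
    unfolding ins by (rule lborel_product.product_nn_integral_insert[OF _ _ fv, symmetric]) auto
  also have "\<dots> = (\<integral>\<^sup>+x. f x \<partial>lborel_cvec n)"
    by (rule nn_integral_lborel_cvec[OF f, symmetric])
  finally show "(\<integral>\<^sup>+x. f (?A *\<^sub>v x) \<partial>lborel_cvec n) = (\<integral>\<^sup>+x. f x \<partial>lborel_cvec n)" .
qed

section \<open>Isometries and planar rotations\<close>

definition isometry :: "nat \<Rightarrow> complex mat \<Rightarrow> bool" where
  "isometry n U \<longleftrightarrow> U \<in> carrier_mat n n \<and>
     (\<forall>x \<in> carrier_vec n. \<forall>y \<in> carrier_vec n. (U *\<^sub>v x) \<bullet>c (U *\<^sub>v y) = x \<bullet>c y)"

lemma index_mat_adjoint [simp]:
  "i < dim_col A \<Longrightarrow> j < dim_row A \<Longrightarrow> mat_adjoint A $$ (i, j) = cnj (A $$ (j, i))" for A :: "complex mat"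
  by (auto simp: mat_adjoint_def mat_of_rows_index)

lemma dim_mat_adjoint [simp]: "dim_row (mat_adjoint A) = dim_col A" "dim_col (mat_adjoint A) = dim_row A"
  by (auto simp: mat_adjoint_def)

lemma mult_mat_vec_cscalar_prod:
  fixes A :: "complex mat"
  assumes A: "A \<in> carrier_mat n n" and x: "x \<in> carrier_vec n" and y: "y \<in> carrier_vec n"
  shows "(A *\<^sub>v x) \<bullet>c y = x \<bullet>c (mat_adjoint A *\<^sub>v y)"
proof -
  have A': "mat_adjoint A \<in> carrier_mat n n" using A by auto
  have "(A *\<^sub>v x) \<bullet>c y = (\<Sum>i<n. \<Sum>j<n. A $$ (i, j) * x $ j * cnj (y $ i))"
    by (simp add: cscalar_prod_sum[OF y] mult_mat_vec_sum[OF A x] sum_distrib_right cong: sum.cong_simp)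
  also have "\<dots> = (\<Sum>j<n. \<Sum>i<n. A $$ (i, j) * x $ j * cnj (y $ i))"
    by (rule sum.swap)
  also have "\<dots> = (\<Sum>j<n. x $ j * cnj ((mat_adjoint A *\<^sub>v y) $ j))"
    unfolding sum_distrib_left cnj_sum using A
    by (intro sum.cong refl) (auto simp: mult_mat_vec_sum[OF A' y] sum_distrib_left intro!: sum.cong)
  also have "\<dots> = x \<bullet>c (mat_adjoint A *\<^sub>v y)"
    by (rule cscalar_prod_sum[symmetric, OF mult_mat_vec_carrier[OF A' y]])
  finally show ?thesis .
qed

lemma mat_mult_index_sum:
  "A \<in> carrier_mat n m \<Longrightarrow> B \<in> carrier_mat m k \<Longrightarrow> i < n \<Longrightarrow> j < k \<Longrightarrow> (A * B) $$ (i, j) = (\<Sum>l<m. A $$ (i, l) * B $$ (l, j))"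
  by (auto simp: scalar_prod_def atLeast0LessThan)

lemma isometry_adjoint:
  assumes U: "isometry n U"
  shows "mat_adjoint U * U = 1\<^sub>m n" "U * mat_adjoint U = 1\<^sub>m n"
proof -
  have Uc: "U \<in> carrier_mat n n" and Uc': "mat_adjoint U \<in> carrier_mat n n"
    using U by (auto simp: isometry_def)
  show *: "mat_adjoint U * U = 1\<^sub>m n"
  proof (rule eq_matI)
    fix i j assume "i < dim_row (1\<^sub>m n :: complex mat)" "j < dim_col (1\<^sub>m n :: complex mat)"
    then have ij: "i < n" "j < n" by auto
    have Ue: "(U *\<^sub>v unit_vec n j) $ k = U $$ (k, j)" if "k < n" "j < n" for k j
      using Uc that by (subst mult_mat_vec_sum[OF Uc]) (auto simp: if_distrib cong: if_cong)
    have "(mat_adjoint U * U) $$ (i, j) = (\<Sum>k<n. U $$ (k, j) * cnj (U $$ (k, i)))"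
      using ij Uc by (subst mat_mult_index_sum[OF Uc' Uc]) (auto intro!: sum.cong)
    also have "\<dots> = (U *\<^sub>v unit_vec n j) \<bullet>c (U *\<^sub>v unit_vec n i)"
      using Uc ij by (subst cscalar_prod_sum[of _ n]) (auto intro!: sum.cong simp: Ue)
    also have "\<dots> = unit_vec n j \<bullet>c unit_vec n i"
      using U by (auto simp: isometry_def)
    also have "\<dots> = 1\<^sub>m n $$ (i, j)"
      using ij by (subst cscalar_prod_sum[of _ n]) (auto simp: if_distrib cong: if_cong)
    finally show "(mat_adjoint U * U) $$ (i, j) = 1\<^sub>m n $$ (i, j)" .
  qed (use Uc in auto)
  show "U * mat_adjoint U = 1\<^sub>m n"
    by (rule mat_mult_left_right_inverse[OF Uc' Uc *])
qed

text \<open>Volume preservation is part of the notion because it is obtained from a factorization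
  into shears, not from unitarity.\<close>

definition rotation :: "nat \<Rightarrow> complex mat \<Rightarrow> bool" where
  "rotation n U \<longleftrightarrow> isometry n U \<and> volume_preserving n U"

lemma rotation_carrier: "rotation n U \<Longrightarrow> U \<in> carrier_mat n n"
  by (simp add: rotation_def isometry_def)

lemma rotation_cscalar_prod:
  "rotation n U \<Longrightarrow> x \<in> carrier_vec n \<Longrightarrow> y \<in> carrier_vec n \<Longrightarrow> (U *\<^sub>v x) \<bullet>c (U *\<^sub>v y) = x \<bullet>c y"
  by (simp add: rotation_def isometry_def)

lemma rotation_one: "rotation n (1\<^sub>m n)"
  by (simp add: rotation_def isometry_def volume_preserving_one)

lemma rotation_mult:
  assumes "rotation n U" "rotation n V" shows "rotation n (U * V)"
proof -
  have c: "U \<in> carrier_mat n n" "V \<in> carrier_mat n n" using assms by (auto intro: rotation_carrier)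
  then have "isometry n (U * V)"
    using assms by (auto simp: isometry_def rotation_def assoc_mult_mat_vec[OF c])
  then show ?thesis using assms volume_preserving_mult by (auto simp: rotation_def)
qed

text \<open>The factorization of the planar unitary matrix with rows \<open>(p, - cnj q)\<close> and
  \<open>(q, cnj p)\<close>, acting on the coordinates \<open>k\<close> and \<open>l\<close>, into
  three shears. It presupposes \<open>q \<noteq> 0\<close> and that the squared moduli of
  \<open>p\<close> and \<open>q\<close> add up to one.\<close>

definition givens :: "nat \<Rightarrow> nat \<Rightarrow> nat \<Rightarrow> complex \<Rightarrow> complex \<Rightarrow> complex mat" where
  "givens n k l p q = addrow_mat n ((p - 1) / q) k l * addrow_mat n q l k * addrow_mat n ((cnj p - 1) / q) k l"

lemma givens_vec:
  assumes x: "x \<in> carrier_vec n" and kl: "k < n" "l < n" "k \<noteq> l" and i: "i < n"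
    and q: "q \<noteq> 0" and pq: "p * cnj p + q * cnj q = 1"
  shows "(givens n k l p q *\<^sub>v x) $ i =
    (if i = k then p * x $ k - cnj q * x $ l else if i = l then q * x $ k + cnj p * x $ l else x $ i)"
proof -
  let ?S1 = "addrow_mat n ((p - 1) / q) k l" let ?S2 = "addrow_mat n q l k" let ?S3 = "addrow_mat n ((cnj p - 1) / q) k l"
  have c: "?S3 *\<^sub>v x \<in> carrier_vec n" "?S2 *\<^sub>v (?S3 *\<^sub>v x) \<in> carrier_vec n"
    using x by (auto intro!: mult_mat_vec_carrier[where n=n])
  have G: "givens n k l p q *\<^sub>v x = ?S1 *\<^sub>v (?S2 *\<^sub>v (?S3 *\<^sub>v x))"
    unfolding givens_def using x c
    by (subst assoc_mult_mat_vec[of _ n n _ n], auto)+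
  have *: "x $ l + q * (x $ k + (cnj p - 1) / q * x $ l) = q * x $ k + cnj p * x $ l"
    using q by (simp add: field_simps)
  have "p * cnj p - 1 = - (q * cnj q)" using pq by (simp add: algebra_simps)
  then have "(p * cnj p - 1) / q = - cnj q" using q by simp
  then have "p * x $ k + (p * cnj p - 1) / q * x $ l = p * x $ k - cnj q * x $ l" by simp
  moreover have "(x $ k + (cnj p - 1) / q * x $ l) + (p - 1) / q * (q * x $ k + cnj p * x $ l)
      = p * x $ k + (p * cnj p - 1) / q * x $ l"
    using q by (simp add: field_simps)
  ultimately have "(x $ k + (cnj p - 1) / q * x $ l) + (p - 1) / q * (x $ l + q * (x $ k + (cnj p - 1) / q * x $ l))
      = p * x $ k - cnj q * x $ l"
    unfolding * by simp
  with G * show ?thesis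
    using addrow_mat_vec[OF c(2) kl i] addrow_mat_vec[OF c(1) kl(2,1)] addrow_mat_vec[OF x kl] kl i by auto
qed

lemma rotation_givens:
  assumes kl: "k < n" "l < n" "k \<noteq> l" and q: "q \<noteq> 0" and pq: "p * cnj p + q * cnj q = 1"
  shows "rotation n (givens n k l p q)"
  unfolding rotation_def
proof
  show "volume_preserving n (givens n k l p q)"
    unfolding givens_def using kl by (intro volume_preserving_mult volume_preserving_shear) auto
  show "isometry n (givens n k l p q)" unfolding isometry_def
  proof (intro conjI ballI)
    show G: "givens n k l p q \<in> carrier_mat n n" unfolding givens_def by (intro mult_carrier_mat[of _ n n]) auto
    fix x y :: "complex vec" assume x: "x \<in> carrier_vec n" and y: "y \<in> carrier_vec n"
    let ?G = "\<lambda>x. givens n k l p q *\<^sub>v x"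
    have split: "(\<Sum>i<n. f i) = f k + f l + (\<Sum>i\<in>{..<n} - {k, l}. f i)" for f :: "nat \<Rightarrow> complex"
      using kl by (simp add: sum.remove[of "{..<n}" k] sum.remove[of "{..<n} - {k}" l] Diff_insert2[of _ k "{l}"] add_ac)
    have "?G x \<bullet>c ?G y = (\<Sum>i<n. ?G x $ i * cnj (?G y $ i))"
      by (rule cscalar_prod_sum[OF mult_mat_vec_carrier[OF G y]])
    also have "\<dots> = ?G x $ k * cnj (?G y $ k) + ?G x $ l * cnj (?G y $ l) + (\<Sum>i\<in>{..<n} - {k, l}. x $ i * cnj (y $ i))"
      unfolding split by (intro arg_cong2[where f = "(+)"] sum.cong refl)
        (auto simp: givens_vec[OF x kl _ q pq] givens_vec[OF y kl _ q pq])
    also have "?G x $ k * cnj (?G y $ k) + ?G x $ l * cnj (?G y $ l)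
        = (p * cnj p + q * cnj q) * (x $ k * cnj (y $ k) + x $ l * cnj (y $ l))"
      using kl by (simp add: givens_vec[OF x kl _ q pq] givens_vec[OF y kl _ q pq] algebra_simps)
    also have "\<dots> = x $ k * cnj (y $ k) + x $ l * cnj (y $ l)" using pq by simp
    also have "\<dots> + (\<Sum>i\<in>{..<n} - {k, l}. x $ i * cnj (y $ i)) = x \<bullet>c y"
      unfolding cscalar_prod_sum[OF y] split ..
    finally show "?G x \<bullet>c ?G y = x \<bullet>c y" .
  qed
qed

text \<open>Coordinate \<open>j\<close> is annihilated by a planar rotation against coordinate 0.
  Zeros produced earlier survive, since only the coordinates 0 and \<open>j\<close> change.\<close>

lemma rotation_onto_axis:
  assumes x: "x \<in> carrier_vec n"
  shows "\<exists>U. rotation n U \<and> (\<forall>i. 0 < i \<longrightarrow> i < n \<longrightarrow> (U *\<^sub>v x) $ i = 0)"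
proof -
  have "\<exists>U. rotation n U \<and> (\<forall>i. 0 < i \<longrightarrow> i < j \<longrightarrow> (U *\<^sub>v x) $ i = 0)" if "j \<le> n" for j
    using that
  proof (induction j)
    case 0
    then show ?case using rotation_one by auto
  next
    case (Suc j)
    then obtain U where U: "rotation n U" and zero: "\<And>i. 0 < i \<Longrightarrow> i < j \<Longrightarrow> (U *\<^sub>v x) $ i = 0" by auto
    let ?y = "U *\<^sub>v x"
    have y: "?y \<in> carrier_vec n" using x rotation_carrier[OF U] by auto
    show ?case
    proof (cases "j = 0 \<or> ?y $ j = 0")
      case True
      then show ?thesis using U zero by (metis less_Suc_eq less_nat_zero_code)
    next
      case False
      \<comment> \<open>The new coordinate \<open>j\<close> is
        \<open>q * ?y $ 0 + cnj p * ?y $ j\<close>, which these choices make zero. A vanishing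
        \<open>?y $ j\<close> was split off beforehand because it would give \<open>q = 0\<close>,
        where the shear factorization breaks down.\<close>
      define r where "r = sqrt ((cmod (?y $ 0))\<^sup>2 + (cmod (?y $ j))\<^sup>2)"
      define p where "p = cnj (?y $ 0) / r"
      define q where "q = - (?y $ j) / r"
      have "0 < (cmod (?y $ 0))\<^sup>2 + (cmod (?y $ j))\<^sup>2" using False by (intro add_nonneg_pos) auto
      then have r: "r > 0" "r\<^sup>2 = (cmod (?y $ 0))\<^sup>2 + (cmod (?y $ j))\<^sup>2" by (auto simp: r_def)
      have q: "q \<noteq> 0" using False r by (auto simp: q_def)
      have "complex_of_real (r\<^sup>2) = ?y $ 0 * cnj (?y $ 0) + ?y $ j * cnj (?y $ j)"
        unfolding r(2) by (simp only: of_real_add complex_norm_square)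
      moreover have "complex_of_real (r\<^sup>2) \<noteq> 0" using r(1) by simp
      ultimately have pq: "p * cnj p + q * cnj q = 1"
        using r(1) by (simp add: p_def q_def add_divide_distrib[symmetric] power2_eq_square[symmetric] flip: of_real_power)
      have kl: "0 < n" "j < n" "0 \<noteq> j" using False Suc.prems by auto
      let ?G = "givens n 0 j p q"
      have G: "rotation n ?G" by (rule rotation_givens[OF kl q pq])
      have "(?G * U *\<^sub>v x) $ i = 0" if i: "0 < i" "i < Suc j" for i
      proof -
        have "(?G * U *\<^sub>v x) $ i = (?G *\<^sub>v ?y) $ i"
          using assoc_mult_mat_vec[OF rotation_carrier[OF G] rotation_carrier[OF U] x] by simp
        also have "\<dots> = 0"
          using i zero[of i] kl
          by (subst givens_vec[OF y kl _ q pq]) (auto simp: p_def q_def)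
        finally show ?thesis .
      qed
      then show ?thesis using rotation_mult[OF G U] by blast
    qed
  qed
  then show ?thesis by auto
qed

text \<open>Preservation of the norm leaves a phase \<mu> undetermined. All functionals averaged
  below are insensitive to it, at least almost everywhere.\<close>

lemma rotation_unit_vec:
  assumes x: "x \<in> carrier_vec n" "x \<bullet>c x = 1"
  obtains U \<mu> where "rotation n U" "U *\<^sub>v x = \<mu> \<cdot>\<^sub>v unit_vec n 0" "cmod \<mu> = 1" "0 < n"
proof -
  have n: "0 < n" using x by (cases n) (auto simp: scalar_prod_def)
  obtain U where U: "rotation n U" "\<And>i. 0 < i \<Longrightarrow> i < n \<Longrightarrow> (U *\<^sub>v x) $ i = 0"
    using rotation_onto_axis[OF x(1)] by auto
  let ?y = "U *\<^sub>v x"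
  have y: "?y \<in> carrier_vec n" using x rotation_carrier[OF U(1)] by auto
  have "1 = ?y \<bullet>c ?y" using rotation_cscalar_prod[OF U(1) x(1) x(1)] x(2) by simp
  also have "\<dots> = (\<Sum>i<n. if i = 0 then ?y $ 0 * cnj (?y $ 0) else 0)"
    unfolding cscalar_prod_sum[OF y] using U(2) by (intro sum.cong) auto
  also have "\<dots> = ?y $ 0 * cnj (?y $ 0)" using n by simp
  also have "\<dots> = complex_of_real ((cmod (?y $ 0))\<^sup>2)" by (simp only: complex_norm_square)
  finally have "(cmod (?y $ 0))\<^sup>2 = 1" by (metis of_real_eq_1_iff)
  then have "cmod (?y $ 0) = 1" by (simp add: power2_eq_1_iff) (metis norm_ge_zero not_one_le_zero neg_0_le_iff_le)
  moreover have "?y = (?y $ 0) \<cdot>\<^sub>v unit_vec n 0"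
    using y U(2) n carrier_matD[OF rotation_carrier[OF U(1)]] by (intro eq_vecI) auto
  ultimately show ?thesis using that U(1) n by metis
qed

section \<open>The standard complex Gaussian vector\<close>

definition sq_norm_cvec :: "complex vec \<Rightarrow> real" where
  "sq_norm_cvec x = (\<Sum>i<dim_vec x. (cmod (x $ i))\<^sup>2)"

lemma cscalar_prod_self: "x \<bullet>c x = complex_of_real (sq_norm_cvec x)"
  by (simp add: cscalar_prod_sum[of x "dim_vec x"] sq_norm_cvec_def complex_norm_square del: of_real_power)

lemma sq_norm_cvec_nonneg [simp]: "0 \<le> sq_norm_cvec x"
  by (auto simp: sq_norm_cvec_def intro: sum_nonneg)

lemma sq_norm_cvec_eq_0: "x \<in> carrier_vec n \<Longrightarrow> sq_norm_cvec x = 0 \<longleftrightarrow> x = 0\<^sub>v n"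
  by (auto simp: sq_norm_cvec_def sum_nonneg_eq_0_iff)

lemma cvec_measurable_cscalar_prod:
  assumes "f \<in> M \<rightarrow>\<^sub>M borel_cvec n" "g \<in> M \<rightarrow>\<^sub>M borel_cvec n"
  shows "(\<lambda>x. f x \<bullet>c g x) \<in> borel_measurable M"
proof -
  have "(\<lambda>x. \<Sum>i<n. f x $ i * cnj (g x $ i)) \<in> borel_measurable M"
    by (intro borel_measurable_sum borel_measurable_times borel_measurable_cnj
        measurable_compose[OF assms(1) borel_cvec_index] measurable_compose[OF assms(2) borel_cvec_index]) auto
  moreover have "f x \<bullet>c g x = (\<Sum>i<n. f x $ i * cnj (g x $ i))" if "x \<in> space M" for x
    using measurable_space[OF assms(2) that] by (intro cscalar_prod_sum) (simp add: space_borel_cvec)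
  ultimately show ?thesis by (subst measurable_cong) auto
qed

lemma cvec_measurable_sq_norm:
  assumes "f \<in> M \<rightarrow>\<^sub>M borel_cvec n"
  shows "(\<lambda>x. sq_norm_cvec (f x)) \<in> borel_measurable M"
proof -
  have "(\<lambda>x. Re (f x \<bullet>c f x)) \<in> borel_measurable M"
    by (rule measurable_compose[OF cvec_measurable_cscalar_prod[OF assms assms] borel_measurable_Re])
  then show ?thesis by (simp add: cscalar_prod_self)
qed

definition std_cnormal :: "nat \<Rightarrow> complex vec measure" where
  "std_cnormal n = density (lborel_cvec n) (\<lambda>x. ennreal (exp (- sq_norm_cvec x) / pi ^ n))"

lemma space_std_cnormal [simp]: "space (std_cnormal n) = carrier_vec n"
  by (simp add: std_cnormal_def)

lemma sets_std_cnormal [measurable_cong]: "sets (std_cnormal n) = sets (borel_cvec n)"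
  by (simp add: std_cnormal_def sets_lborel_cvec)

lemma measurable_std_cnormal [simp]: "measurable (std_cnormal n) N = measurable (borel_cvec n) N"
  by (rule measurable_cong_sets) (auto simp: sets_std_cnormal)

lemma measurable_into_std_cnormal [simp]: "measurable N (std_cnormal n) = measurable N (borel_cvec n)"
  by (rule measurable_cong_sets) (auto simp: sets_std_cnormal)

lemma measurable_lborel_cvec [simp]: "measurable (lborel_cvec n) N = measurable (borel_cvec n) N"
  by (rule measurable_cong_sets) (auto simp: sets_lborel_cvec)

lemma std_cnormal_density_measurable:
  "(\<lambda>x. ennreal (exp (- sq_norm_cvec x) / pi ^ n)) \<in> borel_measurable (borel_cvec n)"
  using cvec_measurable_sq_norm[OF measurable_ident, of n] by simp

lemma nn_integral_std_cnormal:
  assumes "f \<in> borel_measurable (borel_cvec n)"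
  shows "(\<integral>\<^sup>+x. f x \<partial>std_cnormal n) = (\<integral>\<^sup>+x. ennreal (exp (- sq_norm_cvec x) / pi ^ n) * f x \<partial>lborel_cvec n)"
  unfolding std_cnormal_def using assms std_cnormal_density_measurable
  by (subst nn_integral_density) auto

lemma nn_integral_lborel_cvec_prod:
  assumes [measurable]: "\<And>i. i < n \<Longrightarrow> f i \<in> borel_measurable borel"
  shows "(\<integral>\<^sup>+x. (\<Prod>i<n. f i (x $ i)) \<partial>lborel_cvec n) = (\<Prod>i<n. (\<integral>\<^sup>+z. f i z \<partial>lborel))"
proof -
  have "(\<lambda>x. \<Prod>i<n. f i (x $ i)) \<in> borel_measurable (borel_cvec n)"
    by (intro borel_measurable_prod_ennreal measurable_compose[OF borel_cvec_index assms]) auto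
  from nn_integral_lborel_cvec[OF this]
  have "(\<integral>\<^sup>+x. (\<Prod>i<n. f i (x $ i)) \<partial>lborel_cvec n) = (\<integral>\<^sup>+x. (\<Prod>i<n. f i (x i)) \<partial>PiM {..<n} (\<lambda>_. lborel))"
    by (simp cong: prod.cong_simp)
  also have "\<dots> = (\<Prod>i<n. (\<integral>\<^sup>+z. f i z \<partial>lborel))"
    by (rule lborel_product.product_nn_integral_prod) auto
  finally show ?thesis .
qed

lemma std_cnormal_density_prod:
  "x \<in> carrier_vec n \<Longrightarrow>
    ennreal (exp (- sq_norm_cvec x) / pi ^ n) = (\<Prod>i<n. ennreal (exp (- 1 * (cmod (x $ i))\<^sup>2) / pi))"
  by (auto simp: sq_norm_cvec_def prod_ennreal prod_dividef exp_sum sum_negf[symmetric])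

lemma prob_space_std_cnormal: "prob_space (std_cnormal n)"
proof
  have "emeasure (std_cnormal n) (space (std_cnormal n)) = (\<integral>\<^sup>+x. 1 \<partial>std_cnormal n)" by simp
  also have "\<dots> = (\<integral>\<^sup>+x. (\<Prod>i<n. ennreal (exp (- 1 * (cmod (x $ i))\<^sup>2) / pi)) \<partial>lborel_cvec n)"
    by (subst nn_integral_std_cnormal) (auto intro!: nn_integral_cong simp: std_cnormal_density_prod)
  also have "\<dots> = (\<Prod>i<n. (\<integral>\<^sup>+(z::complex). ennreal (exp (- 1 * (cmod z)\<^sup>2) / pi) \<partial>lborel))"
    by (rule nn_integral_lborel_cvec_prod) auto
  also have "(\<integral>\<^sup>+(z::complex). ennreal (exp (- 1 * (cmod z)\<^sup>2) / pi) \<partial>lborel)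
      = (\<integral>\<^sup>+(z::complex). ennreal (exp (- 1 * (cmod z)\<^sup>2)) \<partial>lborel) / ennreal pi"
    by (subst nn_integral_divide[symmetric]) (auto intro!: nn_integral_cong simp: divide_ennreal)
  also have "\<dots> = 1" by (subst nn_integral_complex_gaussian) (auto simp: ennreal_divide_self)
  finally show "emeasure (std_cnormal n) (space (std_cnormal n)) = 1" by simp
qed

lemma sq_norm_cvec_rotation:
  "rotation n U \<Longrightarrow> x \<in> carrier_vec n \<Longrightarrow> sq_norm_cvec (U *\<^sub>v x) = sq_norm_cvec x"
  using rotation_cscalar_prod[of n U x x] by (simp add: cscalar_prod_self)

lemma rotation_measurable: "rotation n U \<Longrightarrow> (\<lambda>x. U *\<^sub>v x) \<in> borel_cvec n \<rightarrow>\<^sub>M borel_cvec n"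
  by (intro mult_mat_vec_measurable rotation_carrier)

lemma nn_integral_std_cnormal_rotation:
  assumes U: "rotation n U" and f: "f \<in> borel_measurable (borel_cvec n)"
  shows "(\<integral>\<^sup>+x. f (U *\<^sub>v x) \<partial>std_cnormal n) = (\<integral>\<^sup>+x. f x \<partial>std_cnormal n)"
proof -
  let ?g = "\<lambda>x. ennreal (exp (- sq_norm_cvec x) / pi ^ n) * f x"
  have g: "?g \<in> borel_measurable (borel_cvec n)"
    by (intro borel_measurable_times_ennreal std_cnormal_density_measurable f)
  have "(\<integral>\<^sup>+x. f (U *\<^sub>v x) \<partial>std_cnormal n) = (\<integral>\<^sup>+x. ?g (U *\<^sub>v x) \<partial>lborel_cvec n)"
    using measurable_compose[OF rotation_measurable[OF U] f]
    by (subst nn_integral_std_cnormal) (auto intro!: nn_integral_cong simp: sq_norm_cvec_rotation[OF U])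
  also have "\<dots> = (\<integral>\<^sup>+x. f x \<partial>std_cnormal n)"
    using U g f by (subst volume_preservingD) (auto simp: rotation_def nn_integral_std_cnormal)
  finally show ?thesis .
qed

lemma distr_std_cnormal_rotation:
  assumes U: "rotation n U"
  shows "distr (std_cnormal n) (std_cnormal n) (\<lambda>x. U *\<^sub>v x) = std_cnormal n"
proof (rule measure_eqI)
  fix A assume "A \<in> sets (distr (std_cnormal n) (std_cnormal n) (\<lambda>x. U *\<^sub>v x))"
  then have A: "A \<in> sets (borel_cvec n)" by (simp add: sets_std_cnormal)
  have "emeasure (distr (std_cnormal n) (std_cnormal n) (\<lambda>x. U *\<^sub>v x)) A
      = (\<integral>\<^sup>+x. indicator A x \<partial>distr (std_cnormal n) (std_cnormal n) (\<lambda>x. U *\<^sub>v x))"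
    using A by (simp add: sets_std_cnormal)
  also have "\<dots> = (\<integral>\<^sup>+x. indicator A (U *\<^sub>v x) \<partial>std_cnormal n)"
    using A rotation_measurable[OF U] by (subst nn_integral_distr) auto
  also have "\<dots> = (\<integral>\<^sup>+x. indicator A x \<partial>std_cnormal n)"
    using A by (intro nn_integral_std_cnormal_rotation U) auto
  also have "\<dots> = emeasure (std_cnormal n) A" using A by (simp add: sets_std_cnormal)
  finally show "emeasure (distr (std_cnormal n) (std_cnormal n) (\<lambda>x. U *\<^sub>v x)) A = emeasure (std_cnormal n) A" .
qed simp

lemma AE_std_cnormal_nonzero:
  assumes n: "0 < n"
  shows "AE x in std_cnormal n. sq_norm_cvec x \<noteq> 0"
proof -
  have "{0\<^sub>v n} = (\<lambda>x. sq_norm_cvec x) -` {0} \<inter> space (borel_cvec n)"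
    using sq_norm_cvec_eq_0[of _ n] by (auto simp: space_borel_cvec)
  also have "\<dots> \<in> sets (borel_cvec n)"
    by (rule measurable_sets[OF cvec_measurable_sq_norm[OF measurable_ident_sets[OF refl]]]) auto
  finally have sets: "{0\<^sub>v n} \<in> sets (borel_cvec n)" .
  have e: "vec n -` {0\<^sub>v n} \<inter> space (PiM {..<n} (\<lambda>_. lborel)) = PiE {..<n} (\<lambda>_. {0::complex})"
  proof -
    have "(vec n x = 0\<^sub>v n) \<longleftrightarrow> (\<forall>i<n. x i = 0)" for x :: "nat \<Rightarrow> complex"
    proof (intro iffI allI impI)
      fix i assume e: "vec n x = 0\<^sub>v n" and i: "i < n"
      have "vec n x $ i = 0\<^sub>v n $ i" by (simp only: e)
      then show "x i = 0" using i by simp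
    qed (auto intro!: eq_vecI)
    then show ?thesis
      by (auto simp: space_PiM PiE_iff extensional_def fun_eq_iff split: if_splits)
  qed
  have "emeasure (lborel_cvec n) {0\<^sub>v n} = emeasure (PiM {..<n} (\<lambda>_. lborel)) (PiE {..<n} (\<lambda>_. {0::complex}))"
    unfolding lborel_cvec_def emeasure_distr[OF vec_measurable sets] e ..
  also have "\<dots> = 0"
    using n by (subst lborel_product.emeasure_PiM) auto
  finally have "{0\<^sub>v n} \<in> null_sets (lborel_cvec n)"
    using sets by (auto simp: sets_lborel_cvec)
  then have "AE x in lborel_cvec n. sq_norm_cvec x \<noteq> 0"
    by (rule AE_I') (auto simp: sq_norm_cvec_eq_0)
  then show ?thesis
    unfolding std_cnormal_def using std_cnormal_density_measurable by (subst AE_density) auto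
qed

section \<open>The smallest eigenvalue and its eigenvector\<close>

text \<open>An orthonormal eigenbasis together with simplicity of the spectrum. Simplicity makes the
  eigenvector of the smallest eigenvalue unique up to a scalar, so that its squared overlap with a
  vector is a function of \<open>W\<close>.\<close>

definition spectral :: "nat \<Rightarrow> complex mat \<Rightarrow> (nat \<Rightarrow> real) \<Rightarrow> (nat \<Rightarrow> complex vec) \<Rightarrow> bool" where
  "spectral n W l u \<longleftrightarrow> W \<in> carrier_mat n n \<and> inj_on l {..<n} \<and>
    (\<forall>i<n. u i \<in> carrier_vec n \<and> W *\<^sub>v u i = complex_of_real (l i) \<cdot>\<^sub>v u i) \<and>
    (\<forall>i<n. \<forall>j<n. u i \<bullet>c u j = (if i = j then 1 else 0))"

text \<open>Orthonormality says that the square matrix with columns \<open>u k\<close> has its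
  adjoint as left inverse; the adjoint is then a right inverse as well, which is this resolution of
  the identity.\<close>

lemma orthonormal_complete:
  assumes u: "\<And>i. i < n \<Longrightarrow> u i \<in> carrier_vec n"
    and on: "\<And>i j. i < n \<Longrightarrow> j < n \<Longrightarrow> u i \<bullet>c u j = (if i = j then 1 else 0 :: complex)"
    and ij: "i < n" "j < n"
  shows "(\<Sum>k<n. u k $ i * cnj (u k $ j)) = (if i = j then 1 else 0)"
proof -
  define U where "U = mat n n (\<lambda>(i, k). u k $ i)"
  have U: "U \<in> carrier_mat n n" "mat_adjoint U \<in> carrier_mat n n" by (auto simp: U_def)
  have "mat_adjoint U * U = 1\<^sub>m n"
  proof (rule eq_matI)
    fix a b assume "a < dim_row (1\<^sub>m n :: complex mat)" "b < dim_col (1\<^sub>m n :: complex mat)"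
    then have ab: "a < n" "b < n" by auto
    have "(mat_adjoint U * U) $$ (a, b) = (\<Sum>k<n. u b $ k * cnj (u a $ k))"
      using ab by (subst mat_mult_index_sum[OF U(2,1)]) (auto intro!: sum.cong simp: U_def)
    also have "\<dots> = u b \<bullet>c u a" by (rule cscalar_prod_sum[OF u[OF ab(1)], symmetric])
    finally show "(mat_adjoint U * U) $$ (a, b) = 1\<^sub>m n $$ (a, b)" using on ab by simp
  qed (auto simp: U_def)
  then have "U * mat_adjoint U = 1\<^sub>m n" by (rule mat_mult_left_right_inverse[OF U(2,1)])
  then have "(U * mat_adjoint U) $$ (i, j) = (if i = j then 1 else 0)" using ij by simp
  then show ?thesis
    using ij by (subst (asm) mat_mult_index_sum[OF U]) (auto simp: U_def)
qed

text \<open>The resolution of the identity is inserted next to \<open>B\<close>. The matrix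
  \<open>B\<close> is arbitrary apart from being diagonal in the basis, because \<open>W\<close>,
  \<open>W * W\<close>, the identity and the powers of \<open>trace_shift n W\<close> all have to be
  treated.\<close>

lemma orthonormal_diag_index:
  assumes u: "\<And>i. i < n \<Longrightarrow> u i \<in> carrier_vec n"
    and on: "\<And>i j. i < n \<Longrightarrow> j < n \<Longrightarrow> u i \<bullet>c u j = (if i = j then 1 else 0 :: complex)"
    and B: "B \<in> carrier_mat n n" and ev: "\<And>k. k < n \<Longrightarrow> B *\<^sub>v u k = b k \<cdot>\<^sub>v u k"
    and ij: "i < n" "j < n"
  shows "B $$ (i, j) = (\<Sum>k<n. b k * u k $ i * cnj (u k $ j))"
proof -
  have "B $$ (i, j) = (\<Sum>p<n. B $$ (i, p) * (if p = j then 1 else 0))"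
    using ij by (simp add: if_distrib cong: if_cong)
  also have "\<dots> = (\<Sum>p<n. B $$ (i, p) * (\<Sum>k<n. u k $ p * cnj (u k $ j)))"
    using ij by (intro sum.cong refl) (simp add: orthonormal_complete[OF u on])
  also have "\<dots> = (\<Sum>k<n. (\<Sum>p<n. B $$ (i, p) * u k $ p) * cnj (u k $ j))"
    unfolding sum_distrib_left sum_distrib_right by (subst sum.swap) (simp add: mult_ac)
  also have "\<dots> = (\<Sum>k<n. b k * u k $ i * cnj (u k $ j))"
  proof (intro sum.cong refl, goal_cases)
    case (1 k)
    then have k: "k < n" by simp
    have "(\<Sum>p<n. B $$ (i, p) * u k $ p) = (B *\<^sub>v u k) $ i"
      by (rule mult_mat_vec_sum[OF B u[OF k] ij(1), symmetric])
    then show ?case using ev[OF k] u[OF k] ij by simp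
  qed
  finally show ?thesis .
qed

definition mtrace :: "nat \<Rightarrow> complex mat \<Rightarrow> complex" where
  "mtrace n A = (\<Sum>i<n. A $$ (i, i))"

lemma orthonormal_diag_trace:
  assumes u: "\<And>i. i < n \<Longrightarrow> u i \<in> carrier_vec n"
    and on: "\<And>i j. i < n \<Longrightarrow> j < n \<Longrightarrow> u i \<bullet>c u j = (if i = j then 1 else 0 :: complex)"
    and B: "B \<in> carrier_mat n n" and ev: "\<And>k. k < n \<Longrightarrow> B *\<^sub>v u k = b k \<cdot>\<^sub>v u k"
  shows "mtrace n B = (\<Sum>k<n. b k)"
proof -
  have "mtrace n B = (\<Sum>i<n. \<Sum>k<n. b k * (u k $ i * cnj (u k $ i)))"
    unfolding mtrace_def by (intro sum.cong refl, subst orthonormal_diag_index[OF u on B ev]) (auto simp: mult_ac)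
  also have "\<dots> = (\<Sum>k<n. b k * (u k \<bullet>c u k))"
    by (subst sum.swap) (simp add: sum_distrib_left cscalar_prod_sum[OF u])
  also have "\<dots> = (\<Sum>k<n. b k)" using on by (intro sum.cong) auto
  finally show ?thesis .
qed

lemma orthonormal_diag_form:
  assumes u: "\<And>i. i < n \<Longrightarrow> u i \<in> carrier_vec n"
    and on: "\<And>i j. i < n \<Longrightarrow> j < n \<Longrightarrow> u i \<bullet>c u j = (if i = j then 1 else 0 :: complex)"
    and B: "B \<in> carrier_mat n n" and ev: "\<And>k. k < n \<Longrightarrow> B *\<^sub>v u k = b k \<cdot>\<^sub>v u k"
    and q: "q \<in> carrier_vec n"
  shows "(B *\<^sub>v q) \<bullet>c q = (\<Sum>k<n. b k * complex_of_real ((cmod (u k \<bullet>c q))\<^sup>2))"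
proof -
  have s: "(\<Sum>i<n. u k $ i * cnj (q $ i)) = u k \<bullet>c q" for k by (rule cscalar_prod_sum[OF q, symmetric])
  have s': "(\<Sum>j<n. cnj (u k $ j) * q $ j) = cnj (u k \<bullet>c q)" for k
    unfolding s[symmetric] cnj_sum by simp
  have "(B *\<^sub>v q) \<bullet>c q = (\<Sum>i<n. \<Sum>j<n. B $$ (i, j) * q $ j * cnj (q $ i))"
    by (simp add: cscalar_prod_sum[OF q] mult_mat_vec_sum[OF B q] sum_distrib_right cong: sum.cong_simp)
  also have "\<dots> = (\<Sum>i<n. \<Sum>j<n. \<Sum>k<n. b k * (u k $ i * cnj (q $ i)) * (cnj (u k $ j) * q $ j))"
    by (intro sum.cong refl, subst orthonormal_diag_index[OF u on B ev])
       (auto simp: sum_distrib_right sum_distrib_left mult_ac)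
  also have "\<dots> = (\<Sum>k<n. \<Sum>i<n. \<Sum>j<n. b k * (u k $ i * cnj (q $ i)) * (cnj (u k $ j) * q $ j))"
    by (subst sum.swap[of _ _ "{..<n}"], subst (2) sum.swap) simp
  also have "\<dots> = (\<Sum>k<n. b k * (u k \<bullet>c q) * cnj (u k \<bullet>c q))"
    unfolding s[symmetric] unfolding s' [symmetric]
    by (simp add: sum_distrib_left[symmetric] sum_distrib_right[symmetric] s s')
  finally show ?thesis by (simp add: complex_norm_square mult_ac del: of_real_power)
qed

text \<open>After division by \<open>\<beta> p ^ k\<close> every term except the one at
  \<open>p\<close> is a power of a ratio in [0, 1) and dies out.\<close>

lemma dominant_power_limit:
  fixes \<beta> w :: "nat \<Rightarrow> real"
  assumes p: "p < n" and "\<And>j. j < n \<Longrightarrow> 0 \<le> \<beta> j" and "\<And>j. j < n \<Longrightarrow> j \<noteq> p \<Longrightarrow> \<beta> j < \<beta> p" and "0 < \<beta> p"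
  shows "(\<lambda>k. (\<Sum>j<n. \<beta> j ^ k * w j) / (\<Sum>j<n. \<beta> j ^ k)) \<longlonglongrightarrow> w p"
proof -
  define \<rho> where "\<rho> j = \<beta> j / \<beta> p" for j
  have lim: "(\<lambda>k. \<rho> j ^ k) \<longlonglongrightarrow> (if j = p then 1 else 0)" if "j < n" for j
  proof (cases "j = p")
    case True
    then show ?thesis using assms(4) by (simp add: \<rho>_def)
  next
    case False
    then show ?thesis using assms(2-4) that by (auto intro!: LIMSEQ_power_zero simp: \<rho>_def)
  qed
  have "(\<lambda>k. (\<Sum>j<n. \<rho> j ^ k * w j) / (\<Sum>j<n. \<rho> j ^ k))
      \<longlonglongrightarrow> (\<Sum>j<n. (if j = p then 1 else 0) * w j) / (\<Sum>j<n. if j = p then 1 else 0)"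
    using p by (intro tendsto_divide tendsto_sum tendsto_mult lim tendsto_const) auto
  moreover have "(\<Sum>j<n. \<rho> j ^ k * w j) / (\<Sum>j<n. \<rho> j ^ k) = (\<Sum>j<n. \<beta> j ^ k * w j) / (\<Sum>j<n. \<beta> j ^ k)" for k
    using assms(4) by (simp add: \<rho>_def power_divide sum_divide_distrib[symmetric])
  moreover have "(\<Sum>j<n. (if j = p then 1 else 0) * w j) = w p" "(\<Sum>j<n. if j = p then 1 else 0 :: real) = 1"
    using p by (auto simp: if_distrib[of "\<lambda>x. x * _"] cong: if_cong)
  ultimately show ?thesis by simp
qed

definition trace_shift :: "nat \<Rightarrow> complex mat \<Rightarrow> complex mat" where
  "trace_shift n W = (mtrace n (W * W) + 1) \<cdot>\<^sub>m 1\<^sub>m n - W"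

text \<open>For Hermitian \<open>W\<close>, \<open>trace_shift n W\<close> is positive definite and its dominant eigenvalue belongs
  to the smallest one of \<open>W\<close>. Power iteration therefore expresses the two spectral quantities as limits of rational functions of the entries.\<close>

definition min_overlap :: "nat \<Rightarrow> complex mat \<Rightarrow> complex vec \<Rightarrow> real" where
  "min_overlap n W q = lim (\<lambda>k. Re ((trace_shift n W ^\<^sub>m k *\<^sub>v q) \<bullet>c q) / Re (mtrace n (trace_shift n W ^\<^sub>m k)))"

definition min_eig :: "nat \<Rightarrow> complex mat \<Rightarrow> real" where
  "min_eig n W = Re (mtrace n (W * W)) + 1
     - lim (\<lambda>k. Re (mtrace n (trace_shift n W ^\<^sub>m Suc k)) / Re (mtrace n (trace_shift n W ^\<^sub>m k)))"

text \<open>Connects three descriptions of the bottom of the spectrum: the spectral data, the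
  measurable limits, and \<open>smallest_eigenvalue\<close>. The last item controls an arbitrary
  eigenvector, such as the one given in the theorem.\<close>

lemma spectral_min:
  assumes sp: "spectral n W l u" and n: "0 < n"
  obtains p where "p < n" "\<And>j. j < n \<Longrightarrow> j \<noteq> p \<Longrightarrow> l p < l j"
    "\<And>q. q \<in> carrier_vec n \<Longrightarrow> min_overlap n W q = (cmod (u p \<bullet>c q))\<^sup>2" "min_eig n W = l p"
    "smallest_eigenvalue W = l p"
    "\<And>x. eigenvector W x (complex_of_real (l p)) \<Longrightarrow> \<exists>c. x = c \<cdot>\<^sub>v u p"
proof -
  have W: "W \<in> carrier_mat n n" and inj: "inj_on l {..<n}"
    and u: "\<And>i. i < n \<Longrightarrow> u i \<in> carrier_vec n"
    and ev: "\<And>i. i < n \<Longrightarrow> W *\<^sub>v u i = complex_of_real (l i) \<cdot>\<^sub>v u i"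
    and on: "\<And>i j. i < n \<Longrightarrow> j < n \<Longrightarrow> u i \<bullet>c u j = (if i = j then 1 else 0)"
    using sp by (auto simp: spectral_def)
  obtain p where p: "p < n" "\<And>j. j < n \<Longrightarrow> l p \<le> l j"
    using obtains_MIN[of "{..<n}" l] n by (metis Min_le finite_imageI finite_lessThan image_eqI lessThan_iff lessThan_empty_iff less_numeral_extra(3))
  have less: "l p < l j" if "j < n" "j \<noteq> p" for j
    using p that inj by (metis inj_onD lessThan_iff order_le_less)
  define t where "t = (\<Sum>i<n. (l i)\<^sup>2) + 1"
  define \<beta> where "\<beta> j = t - l j" for j
  have WW: "W * W \<in> carrier_mat n n" using W by simp
  have "(W * W) *\<^sub>v u k = complex_of_real ((l k)\<^sup>2) \<cdot>\<^sub>v u k" if "k < n" for k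
    using W u[OF that] ev[OF that] assoc_mult_mat_vec[OF W W u[OF that]] mult_mat_vec[OF W u[OF that]]
    by (simp add: smult_smult_assoc power2_eq_square)
  from orthonormal_diag_trace[OF u on WW this]
  have tr: "mtrace n (W * W) = complex_of_real (t - 1)" by (simp add: t_def)
  then have tr': "mtrace n (W * W) + 1 = complex_of_real t" by simp
  let ?B = "trace_shift n W"
  have B: "?B \<in> carrier_mat n n" using W by (auto simp: trace_shift_def)
  have Bev: "?B *\<^sub>v u k = complex_of_real (\<beta> k) \<cdot>\<^sub>v u k" if "k < n" for k
  proof -
    have "?B *\<^sub>v u k = ((mtrace n (W * W) + 1) \<cdot>\<^sub>m 1\<^sub>m n) *\<^sub>v u k - W *\<^sub>v u k"
      unfolding trace_shift_def using W u[OF that] by (intro minus_mult_distrib_mat_vec) auto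
    also have "((mtrace n (W * W) + 1) \<cdot>\<^sub>m 1\<^sub>m n) *\<^sub>v u k = (mtrace n (W * W) + 1) \<cdot>\<^sub>v u k"
    proof (rule eq_vecI)
      fix i assume "i < dim_vec ((mtrace n (W * W) + 1) \<cdot>\<^sub>v u k)"
      then have i: "i < n" using u[OF that] by simp
      have "(((mtrace n (W * W) + 1) \<cdot>\<^sub>m 1\<^sub>m n) *\<^sub>v u k) $ i = (\<Sum>j<n. ((mtrace n (W * W) + 1) \<cdot>\<^sub>m 1\<^sub>m n) $$ (i, j) * u k $ j)"
        using u[OF that] i by (intro mult_mat_vec_sum) auto
      also have "\<dots> = (\<Sum>j<n. if j = i then (mtrace n (W * W) + 1) * u k $ j else 0)"
        using i by (intro sum.cong) auto
      finally show "(((mtrace n (W * W) + 1) \<cdot>\<^sub>m 1\<^sub>m n) *\<^sub>v u k) $ i = ((mtrace n (W * W) + 1) \<cdot>\<^sub>v u k) $ i"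
        using i u[OF that] by simp
    qed (use u[OF that] in auto)
    finally show ?thesis unfolding tr' ev[OF that] using u[OF that]
      by (auto simp: \<beta>_def algebra_simps intro!: eq_vecI)
  qed
  have un0: "u k \<noteq> 0\<^sub>v n" if "k < n" for k
    using on[OF that that] u[OF that] by auto
  have Bk: "?B ^\<^sub>m m \<in> carrier_mat n n" for m using B by simp
  have Bkev: "?B ^\<^sub>m m *\<^sub>v u k = complex_of_real (\<beta> k ^ m) \<cdot>\<^sub>v u k" if "k < n" for k m
    using eigenvector_pow[OF B, of "u k" "complex_of_real (\<beta> k)" m] Bev[OF that] u[OF that] un0[OF that] B
    by (auto simp: eigenvector_def)
  have trk: "Re (mtrace n (?B ^\<^sub>m m)) = (\<Sum>k<n. \<beta> k ^ m)" for m
    using orthonormal_diag_trace[OF u on Bk Bkev, of m] by simp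
  have form: "Re ((?B ^\<^sub>m m *\<^sub>v q) \<bullet>c q) = (\<Sum>k<n. \<beta> k ^ m * (cmod (u k \<bullet>c q))\<^sup>2)" if "q \<in> carrier_vec n" for q m
    using orthonormal_diag_form[OF u on Bk Bkev that, of m] by simp
  \<comment> \<open>The reason for the shift by the trace of \<open>W * W\<close> plus one: it is
    polynomial in the entries, and \<open>0 \<le> (x - 1)\<^sup>2 + x\<^sup>2\<close> gives
    \<open>x \<le> x\<^sup>2 + 1 / 2\<close>, so it exceeds every eigenvalue, whatever its
    sign.\<close>
  have \<beta>0: "0 < \<beta> j" if "j < n" for j
  proof -
    have "(l j)\<^sup>2 \<le> (\<Sum>i<n. (l i)\<^sup>2)" using that by (intro member_le_sum) auto
    moreover have "0 \<le> (l j - 1)\<^sup>2 + (l j)\<^sup>2" by simp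
    ultimately show ?thesis by (auto simp: \<beta>_def t_def power2_diff) 
  qed
  have \<beta>l: "\<beta> j < \<beta> p" if "j < n" "j \<noteq> p" for j using less[OF that] by (simp add: \<beta>_def)
  have 1: "min_overlap n W q = (cmod (u p \<bullet>c q))\<^sup>2" if "q \<in> carrier_vec n" for q
    unfolding min_overlap_def form[OF that] trk
    by (rule limI, rule dominant_power_limit[of p n \<beta>, OF p(1) less_imp_le[OF \<beta>0] \<beta>l \<beta>0[OF p(1)]])
  \<comment> \<open>With the weights \<beta> themselves the quotient is the ratio of consecutive
    traces, which tends to the dominant eigenvalue \<open>t - l p\<close>.\<close>
  have "lim (\<lambda>k. (\<Sum>j<n. \<beta> j ^ k * \<beta> j) / (\<Sum>j<n. \<beta> j ^ k)) = \<beta> p"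
    by (rule limI, rule dominant_power_limit[of p n \<beta>, OF p(1) less_imp_le[OF \<beta>0] \<beta>l \<beta>0[OF p(1)]])
  then have 2: "min_eig n W = l p"
    unfolding min_eig_def trk tr by (simp add: \<beta>_def mult.commute)
  \<comment> \<open>Every eigenpair is one of the given ones: symmetry of \<open>W\<close> makes
    \<open>e - l j\<close> annihilate the \<open>j\<close>-th coefficient of \<open>x\<close>, and
    since the \<open>l j\<close> are distinct only one coefficient survives.\<close>
  have evec: "\<exists>k<n. e = complex_of_real (l k) \<and> (\<exists>c. x = c \<cdot>\<^sub>v u k)" if x: "eigenvector W x e" for x e
  proof -
    have xc: "x \<in> carrier_vec n" and x0: "x \<noteq> 0\<^sub>v n" and Wx: "W *\<^sub>v x = e \<cdot>\<^sub>v x"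
      using x W by (auto simp: eigenvector_def)
    have herm: "(W *\<^sub>v x) \<bullet>c u k = complex_of_real (l k) * (x \<bullet>c u k)" if k: "k < n" for k
    proof -
      have "mat_adjoint W = W"
        using W by (intro eq_matI) (auto simp: orthonormal_diag_index[OF u on W ev] cnj_sum intro!: sum.cong)
      then have "(W *\<^sub>v x) \<bullet>c u k = x \<bullet>c (complex_of_real (l k) \<cdot>\<^sub>v u k)"
        using mult_mat_vec_cscalar_prod[OF W xc u[OF k]] ev[OF k] by simp
      also have "\<dots> = complex_of_real (l k) * (x \<bullet>c u k)"
        using u[OF k] by (subst (1 2) cscalar_prod_sum[of _ n]) (auto simp: sum_distrib_left intro!: sum.cong)
      finally show ?thesis .
    qed
    have expand: "x $ i = (\<Sum>k<n. (x \<bullet>c u k) * u k $ i)" if i: "i < n" for i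
    proof -
      have "x $ i = (\<Sum>j<n. x $ j * (if i = j then 1 else 0))" using i by (simp add: if_distrib cong: if_cong)
      also have "\<dots> = (\<Sum>j<n. x $ j * (\<Sum>k<n. u k $ i * cnj (u k $ j)))"
        using i by (intro sum.cong refl) (simp add: orthonormal_complete[OF u on])
      also have "\<dots> = (\<Sum>k<n. (\<Sum>j<n. x $ j * cnj (u k $ j)) * u k $ i)"
        unfolding sum_distrib_left sum_distrib_right by (subst sum.swap) (simp add: mult_ac)
      finally show ?thesis by (simp add: cscalar_prod_sum[OF u])
    qed
    have "\<exists>k<n. x \<bullet>c u k \<noteq> 0"
    proof (rule ccontr)
      assume "\<not> (\<exists>k<n. x \<bullet>c u k \<noteq> 0)"
      then have "x $ i = 0" if "i < n" for i using expand[OF that] by simp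
      then have "x = 0\<^sub>v n" using xc by (intro eq_vecI) auto
      then show False using x0 by simp
    qed
    then obtain k where k: "k < n" "x \<bullet>c u k \<noteq> 0" by auto
    have e: "e * (x \<bullet>c u j) = complex_of_real (l j) * (x \<bullet>c u j)" if "j < n" for j
      using herm[OF that] xc u[OF that] unfolding Wx by simp
    have ek: "e = complex_of_real (l k)" using e[OF k(1)] k(2) by simp
    have z: "x \<bullet>c u j = 0" if "j < n" "j \<noteq> k" for j
      using e[OF that(1)] ek inj that k(1) by (auto simp: inj_on_def)
    have "x = (x \<bullet>c u k) \<cdot>\<^sub>v u k"
    proof (rule eq_vecI)
      fix i assume "i < dim_vec ((x \<bullet>c u k) \<cdot>\<^sub>v u k)"
      then have i: "i < n" using u[OF k(1)] by simp
      have "x $ i = (\<Sum>j<n. if j = k then (x \<bullet>c u k) * u k $ i else 0)"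
        unfolding expand[OF i] using z by (intro sum.cong) auto
      then show "x $ i = ((x \<bullet>c u k) \<cdot>\<^sub>v u k) $ i" using i k(1) u[OF k(1)] by simp
    qed (use xc u[OF k(1)] in auto)
    then show ?thesis using k(1) ek by blast
  qed
  have "{r. eigenvalue W (complex_of_real r)} = l ` {..<n}"
  proof safe
    fix r assume "eigenvalue W (complex_of_real r)"
    then obtain x where "eigenvector W x (complex_of_real r)" by (auto simp: eigenvalue_def)
    from evec[OF this] show "r \<in> l ` {..<n}" by auto
  next
    fix k assume "k < n"
    then show "eigenvalue W (complex_of_real (l k))"
      using u un0 ev W by (auto simp: eigenvalue_def eigenvector_def intro!: exI[of _ "u k"])
  qed
  then have 3: "smallest_eigenvalue W = l p"
    unfolding smallest_eigenvalue_def using p by (auto intro!: Min_eqI)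
  have 4: "\<exists>c. x = c \<cdot>\<^sub>v u p" if "eigenvector W x (complex_of_real (l p))" for x
    using evec[OF that] inj p(1) by (auto simp: inj_on_def)
  show ?thesis using that p(1) less 1 2 3 4 by blast
qed

section \<open>Gram matrices and the discriminant\<close>

definition gram :: "nat \<Rightarrow> nat \<Rightarrow> (nat \<Rightarrow> complex vec) \<Rightarrow> complex mat" where
  "gram n m X = mat n n (\<lambda>(i, j). \<Sum>k<m. X k $ i * cnj (X k $ j))"

lemma gram_carrier [simp]: "gram n m X \<in> carrier_mat n n"
  by (simp add: gram_def)

lemma gram_index: "i < n \<Longrightarrow> j < n \<Longrightarrow> gram n m X $$ (i, j) = (\<Sum>k<m. X k $ i * cnj (X k $ j))"
  by (simp add: gram_def)

lemma gram_adjoint: "mat_adjoint (gram n m X) = gram n m X"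
  by (rule eq_matI) (auto simp: gram_def cnj_sum mult.commute intro!: sum.cong)

lemma gram_form:
  assumes q: "q \<in> carrier_vec n"
  shows "(gram n m X *\<^sub>v q) \<bullet>c q = complex_of_real (\<Sum>k<m. (cmod (X k \<bullet>c q))\<^sup>2)"
proof -
  have s: "(\<Sum>i<n. x $ i * cnj (q $ i)) = x \<bullet>c q" for x by (rule cscalar_prod_sum[OF q, symmetric])
  have s': "(\<Sum>j<n. cnj (x $ j) * q $ j) = cnj (x \<bullet>c q)" for x
    unfolding s[symmetric] cnj_sum by simp
  have "(gram n m X *\<^sub>v q) \<bullet>c q = (\<Sum>i<n. \<Sum>j<n. \<Sum>k<m. (X k $ i * cnj (q $ i)) * (cnj (X k $ j) * q $ j))"
    unfolding cscalar_prod_sum[OF q]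
    by (intro sum.cong refl) (auto simp: mult_mat_vec_sum[OF gram_carrier q] gram_index sum_distrib_left sum_distrib_right mult_ac intro!: sum.cong)
  also have "\<dots> = (\<Sum>k<m. \<Sum>i<n. \<Sum>j<n. (X k $ i * cnj (q $ i)) * (cnj (X k $ j) * q $ j))"
    by (subst sum.swap[of _ "{..<m}"], subst sum.swap[of _ "{..<m}"]) simp
  also have "\<dots> = (\<Sum>k<m. (X k \<bullet>c q) * cnj (X k \<bullet>c q))"
    by (simp add: sum_distrib_left[symmetric] sum_distrib_right[symmetric] s s')
  finally show ?thesis by (simp add: complex_norm_square del: of_real_power)
qed

text \<open>Up to sign the discriminant of the characteristic polynomial. Passing through
  \<open>mat n n\<close> forces dimension \<open>n\<close> on every argument, so that the degree is
  constant and the value is a polynomial in the entries.\<close>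

definition disc :: "nat \<Rightarrow> complex mat \<Rightarrow> complex" where
  "disc n W = (let p = char_poly (mat n n (\<lambda>ij. W $$ ij)) in resultant p (pderiv p))"

lemma disc_carrier: "W \<in> carrier_mat n n \<Longrightarrow> disc n W = resultant (char_poly W) (pderiv (char_poly W))"
  by (subgoal_tac "mat n n (\<lambda>ij. W $$ ij) = W") (auto simp: disc_def Let_def)

text \<open>The resultant is nonzero exactly when the polynomial and its derivative are coprime. A
  repeated entry of \<open>es\<close> yields a common linear factor; conversely, at a common root
  \<open>a\<close> the cofactor of \<open>[:- a, 1:]\<close> would have to vanish, which
  distinctness forbids.\<close>

lemma disc_factorized:
  assumes W: "W \<in> carrier_mat n n" and es: "char_poly W = (\<Prod>a\<leftarrow>es. [:- a, 1:])"
  shows "disc n W \<noteq> 0 \<longleftrightarrow> distinct es"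
proof -
  let ?p = "char_poly W"
  have p0: "?p \<noteq> 0" using degree_monic_char_poly[OF W] by auto
  have iff: "disc n W \<noteq> 0 \<longleftrightarrow> degree (gcd ?p (pderiv ?p)) = 0"
    using resultant_0_gcd[of ?p "pderiv ?p"] by (auto simp: disc_carrier[OF W])
  show ?thesis
  proof
    assume nz: "disc n W \<noteq> 0"
    show "distinct es"
    proof (rule ccontr)
      assume "\<not> distinct es"
      then obtain xs ys zs a where "es = xs @ [a] @ ys @ [a] @ zs" using not_distinct_decomp by blast
      then have "?p = [:- a, 1:] * ([:- a, 1:] * ((\<Prod>a\<leftarrow>xs. [:- a, 1:]) * (\<Prod>a\<leftarrow>ys. [:- a, 1:]) * (\<Prod>a\<leftarrow>zs. [:- a, 1:])))"
        unfolding es by (simp only: map_append prod_list.append list.map prod_list.Cons prod_list.Nil mult_ac mult_1_right mult_1_left)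
      then obtain r where r: "?p = [:- a, 1:] * ([:- a, 1:] * r)" by blast
      have "[:- a, 1:] dvd pderiv ?p" unfolding r pderiv_mult by (intro dvd_add dvd_mult dvd_mult2 dvd_refl) 
      moreover have "[:- a, 1:] dvd ?p" unfolding r by (rule dvd_triv_left)
      ultimately have "[:- a, 1:] dvd gcd ?p (pderiv ?p)" by simp
      then have "degree [:- a, 1:] \<le> degree (gcd ?p (pderiv ?p))" using p0 by (intro dvd_imp_degree_le) auto
      then show False using nz iff by simp
    qed
  next
    assume d: "distinct es"
    show "disc n W \<noteq> 0"
    proof (rule ccontr)
      assume "\<not> disc n W \<noteq> 0"
      then have "degree (gcd ?p (pderiv ?p)) \<noteq> 0" using iff by auto
      then have "\<not> constant (poly (gcd ?p (pderiv ?p)))" by (simp add: constant_degree)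
      then obtain a where "poly (gcd ?p (pderiv ?p)) a = 0" using fundamental_theorem_of_algebra by blast
      then have a: "poly ?p a = 0" "poly (pderiv ?p) a = 0"
        using dvd_trans gcd_dvd1 gcd_dvd2 unfolding poly_eq_0_iff_dvd by blast+
      then have "a \<in> set es" unfolding es by (auto simp: poly_prod_list prod_list_zero_iff o_def)
      then obtain xs zs where e: "es = xs @ a # zs" by (auto simp: in_set_conv_decomp)
      let ?r = "(\<Prod>a\<leftarrow>xs. [:- a, 1:]) * (\<Prod>a\<leftarrow>zs. [:- a, 1:])"
      have pr: "?p = [:- a, 1:] * ?r"
        unfolding es e by (simp only: map_append prod_list.append list.map prod_list.Cons mult_ac)
      have "poly (pderiv ?p) a = poly ?r a" unfolding pr pderiv_mult by (simp add: pderiv_pCons)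
      moreover have "poly ?r a \<noteq> 0" using d unfolding e by (auto simp: poly_prod_list prod_list_zero_iff o_def)
      ultimately show False using a by simp
    qed
  qed
qed

text \<open>Since the roots are distinct, one normalized eigenvector per root is enough: symmetry
  makes the eigenvalues real and eigenvectors of different eigenvalues orthogonal.\<close>

lemma hermitian_spectral:
  assumes W: "W \<in> carrier_mat n n" and herm: "mat_adjoint W = W" and d: "disc n W \<noteq> 0"
  shows "\<exists>l u. spectral n W l u"
proof -
  obtain es where es: "char_poly W = (\<Prod>a\<leftarrow>es. [:- a, 1:])" and len: "length es = n"
    using char_poly_factorized[OF W] by auto
  have dist: "distinct es" using disc_factorized[OF W es] d by simp
  have sym: "(W *\<^sub>v x) \<bullet>c y = x \<bullet>c (W *\<^sub>v y)" if "x \<in> carrier_vec n" "y \<in> carrier_vec n" for x y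
    using mult_mat_vec_cscalar_prod[OF W that] herm by simp
  have left: "(c \<cdot>\<^sub>v x) \<bullet>c y = c * (x \<bullet>c y)" and right: "x \<bullet>c (c \<cdot>\<^sub>v y) = cnj c * (x \<bullet>c y)"
    if "x \<in> carrier_vec n" "y \<in> carrier_vec n" for c :: complex and x y
    using that by (simp_all add: cscalar_prod_sum[of _ n] sum_distrib_left mult_ac)
  have "\<exists>u. u \<in> carrier_vec n \<and> u \<bullet>c u = 1 \<and> W *\<^sub>v u = es ! i \<cdot>\<^sub>v u" if i: "i < n" for i
  proof -
    have "poly (char_poly W) (es ! i) = 0"
      using i len unfolding es by (auto simp: poly_prod_list prod_list_zero_iff o_def)
    then obtain x where x: "x \<in> carrier_vec n" "x \<noteq> 0\<^sub>v n" "W *\<^sub>v x = es ! i \<cdot>\<^sub>v x"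
      using eigenvalue_root_char_poly[OF W] W by (auto simp: eigenvalue_def eigenvector_def)
    have "0 < x \<bullet>c x" using x conjugate_square_greater_0_vec by blast
    then obtain r where r: "x \<bullet>c x = complex_of_real r" "0 < r"
      by (metis less_complex_def complex_eq_iff Re_complex_of_real Im_complex_of_real zero_complex.sel)
    define s where "s = 1 / sqrt r"
    have s: "s * s * r = 1" using r(2) by (simp add: s_def field_simps)
    let ?u = "complex_of_real s \<cdot>\<^sub>v x"
    have "?u \<bullet>c ?u = complex_of_real (s * s * r)"
      using x r by (simp add: left right)
    also have "s * s * r = 1" by (rule s)
    finally have "?u \<bullet>c ?u = 1" by simp
    moreover have "W *\<^sub>v ?u = es ! i \<cdot>\<^sub>v ?u"
      using mult_mat_vec[OF W x(1)] x(3) by (simp add: smult_smult_assoc mult.commute)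
    ultimately show ?thesis using x(1) by (intro exI[of _ ?u]) auto
  qed
  then obtain u where u: "\<And>i. i < n \<Longrightarrow> u i \<in> carrier_vec n" "\<And>i. i < n \<Longrightarrow> u i \<bullet>c u i = 1"
    "\<And>i. i < n \<Longrightarrow> W *\<^sub>v u i = es ! i \<cdot>\<^sub>v u i" by metis
  have eq: "es ! i * (u i \<bullet>c u j) = cnj (es ! j) * (u i \<bullet>c u j)" if "i < n" "j < n" for i j
    using sym[OF u(1)[OF that(1)] u(1)[OF that(2)]] u(1,3) that by (simp add: left right)
  have real: "es ! i = complex_of_real (Re (es ! i))" if "i < n" for i
    using eq[OF that that] u(2)[OF that] by (auto simp: complex_eq_iff)
  have orth: "u i \<bullet>c u j = 0" if "i < n" "j < n" "i \<noteq> j" for i j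
  proof -
    have "es ! i \<noteq> cnj (es ! j)" using real[OF that(2)] dist that len
      by (metis complex_cnj_complex_of_real nth_eq_iff_index_eq)
    then show ?thesis using eq[OF that(1,2)] by simp
  qed
  have "inj_on (\<lambda>i. Re (es ! i)) {..<n}"
    using real dist len by (intro inj_onI) (metis lessThan_iff nth_eq_iff_index_eq)
  then have "spectral n W (\<lambda>i. Re (es ! i)) u"
    unfolding spectral_def using W u orth real by metis
  then show ?thesis by blast
qed

text \<open>The Leibniz formula uses only sums, products and constants. The class \<open>P\<close>
  is kept abstract so that polynomiality along lines, measurability and a class of polynomials
  defined by their coefficients are covered at once.\<close>

lemma det_closed:
  fixes A :: "'z \<Rightarrow> 'a :: comm_ring_1 mat"
  assumes P: "\<And>c. P (\<lambda>_. c)" "\<And>f g. P f \<Longrightarrow> P g \<Longrightarrow> P (\<lambda>z. f z + g z)" "\<And>f g. P f \<Longrightarrow> P g \<Longrightarrow> P (\<lambda>z. f z * g z)"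
    and A: "\<And>z. A z \<in> carrier_mat n n" and e: "\<And>i j. i < n \<Longrightarrow> j < n \<Longrightarrow> P (\<lambda>z. A z $$ (i, j))"
  shows "P (\<lambda>z. det (A z))"
proof -
  have sum: "P (\<lambda>z. \<Sum>i\<in>I. f i z)" if "\<And>i. i \<in> I \<Longrightarrow> P (f i)" for I :: "'i set" and f
    using that by (induction I rule: infinite_finite_induct) (auto intro: P)
  have prod: "P (\<lambda>z. \<Prod>i\<in>I. f i z)" if "\<And>i. i \<in> I \<Longrightarrow> P (f i)" for I :: "'i set" and f
    using that by (induction I rule: infinite_finite_induct) (auto intro: P)
  have "det (A z) = (\<Sum>p | p permutes {0..<n}. signof p * (\<Prod>i = 0..<n. A z $$ (i, p i)))" for z
    using A[of z] by (simp add: det_def)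
  moreover have "P (\<lambda>z. \<Sum>p | p permutes {0..<n}. signof p * (\<Prod>i = 0..<n. A z $$ (i, p i)))"
  proof (intro sum P(3) prod)
    fix p i assume "p \<in> {p. p permutes {0..<n}}" "i \<in> {0..<n}"
    then show "P (\<lambda>z. A z $$ (i, p i))" by (intro e) (auto dest: permutes_in_image[of _ "{0..<n}" i])
  qed (rule P(1))
  ultimately show ?thesis by simp
qed

text \<open>The discriminant is a determinant built from coefficients of another determinant, so
  closure is applied twice: to polynomials all of whose coefficients lie in \<open>P\<close>, and to
  \<open>P\<close> itself for the Sylvester matrix.\<close>

lemma disc_closed:
  fixes A :: "'z \<Rightarrow> complex mat"
  assumes P: "\<And>c. P (\<lambda>_. c)" "\<And>f g. P f \<Longrightarrow> P g \<Longrightarrow> P (\<lambda>z. f z + g z)" "\<And>f g. P f \<Longrightarrow> P g \<Longrightarrow> P (\<lambda>z. f z * g z)"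
    and e: "\<And>i j. i < n \<Longrightarrow> j < n \<Longrightarrow> P (\<lambda>z. A z $$ (i, j))"
  shows "P (\<lambda>z. disc n (A z))"
proof -
  let ?A = "\<lambda>z. mat n n (\<lambda>ij. A z $$ ij)"
  let ?p = "\<lambda>z. char_poly (?A z)"
  define Q where "Q F \<longleftrightarrow> (\<forall>k. P (\<lambda>z. coeff (F z) k))" for F :: "'z \<Rightarrow> complex poly"
  have sum: "P (\<lambda>z. \<Sum>i\<in>I. f i z)" if "\<And>i. i \<in> I \<Longrightarrow> P (f i)" for I :: "nat set" and f
    using that by (induction I rule: infinite_finite_induct) (auto intro: P)
  have Q: "Q ?p" unfolding char_poly_def
  proof (rule det_closed[where n = n and P = Q and A = "\<lambda>z. char_poly_matrix (?A z)"])
    show "Q (\<lambda>z. f z * g z)" if "Q f" "Q g" for f g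
      using that unfolding Q_def coeff_mult by (intro allI sum P(3)) auto
    fix i j assume ij: "i < n" "j < n"
    have "P (\<lambda>z. coeff ((if i = j then [:0, 1:] else 0) + [:- 1:] * [:A z $$ (i, j):]) k)" for k
      using P(3)[OF P(1)[of "-1"] e[OF ij]] P(1) by (cases k) (auto simp: coeff_pCons split: nat.split intro: P)
    moreover have "char_poly_matrix (?A z) $$ (i, j) = (if i = j then [:0, 1:] else 0) + [:- 1:] * [:A z $$ (i, j):]" for z
      using ij by (simp add: char_poly_matrix_def)
    ultimately show "Q (\<lambda>z. char_poly_matrix (?A z) $$ (i, j))"
      by (simp only: Q_def) blast
  qed (auto simp: Q_def P intro!: char_poly_matrix_closed)
  \<comment> \<open>The constant degree fixes the size of the Sylvester matrix and lets a single
    index formula describe its entries for all \<open>z\<close>.\<close>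
  have deg: "degree (?p z) = n" for z using degree_monic_char_poly[of "?A z" n] by auto
  have Q': "P (\<lambda>z. coeff (pderiv (?p z)) k)" for k
    unfolding coeff_pderiv using Q by (intro P) (auto simp: Q_def)
  have "P (\<lambda>z. det (sylvester_mat (?p z) (pderiv (?p z))))"
  proof (rule det_closed[where n = "n + (n - 1)" and P = P and A = "\<lambda>z. sylvester_mat (?p z) (pderiv (?p z))"])
    show "sylvester_mat (?p z) (pderiv (?p z)) \<in> carrier_mat (n + (n - 1)) (n + (n - 1))" for z
      by (intro carrier_matI) (auto simp: deg degree_pderiv)
    fix i j assume "i < n + (n - 1)" "j < n + (n - 1)"
    then have "sylvester_mat (?p z) (pderiv (?p z)) $$ (i, j) =
        (if i < n - 1 then if i \<le> j \<and> j - i \<le> n then coeff (?p z) (n + i - j) else 0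
         else if i - (n - 1) \<le> j \<and> j \<le> i then coeff (pderiv (?p z)) (i - j) else 0)" for z
      using sylvester_index_mat[of i "?p z" "pderiv (?p z)" j] by (simp only: deg degree_pderiv)
    moreover have "P (\<lambda>z. if c then f z else g z)" if "P f" "P g" for c f g
      using that by (cases c) auto
    ultimately show "P (\<lambda>z. sylvester_mat (?p z) (pderiv (?p z)) $$ (i, j))"
      using Q Q' P(1) by (simp only: Q_def)
  qed (auto simp: P)
  then show ?thesis by (simp add: disc_def resultant_def Let_def)
qed

lemma line_poly_disc:
  assumes "\<And>i j. i < n \<Longrightarrow> j < n \<Longrightarrow> line_poly (\<lambda>z. A z $$ (i, j))"
  shows "line_poly (\<lambda>z. disc n (A z))"
  by (rule disc_closed[where P = line_poly]) (auto intro: line_poly_const line_poly_add line_poly_mult assms)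

lemma borel_measurable_disc:
  assumes "\<And>i j. i < n \<Longrightarrow> j < n \<Longrightarrow> (\<lambda>z. A z $$ (i, j)) \<in> borel_measurable M"
  shows "(\<lambda>z. disc n (A z)) \<in> borel_measurable M"
  by (rule disc_closed[where P = "\<lambda>f. f \<in> borel_measurable M"]) (auto intro: assms)

section \<open>Almost sure simplicity of the spectrum\<close>

abbreviation cnormal_cols :: "nat \<Rightarrow> nat \<Rightarrow> (nat \<Rightarrow> complex vec) measure" where
  "cnormal_cols n m \<equiv> PiM {..<m} (\<lambda>_. std_cnormal n)"

lemma col_measurable: "k < m \<Longrightarrow> (\<lambda>X. X k) \<in> cnormal_cols n m \<rightarrow>\<^sub>M borel_cvec n"
  using measurable_component_singleton[of k "{..<m}" "\<lambda>_. std_cnormal n"] by simp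

lemma gram_index_measurable:
  "i < n \<Longrightarrow> j < n \<Longrightarrow> (\<lambda>X. gram n m X $$ (i, j)) \<in> borel_measurable (cnormal_cols n m)"
proof -
  assume ij: "i < n" "j < n"
  have "(\<lambda>X. \<Sum>k<m. X k $ i * cnj (X k $ j)) \<in> borel_measurable (cnormal_cols n m)"
    by (intro borel_measurable_sum borel_measurable_times borel_measurable_cnj
        measurable_compose[OF col_measurable borel_cvec_index]) (use ij in auto)
  then show ?thesis using ij by (simp add: gram_index)
qed

lemma gram_in_borel_cmat: "gram n m \<in> cnormal_cols n m \<rightarrow>\<^sub>M borel_cmat n n"
  by (rule measurable_borel_cmatI) (auto intro: gram_index_measurable)

lemma prob_space_cnormal_cols: "prob_space (cnormal_cols n m)"
  by (intro prob_space_PiM prob_space_std_cnormal)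

lemma product_sigma_finite_std_cnormal: "product_sigma_finite (\<lambda>_. std_cnormal n)"
  by (intro product_sigma_finite.intro prob_space_imp_sigma_finite prob_space_std_cnormal)

lemma line_poly_gram_entry:
  assumes ij: "i < n" "j < n"
  shows "line_poly (\<lambda>z. gram n m (X(k := vec n (x(p := z)))) $$ (i, j))"
proof -
  have e: "line_poly (\<lambda>z. (X(k := vec n (x(p := z)))) l $ i)" if "i < n" for l i
    using that line_poly_ident line_poly_const by (cases "l = k"; cases "i = p") auto
  show ?thesis unfolding gram_index[OF ij]
    by (intro line_poly_sum line_poly_mult line_poly_cnj e ij)
qed

lemma AE_std_cnormal_vec:
  assumes "AE x in PiM {..<n} (\<lambda>_. lborel). P (vec n x)" "Measurable.pred (borel_cvec n) P"
  shows "AE x in std_cnormal n. P x"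
proof -
  have "AE x in lborel_cvec n. P x"
    unfolding lborel_cvec_def using assms
    by (subst AE_distr_iff[OF vec_measurable]) (auto simp: pred_def)
  then show ?thesis
    unfolding std_cnormal_def using std_cnormal_density_measurable by (subst AE_density) auto
qed

text \<open>The discriminant is a polynomial in the entries of the columns and their conjugates,
  hence almost surely nonzero as soon as it is nonzero for one choice of columns.\<close>

lemma AE_disc_gram:
  assumes "n \<le> m"
  shows "AE X in cnormal_cols n m. disc n (gram n m X) \<noteq> 0"
proof (rule AE_PiM_nonzero[where a = "\<lambda>k\<in>{..<m}. vec n (\<lambda>i. if i = k then complex_of_real (sqrt (k + 1)) else 0)"])
  show "product_sigma_finite (\<lambda>_::nat. std_cnormal n)" by (rule product_sigma_finite_std_cnormal)
  show meas: "(\<lambda>X. disc n (gram n m X)) \<in> borel_measurable (cnormal_cols n m)"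
    by (intro borel_measurable_disc gram_index_measurable)
  \<comment> \<open>Column \<open>k\<close> is \<open>sqrt (k + 1)\<close> times the
    \<open>k\<close>-th unit vector, and zero for k \<ge> n. As n \<le> m, the Gram matrix is
    diagonal with the distinct entries 1, ..., n.\<close>
  let ?a = "\<lambda>k\<in>{..<m}. vec n (\<lambda>i. if i = k then complex_of_real (sqrt (k + 1)) else 0)"
  show "?a \<in> space (cnormal_cols n m)" by (auto simp: space_PiM)
  have "gram n m ?a = mat n n (\<lambda>(i, j). if i = j then complex_of_real (i + 1) else 0)"
  proof (rule eq_matI)
    fix i j assume "i < dim_row (mat n n (\<lambda>(i, j). if i = j then complex_of_real (i + 1) else 0))"
      "j < dim_col (mat n n (\<lambda>(i, j). if i = j then complex_of_real (i + 1) else 0))"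
    then have ij: "i < n" "j < n" by auto
    have "gram n m ?a $$ (i, j) = (\<Sum>k<m. if k = i then (if i = j then complex_of_real (sqrt (i + 1) * sqrt (i + 1)) else 0) else 0)"
      unfolding gram_index[OF ij] using ij by (intro sum.cong) (auto simp flip: of_real_mult)
    then show "gram n m ?a $$ (i, j) = mat n n (\<lambda>(i, j). if i = j then complex_of_real (i + 1) else 0) $$ (i, j)"
      using ij assms by simp
  qed (auto simp: gram_def)
  then have eq: "gram n m ?a = mat n n (\<lambda>(i, j). if i = j then complex_of_real (i + 1) else 0)" .
  let ?es = "map (\<lambda>i. complex_of_real (i + 1)) [0..<n]"
  have diag: "diag_mat (gram n m ?a) = ?es" unfolding eq by (auto simp: diag_mat_def)
  have "char_poly (gram n m ?a) = (\<Prod>a\<leftarrow>?es. [:- a, 1:])"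
    unfolding diag[symmetric] by (rule char_poly_upper_triangular[of _ n]) (auto simp: eq)
  moreover have "distinct ?es" by (auto simp: distinct_map inj_on_def simp flip: of_nat_Suc)
  ultimately show "disc n (gram n m ?a) \<noteq> 0" by (subst disc_factorized) auto
  fix X k assume X: "X \<in> space (cnormal_cols n m)" and k: "k \<in> {..<m}"
  let ?f = "\<lambda>t. disc n (gram n m (X(k := t)))"
  have upd: "(\<lambda>t. X(k := t)) \<in> std_cnormal n \<rightarrow>\<^sub>M cnormal_cols n m"
  proof -
    have "(\<lambda>t. X(k := t)) \<in> std_cnormal n \<rightarrow>\<^sub>M PiM (insert k {..<m}) (\<lambda>_. std_cnormal n)"
      using X by (intro measurable_fun_upd[where J = "{..<m}"]) auto
    then show ?thesis using k by (simp add: insert_absorb)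
  qed
  have fmeas: "?f \<in> borel_measurable (borel_cvec n)"
    using measurable_compose[OF upd meas] by simp
  show "(\<forall>t\<in>space (std_cnormal n). ?f t = 0) \<or> (AE t in std_cnormal n. ?f t \<noteq> 0)"
  proof (cases "\<forall>t\<in>carrier_vec n. ?f t = 0")
    case False
    then obtain t0 where t0: "t0 \<in> carrier_vec n" "?f t0 \<noteq> 0" by auto
    have vt0: "vec n (\<lambda>i\<in>{..<n}. t0 $ i) = t0" using t0 by (intro eq_vecI) auto
    \<comment> \<open>The same principle one level down: the column \<open>t0\<close> with a nonzero
      value becomes the witness for the product over its entries.\<close>
    have "AE x in PiM {..<n} (\<lambda>_. lborel). ?f (vec n x) \<noteq> 0"
    proof (rule AE_PiM_nonzero[where a = "\<lambda>i\<in>{..<n}. t0 $ i"])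
      show "product_sigma_finite (\<lambda>_::nat. lborel :: complex measure)" by standard
      show fv: "(\<lambda>x. ?f (vec n x)) \<in> borel_measurable (PiM {..<n} (\<lambda>_. lborel))"
        by (rule measurable_compose[OF vec_measurable fmeas])
      show "?f (vec n (\<lambda>i\<in>{..<n}. t0 $ i)) \<noteq> 0" unfolding vt0 by (rule t0)
      fix x i assume x: "x \<in> space (PiM {..<n} (\<lambda>_. lborel :: complex measure))" and i: "i \<in> {..<n}"
      let ?g = "\<lambda>z. ?f (vec n (x(i := z)))"
      have lp: "line_poly ?g"
        by (intro line_poly_disc line_poly_gram_entry)
      have "(\<lambda>z. x(i := z)) \<in> lborel \<rightarrow>\<^sub>M PiM (insert i {..<n}) (\<lambda>_. lborel)"
        using x by (intro measurable_fun_upd[where J = "{..<n}"]) auto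
      then have "(\<lambda>z. x(i := z)) \<in> lborel \<rightarrow>\<^sub>M PiM {..<n} (\<lambda>_. lborel)" using i by (simp add: insert_absorb)
      from measurable_compose[OF this fv] have gm: "?g \<in> borel_measurable borel" by simp
      show "(\<forall>z\<in>space lborel. ?g z = 0) \<or> (AE z in lborel. ?g z \<noteq> 0)"
        using AE_line_poly_nonzero[OF lp gm] by auto
    qed (auto simp: space_PiM)
    then have "AE t in std_cnormal n. ?f t \<noteq> 0"
    proof (rule AE_std_cnormal_vec)
      show "Measurable.pred (borel_cvec n) (\<lambda>t. ?f t \<noteq> 0)" using fmeas by measurable
    qed
    then show ?thesis ..
  qed simp
qed simp

lemma AE_spectral_gram:
  assumes "n \<le> m"
  shows "AE X in cnormal_cols n m. \<exists>l u. spectral n (gram n m X) l u"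
  using AE_disc_gram[OF assms] by (rule AE_mp) (auto intro!: AE_I2 hermitian_spectral gram_adjoint)

section \<open>Spherical caps\<close>

lemma nn_integral_lborel_cvec_axis:
  assumes f: "f \<in> borel_measurable (borel_cvec n)" and n: "0 < n"
  shows "(\<integral>\<^sup>+x. f x \<partial>lborel_cvec n) =
    (\<integral>\<^sup>+x. (\<integral>\<^sup>+z. f (vec n (x(0 := z))) \<partial>lborel) \<partial>PiM {1..<n} (\<lambda>_. lborel))"
proof -
  have ins: "{..<n} = insert 0 {1..<n}" using n by auto
  have "(\<lambda>x. f (vec n x)) \<in> borel_measurable (PiM {..<n} (\<lambda>_. lborel))"
    by (rule measurable_compose[OF vec_measurable f])
  then show ?thesis
    unfolding nn_integral_lborel_cvec[OF f] unfolding ins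
    by (subst lborel_product.product_nn_integral_insert) auto
qed

lemma nn_integral_complex_scale:
  assumes [measurable]: "f \<in> borel_measurable borel" and s: "0 < s"
  shows "(\<integral>\<^sup>+(z::complex). f (of_real s * z) \<partial>lborel) = ennreal (1 / s\<^sup>2) * (\<integral>\<^sup>+z. f z \<partial>lborel)"
proof -
  have "(\<integral>\<^sup>+z. f z \<partial>lborel) = (\<integral>\<^sup>+z. f z \<partial>density (distr lborel borel (\<lambda>x. 0 + s *\<^sub>R x)) (\<lambda>_. ennreal (\<bar>s\<bar> ^ DIM(complex))))"
    using lborel_affine[of s "0::complex"] s by simp
  also have "\<dots> = ennreal (s\<^sup>2) * (\<integral>\<^sup>+(z::complex). f (of_real s * z) \<partial>lborel)"
    using s by (simp add: nn_integral_density nn_integral_distr nn_integral_cmult scaleR_conv_of_real)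
  finally show ?thesis
    using s by (simp add: mult.assoc[symmetric] ennreal_mult[symmetric])
qed

lemma nn_integral_PiM_complex_scale:
  fixes I :: "nat set"
  assumes "finite I" "f \<in> borel_measurable (PiM I (\<lambda>_. lborel))" and s: "0 < s"
  shows "(\<integral>\<^sup>+x. f (\<lambda>i\<in>I. complex_of_real s * x i) \<partial>PiM I (\<lambda>_. lborel)) =
    ennreal ((1 / s\<^sup>2) ^ card I) * (\<integral>\<^sup>+x. f x \<partial>PiM I (\<lambda>_. lborel))"
  using assms(1,2)
proof (induction I arbitrary: f rule: finite_induct)
  case empty
  then show ?case by (simp add: PiM_empty nn_integral_count_space_finite restrict_def)
next
  case (insert i I)
  note [measurable] = insert.prems
  let ?P = "\<lambda>I. PiM I (\<lambda>_::nat. lborel :: complex measure)"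
  interpret I: finite_product_sigma_finite "\<lambda>_::nat. lborel :: complex measure" I by standard (rule insert.hyps)
  have sc[measurable]: "(\<lambda>x. \<lambda>i\<in>J. complex_of_real s * x i) \<in> ?P J \<rightarrow>\<^sub>M ?P J" for J
    by measurable
  have upd: "(\<lambda>t. x(i := t)) \<in> lborel \<rightarrow>\<^sub>M ?P (insert i I)" if "x \<in> space (?P I)" for x
    using that by (intro measurable_fun_upd[where J = I]) auto
  have fs: "(\<lambda>x. f (\<lambda>j\<in>insert i I. complex_of_real s * x j)) \<in> borel_measurable (?P (insert i I))"
    by measurable
  have "(\<integral>\<^sup>+x. f (\<lambda>j\<in>insert i I. complex_of_real s * x j) \<partial>?P (insert i I))
      = (\<integral>\<^sup>+x. (\<integral>\<^sup>+t. f (\<lambda>j\<in>insert i I. complex_of_real s * (x(i := t)) j) \<partial>lborel) \<partial>?P I)"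
    by (rule lborel_product.product_nn_integral_insert[OF insert.hyps fs])
  also have "\<dots> = (\<integral>\<^sup>+x. ennreal (1 / s\<^sup>2) * (\<integral>\<^sup>+t. f ((\<lambda>j\<in>I. complex_of_real s * x j)(i := t)) \<partial>lborel) \<partial>?P I)"
  proof (rule nn_integral_cong)
    fix x assume x: "x \<in> space (?P I)"
    have "(\<lambda>j\<in>insert i I. complex_of_real s * (x(i := t)) j) = (\<lambda>j\<in>I. complex_of_real s * x j)(i := complex_of_real s * t)" for t
      using insert.hyps by (auto simp: fun_eq_iff)
    moreover have "(\<lambda>t. f ((\<lambda>j\<in>I. complex_of_real s * x j)(i := t))) \<in> borel_measurable borel"
      using measurable_compose[OF upd insert.prems] measurable_space[OF sc x] by simp
    ultimately show "(\<integral>\<^sup>+t. f (\<lambda>j\<in>insert i I. complex_of_real s * (x(i := t)) j) \<partial>lborel)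
        = ennreal (1 / s\<^sup>2) * (\<integral>\<^sup>+t. f ((\<lambda>j\<in>I. complex_of_real s * x j)(i := t)) \<partial>lborel)"
      using nn_integral_complex_scale[of "\<lambda>t. f ((\<lambda>j\<in>I. complex_of_real s * x j)(i := t))", OF _ s]
      by (simp del: fun_upd_apply)
  qed
  also have "\<dots> = ennreal (1 / s\<^sup>2) * (\<integral>\<^sup>+x. (\<integral>\<^sup>+t. f ((\<lambda>j\<in>I. complex_of_real s * x j)(i := t)) \<partial>lborel) \<partial>?P I)"
    by (rule nn_integral_cmult) measurable
  also have "(\<integral>\<^sup>+x. (\<integral>\<^sup>+t. f ((\<lambda>j\<in>I. complex_of_real s * x j)(i := t)) \<partial>lborel) \<partial>?P I)
      = ennreal ((1 / s\<^sup>2) ^ card I) * (\<integral>\<^sup>+x. (\<integral>\<^sup>+t. f (x(i := t)) \<partial>lborel) \<partial>?P I)"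
    by (rule insert.IH) measurable
  also have "(\<integral>\<^sup>+x. (\<integral>\<^sup>+t. f (x(i := t)) \<partial>lborel) \<partial>?P I) = (\<integral>\<^sup>+x. f x \<partial>?P (insert i I))"
    by (rule lborel_product.product_nn_integral_insert[OF insert.hyps insert.prems, symmetric])
  finally show ?case
    using insert.hyps by (simp add: ennreal_mult[symmetric] mult.assoc[symmetric])
qed

text \<open>The substitution \<open>r = y + a T'\<close>, \<open>T = (1 - a) T'\<close>, \<open>Q = (1 - a) Q'\<close> leaves \<open>r + T\<close> invariant and
  maps the cap \<open>r > a (r + T)\<close> onto the whole half-line.\<close>

lemma nn_integral_cap_radial:
  fixes a T Q l c d :: real
  assumes a: "0 \<le> a" "a < 1" and T: "0 \<le> T"
  shows "(\<integral>\<^sup>+r. ennreal (exp (- (r + T)) / d) * (indicator {r. r > a * (r + T)} r * ennreal (exp (c * ((l * r + Q) / (r + T))))) * indicator {0..} r \<partial>lborel)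
    = (\<integral>\<^sup>+y. ennreal (exp (- (y + T / (1 - a))) / d) *
        ennreal (exp (c * (l * a + (1 - a) * ((l * y + Q / (1 - a)) / (y + T / (1 - a)))))) * indicator {0..} y \<partial>lborel)"
proof -
  \<comment> \<open>The boundary of the cap: \<open>b\<close> solves
    \<open>r = a * (r + T)\<close>.\<close>
  define b where "b = a * T / (1 - a)"
  have bT: "b + T = T / (1 - a)" using a by (simp add: b_def field_simps)
  have b0: "0 \<le> b" using a T by (simp add: b_def)
  let ?f = "\<lambda>r. ennreal (exp (- (r + T)) / d) * (indicator {r. r > a * (r + T)} r * ennreal (exp (c * ((l * r + Q) / (r + T))))) * indicator {0..} r"
  have "(\<integral>\<^sup>+r. ?f r \<partial>lborel) = (\<integral>\<^sup>+y. ?f (b + y) \<partial>lborel)"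
    using nn_integral_real_affine[of ?f 1 b] by simp
  also have "\<dots> = (\<integral>\<^sup>+y. ennreal (exp (- (y + T / (1 - a))) / d) *
        ennreal (exp (c * (l * a + (1 - a) * ((l * y + Q / (1 - a)) / (y + T / (1 - a)))))) * indicator {0..} y \<partial>lborel)"
  \<comment> \<open>The point 0 has to be excluded: there the strict cap inequality fails, while the
    indicator of the closed half-line is one.\<close>
  proof (rule nn_integral_cong_AE, rule AE_mp[OF AE_lborel_singleton[of 0]], rule AE_I2, rule impI)
    fix y :: real assume y: "y \<noteq> 0"
    have sum: "b + y + T = y + T / (1 - a)" using bT by simp
    have "a * (b + y + T) = b + a * y" unfolding sum using a by (simp add: b_def field_simps)
    then have iff: "b + y > a * (b + y + T) \<longleftrightarrow> y > 0"
      using a by (auto simp: mult_less_cancel_right2 zero_less_mult_iff)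
    show "?f (b + y) = ennreal (exp (- (y + T / (1 - a))) / d) *
        ennreal (exp (c * (l * a + (1 - a) * ((l * y + Q / (1 - a)) / (y + T / (1 - a)))))) * indicator {0..} y"
    proof (cases "y > 0")
      case True
      define S where "S = y + T / (1 - a)"
      have "0 \<le> T / (1 - a)" using a T by simp
      then have S: "S > 0" using True by (simp add: S_def)
      have "l * (b + y) + Q = l * a * S + (1 - a) * (l * y + Q / (1 - a))"
      proof -
        have "(1 - a) * (l * y + Q / (1 - a)) = (1 - a) * (l * y) + Q" using a by (simp add: distrib_left)
        moreover have "a * S = a * y + b" by (simp add: S_def b_def distrib_left)
        then have "l * a * S = l * (a * y + b)" by simp
        ultimately show ?thesis by (simp add: algebra_simps)
      qed
      then have "(l * (b + y) + Q) / S = l * a + (1 - a) * ((l * y + Q / (1 - a)) / S)"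
      proof -
        have "(l * a * S + k * B) / S = l * a + k * (B / S)" for k B using S by (simp add: add_divide_distrib)
        with \<open>l * (b + y) + Q = _\<close> show ?thesis by metis
      qed
      moreover have "indicator {r. r > a * (r + T)} (b + y) = (1 :: ennreal)"
        using True iff by (simp add: indicator_def)
      ultimately show ?thesis
        using True b0 unfolding sum S_def[symmetric] by simp
    next
      case False
      then show ?thesis using y iff by simp
    qed
  qed
  finally show ?thesis .
qed

text \<open>The radial substitution is made in the squared modulus of coordinate 0, the others being
  fixed. It leaves \<open>T\<close> and \<open>K\<close> divided by \<open>1 - a\<close>; both are
  homogeneous of degree two, so a scaling of the other n - 1 complex coordinates by
  \<open>1 / sqrt (1 - a)\<close> absorbs this, and its Jacobian is the factor
  \<open>(1 - a) ^ (n - 1)\<close>.\<close>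

lemma nn_integral_cap_axis:
  fixes a c l :: real and K :: "(nat \<Rightarrow> complex) \<Rightarrow> real"
  assumes a: "0 \<le> a" "a < 1" and n: "0 < n"
    and K[measurable]: "K \<in> borel_measurable (PiM {1..<n} (\<lambda>_. lborel))"
    and hom: "\<And>s x. K (\<lambda>i\<in>{1..<n}. complex_of_real s * x i) = s\<^sup>2 * K x"
    and F: "F \<in> borel_measurable (borel_cvec n)" "\<And>x. x \<in> carrier_vec n \<Longrightarrow> F x =
        indicator {x. (cmod (x $ 0))\<^sup>2 > a * sq_norm_cvec x} x *
        ennreal (exp (c * ((l * (cmod (x $ 0))\<^sup>2 + K (\<lambda>i\<in>{1..<n}. x $ i)) / sq_norm_cvec x)))"
    and G: "G \<in> borel_measurable (borel_cvec n)" "\<And>x. x \<in> carrier_vec n \<Longrightarrow> G x =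
        ennreal (exp (c * (l * a + (1 - a) * ((l * (cmod (x $ 0))\<^sup>2 + K (\<lambda>i\<in>{1..<n}. x $ i)) / sq_norm_cvec x))))"
  shows "(\<integral>\<^sup>+x. F x \<partial>std_cnormal n) = ennreal ((1 - a) ^ (n - 1)) * (\<integral>\<^sup>+x. G x \<partial>std_cnormal n)"
proof -
  let ?P = "PiM {1..<n} (\<lambda>_::nat. lborel :: complex measure)"
  define T where "T x = (\<Sum>i\<in>{1..<n}. (cmod (x i))\<^sup>2)" for x :: "nat \<Rightarrow> complex"
  have T[measurable]: "T \<in> borel_measurable ?P" unfolding T_def by measurable
  have T0: "0 \<le> T x" for x by (auto simp: T_def intro: sum_nonneg)
  have Thom: "T (\<lambda>i\<in>{1..<n}. complex_of_real s * x i) = s\<^sup>2 * T x" for s x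
    by (simp add: T_def norm_mult power_mult_distrib sum_distrib_left)
  have ins: "{..<n} = insert 0 {1..<n}" using n by auto
  have sq: "sq_norm_cvec (vec n (x(0 := z))) = (cmod z)\<^sup>2 + T x" for x z
    unfolding sq_norm_cvec_def dim_vec T_def ins using n by (subst sum.insert) auto
  have restr: "(\<lambda>i\<in>{1..<n}. vec n (x(0 := z)) $ i) = x" if "x \<in> space ?P" for x z
    using that by (auto simp: space_PiM PiE_def extensional_def fun_eq_iff)
  let ?d = "pi ^ n"
  define \<Phi> where "\<Phi> x r = ennreal (exp (- (r + T x)) / ?d) *
      (indicator {r. r > a * (r + T x)} r * ennreal (exp (c * ((l * r + K x) / (r + T x)))))" for x r
  define \<Psi> where "\<Psi> x r = ennreal (exp (- (r + T x)) / ?d) *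
      ennreal (exp (c * (l * a + (1 - a) * ((l * r + K x) / (r + T x)))))" for x r
  have \<Psi>m[measurable]: "case_prod \<Psi> \<in> borel_measurable (?P \<Otimes>\<^sub>M borel)"
    unfolding \<Psi>_def split_beta' by measurable
  have \<Psi>m'[measurable]: "\<Psi> x \<in> borel_measurable borel" for x
    unfolding \<Psi>_def by measurable
  have \<Phi>m[measurable]: "\<Phi> x \<in> borel_measurable borel" for x
    unfolding \<Phi>_def by measurable
  have Fz: "ennreal (exp (- sq_norm_cvec y) / ?d) * F y = \<Phi> x ((cmod z)\<^sup>2)"
    and Gz: "ennreal (exp (- sq_norm_cvec y) / ?d) * G y = \<Psi> x ((cmod z)\<^sup>2)"
    if x: "x \<in> space ?P" and y: "y = vec n (x(0 := z))" for x y z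
    using F(2)[of y] G(2)[of y] sq[of x z] restr[OF x, of z] n unfolding y
    by (auto simp: \<Phi>_def \<Psi>_def indicator_def)
  have dF: "(\<lambda>x. ennreal (exp (- sq_norm_cvec x) / ?d) * F x) \<in> borel_measurable (borel_cvec n)"
    and dG: "(\<lambda>x. ennreal (exp (- sq_norm_cvec x) / ?d) * G x) \<in> borel_measurable (borel_cvec n)"
    by (intro borel_measurable_times_ennreal std_cnormal_density_measurable F G)+
  have "(\<integral>\<^sup>+x. F x \<partial>std_cnormal n) = (\<integral>\<^sup>+x. (\<integral>\<^sup>+z. \<Phi> x ((cmod z)\<^sup>2) \<partial>lborel) \<partial>?P)"
    unfolding nn_integral_std_cnormal[OF F(1)] nn_integral_lborel_cvec_axis[OF dF n]
    using Fz by (intro nn_integral_cong) simp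
  also have "\<dots> = (\<integral>\<^sup>+x. ennreal pi * (\<integral>\<^sup>+r. \<Phi> x r * indicator {0..} r \<partial>lborel) \<partial>?P)"
    by (intro nn_integral_cong nn_integral_cmod_square) measurable
  also have "\<dots> = (\<integral>\<^sup>+x. ennreal pi * (\<integral>\<^sup>+r. \<Psi> (\<lambda>i\<in>{1..<n}. complex_of_real (1 / sqrt (1 - a)) * x i) r * indicator {0..} r \<partial>lborel) \<partial>?P)"
  proof (rule nn_integral_cong, rule arg_cong2[where f = "(*)"], rule refl)
    fix x
    show "(\<integral>\<^sup>+r. \<Phi> x r * indicator {0..} r \<partial>lborel)
        = (\<integral>\<^sup>+r. \<Psi> (\<lambda>i\<in>{1..<n}. complex_of_real (1 / sqrt (1 - a)) * x i) r * indicator {0..} r \<partial>lborel)"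
      unfolding \<Phi>_def \<Psi>_def hom Thom nn_integral_cap_radial[OF a T0] using a
      by (simp add: power_divide)
  qed
  also have "\<dots> = ennreal ((1 / (1 / sqrt (1 - a))\<^sup>2) ^ card {1..<n}) * (\<integral>\<^sup>+x. ennreal pi * (\<integral>\<^sup>+r. \<Psi> x r * indicator {0..} r \<partial>lborel) \<partial>?P)"
    by (rule nn_integral_PiM_complex_scale, simp, measurable, use a in simp)
  also have "(1 / (1 / sqrt (1 - a))\<^sup>2) ^ card {1..<n} = (1 - a) ^ (n - 1)"
    using a by (simp add: power_divide)
  also have "(\<integral>\<^sup>+x. ennreal pi * (\<integral>\<^sup>+r. \<Psi> x r * indicator {0..} r \<partial>lborel) \<partial>?P) = (\<integral>\<^sup>+x. (\<integral>\<^sup>+z. \<Psi> x ((cmod z)\<^sup>2) \<partial>lborel) \<partial>?P)"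
    by (intro nn_integral_cong nn_integral_cmod_square[symmetric]) measurable
  also have "\<dots> = (\<integral>\<^sup>+x. G x \<partial>std_cnormal n)"
    unfolding nn_integral_std_cnormal[OF G(1)] nn_integral_lborel_cvec_axis[OF dG n]
    using Gz by (intro nn_integral_cong) simp
  finally show ?thesis .
qed

lemma cscalar_prod_smult:
  fixes c :: complex
  assumes "x \<in> carrier_vec n" "y \<in> carrier_vec n"
  shows "(c \<cdot>\<^sub>v x) \<bullet>c y = c * (x \<bullet>c y)" "x \<bullet>c (c \<cdot>\<^sub>v y) = cnj c * (x \<bullet>c y)"
  using assms by (simp_all add: cscalar_prod_sum[of _ n] sum_distrib_left mult_ac)

lemma mult_mat_unit_vec_index:
  fixes A :: "complex mat"
  assumes A: "A \<in> carrier_mat n n" and ij: "i < n" "j < n"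
  shows "(A *\<^sub>v unit_vec n j) $ i = A $$ (i, j)"
proof -
  have "(A *\<^sub>v unit_vec n j) $ i = (\<Sum>k<n. A $$ (i, k) * unit_vec n j $ k)"
    using ij by (intro mult_mat_vec_sum[OF A]) auto
  also have "\<dots> = (\<Sum>k<n. if k = j then A $$ (i, k) else 0)"
    using ij by (intro sum.cong) auto
  finally show ?thesis using ij by simp
qed

lemma cscalar_prod_unit_vec:
  assumes "x \<in> carrier_vec n" "i < n"
  shows "unit_vec n i \<bullet>c x = cnj (x $ i)"
proof -
  have "unit_vec n i \<bullet>c x = (\<Sum>k<n. unit_vec n i $ k * cnj (x $ k))"
    using assms by (intro cscalar_prod_sum)
  also have "\<dots> = (\<Sum>k<n. if k = i then cnj (x $ k) else 0)"
    using assms by (intro sum.cong) auto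
  finally show ?thesis using assms by simp
qed

lemma cscalar_prod_unit_vec_right:
  fixes x :: "complex vec"
  assumes "x \<in> carrier_vec n" "i < n"
  shows "x \<bullet>c unit_vec n i = x $ i"
proof -
  have "x \<bullet>c unit_vec n i = (\<Sum>k<n. x $ k * cnj (unit_vec n i $ k))"
    by (intro cscalar_prod_sum) auto
  also have "\<dots> = (\<Sum>k<n. if k = i then x $ k else 0)"
    using assms by (intro sum.cong) auto
  finally show ?thesis using assms by simp
qed

text \<open>If the first axis is an eigenvector of a Hermitian matrix, the first row and column
  vanish off the diagonal and the form has no mixed terms.\<close>

lemma hermitian_axis_form:
  fixes W :: "complex mat" and l :: real
  assumes W: "W \<in> carrier_mat n n" and herm: "mat_adjoint W = W" and n: "0 < n"
    and ev: "W *\<^sub>v unit_vec n 0 = complex_of_real l \<cdot>\<^sub>v unit_vec n 0" and x: "x \<in> carrier_vec n"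
  shows "Re ((W *\<^sub>v x) \<bullet>c x) = l * (cmod (x $ 0))\<^sup>2
    + Re (\<Sum>i\<in>{1..<n}. \<Sum>j\<in>{1..<n}. W $$ (i, j) * x $ j * cnj (x $ i))"
proof -
  have col: "W $$ (i, 0) = (if i = 0 then complex_of_real l else 0)" if i: "i < n" for i
    using mult_mat_unit_vec_index[OF W i n] i n unfolding ev by (auto split: if_splits)
  have row: "W $$ (0, j) = (if j = 0 then complex_of_real l else 0)" if j: "j < n" for j
  proof -
    have "W $$ (0, j) = cnj (W $$ (j, 0))" using index_mat_adjoint[of 0 W j] W n j herm by simp
    then show ?thesis using col[OF j] by simp
  qed
  have ins: "{..<n} = insert 0 {1..<n}" using n by auto
  have split: "(\<Sum>i<n. f i) = f 0 + (\<Sum>i\<in>{1..<n}. f i)" for f :: "nat \<Rightarrow> complex"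
    unfolding ins by simp
  have "(W *\<^sub>v x) \<bullet>c x = (\<Sum>i<n. \<Sum>j<n. W $$ (i, j) * x $ j * cnj (x $ i))"
    by (simp add: cscalar_prod_sum[OF x] mult_mat_vec_sum[OF W x] sum_distrib_right cong: sum.cong_simp)
  also have "\<dots> = W $$ (0, 0) * x $ 0 * cnj (x $ 0) + (\<Sum>j\<in>{1..<n}. W $$ (0, j) * x $ j * cnj (x $ 0))
      + (\<Sum>i\<in>{1..<n}. W $$ (i, 0) * x $ 0 * cnj (x $ i) + (\<Sum>j\<in>{1..<n}. W $$ (i, j) * x $ j * cnj (x $ i)))"
    unfolding split ..
  also have "\<dots> = complex_of_real (l * (cmod (x $ 0))\<^sup>2) + (\<Sum>i\<in>{1..<n}. \<Sum>j\<in>{1..<n}. W $$ (i, j) * x $ j * cnj (x $ i))"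
    using n by (simp add: col row complex_norm_square del: of_real_power)
  finally show ?thesis by simp
qed

text \<open>Conditionally on \<open>|u\<^sup>\<dagger> \<xi>|\<^sup>2 > a |\<xi>|\<^sup>2\<close>, a uniform direction has the law of \<open>a\<close> times the axis \<open>u\<close>
  plus \<open>1 - a\<close> times a uniform direction, as far as squared moduli along \<open>u\<close> and quadratic forms
  with eigenvector \<open>u\<close> are concerned.\<close>

lemma nn_integral_cap:
  fixes W :: "complex mat" and a c l :: real
  assumes a: "0 \<le> a" "a < 1"
    and W: "W \<in> carrier_mat n n" and herm: "mat_adjoint W = W"
    and u: "u \<in> carrier_vec n" "u \<bullet>c u = 1" and ev: "W *\<^sub>v u = complex_of_real l \<cdot>\<^sub>v u"
  shows "(\<integral>\<^sup>+x. indicator {x. (cmod (u \<bullet>c x))\<^sup>2 > a * sq_norm_cvec x} x *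
        ennreal (exp (c * (Re ((W *\<^sub>v x) \<bullet>c x) / sq_norm_cvec x))) \<partial>std_cnormal n)
    = ennreal ((1 - a) ^ (n - 1)) *
      (\<integral>\<^sup>+x. ennreal (exp (c * (l * a + (1 - a) * (Re ((W *\<^sub>v x) \<bullet>c x) / sq_norm_cvec x)))) \<partial>std_cnormal n)"
proof -
  obtain U \<mu> where U: "rotation n U" "U *\<^sub>v u = \<mu> \<cdot>\<^sub>v unit_vec n 0" "cmod \<mu> = 1" and n: "0 < n"
    by (rule rotation_unit_vec[OF u])
  have Uc: "U \<in> carrier_mat n n" and Uc': "mat_adjoint U \<in> carrier_mat n n"
    using rotation_carrier[OF U(1)] by auto
  have iso: "isometry n U" using U(1) by (simp add: rotation_def)
  note UU = isometry_adjoint[OF iso]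
  \<comment> \<open>The matrix \<open>W\<close> in coordinates where \<open>u\<close> lies on the
    first axis. The phase \<mu> cancels in the eigenvector equation and in the overlap.\<close>
  define V where "V = U * W * mat_adjoint U"
  have V: "V \<in> carrier_mat n n" using Uc Uc' W by (simp add: V_def)
  have VU: "V *\<^sub>v (U *\<^sub>v x) = U *\<^sub>v (W *\<^sub>v x)" if x: "x \<in> carrier_vec n" for x
  proof -
    have "V *\<^sub>v (U *\<^sub>v x) = (V * U) *\<^sub>v x" by (rule assoc_mult_mat_vec[OF V Uc x, symmetric])
    also have "V * U = U * W * (mat_adjoint U * U)"
      unfolding V_def by (rule assoc_mult_mat[OF mult_carrier_mat[OF Uc W] Uc' Uc])
    also have "\<dots> = U * W" unfolding UU by (rule right_mult_one_mat[OF mult_carrier_mat[OF Uc W]])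
    also have "(U * W) *\<^sub>v x = U *\<^sub>v (W *\<^sub>v x)" by (rule assoc_mult_mat_vec[OF Uc W x])
    finally show ?thesis .
  qed
  have form: "(V *\<^sub>v (U *\<^sub>v x)) \<bullet>c (U *\<^sub>v x) = (W *\<^sub>v x) \<bullet>c x" if x: "x \<in> carrier_vec n" for x
    unfolding VU[OF x] using rotation_cscalar_prod[OF U(1) _ x, of "W *\<^sub>v x"] W x by simp
  have onto: "\<exists>x \<in> carrier_vec n. U *\<^sub>v x = y" if y: "y \<in> carrier_vec n" for y
  proof (rule bexI[of _ "mat_adjoint U *\<^sub>v y"])
    have "U *\<^sub>v (mat_adjoint U *\<^sub>v y) = (U * mat_adjoint U) *\<^sub>v y"
      by (rule assoc_mult_mat_vec[OF Uc Uc' y, symmetric])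
    then show "U *\<^sub>v (mat_adjoint U *\<^sub>v y) = y" using UU(2) y by simp
  qed (rule mult_mat_vec_carrier[OF Uc' y])
  have Vsym: "(V *\<^sub>v x) \<bullet>c y = x \<bullet>c (V *\<^sub>v y)" if x: "x \<in> carrier_vec n" and y: "y \<in> carrier_vec n" for x y
  proof -
    from onto[OF x] obtain x' where x': "x' \<in> carrier_vec n" "x = U *\<^sub>v x'" by (elim bexE) simp
    from onto[OF y] obtain y' where y': "y' \<in> carrier_vec n" "y = U *\<^sub>v y'" by (elim bexE) simp
    have "(V *\<^sub>v x) \<bullet>c y = (W *\<^sub>v x') \<bullet>c y'"
      unfolding x'(2) y'(2) VU[OF x'(1)] using W x' y' by (intro rotation_cscalar_prod[OF U(1)]) auto
    also have "\<dots> = x' \<bullet>c (W *\<^sub>v y')" using mult_mat_vec_cscalar_prod[OF W x'(1) y'(1)] herm by simp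
    also have "\<dots> = x \<bullet>c (V *\<^sub>v y)"
      unfolding x'(2) y'(2) VU[OF y'(1)] using W x' y' by (intro rotation_cscalar_prod[OF U(1), symmetric]) auto
    finally show ?thesis .
  qed
  have Vherm: "mat_adjoint V = V"
  proof (rule eq_matI)
    fix i j assume "i < dim_row V" "j < dim_col V"
    then have ij: "i < n" "j < n" using V by auto
    note e = mult_mat_unit_vec_index[OF V]
    have "V $$ (i, j) = (V *\<^sub>v unit_vec n j) \<bullet>c unit_vec n i"
      using V ij by (subst cscalar_prod_unit_vec_right) (auto simp: e)
    also have "\<dots> = unit_vec n j \<bullet>c (V *\<^sub>v unit_vec n i)" by (rule Vsym) auto
    also have "\<dots> = cnj (V $$ (j, i))" using V ij by (subst cscalar_prod_unit_vec) (auto simp: e)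
    finally show "mat_adjoint V $$ (i, j) = V $$ (i, j)" using V ij by simp
  qed (use V in auto)
  have \<mu>: "\<mu> * cnj \<mu> = 1" using U(3) complex_norm_square[of \<mu>] by simp
  have Vev: "V *\<^sub>v unit_vec n 0 = complex_of_real l \<cdot>\<^sub>v unit_vec n 0"
  proof -
    have "unit_vec n 0 = cnj \<mu> \<cdot>\<^sub>v (U *\<^sub>v u)" unfolding U(2) using \<mu> by (simp add: smult_smult_assoc mult.commute)
    then have "V *\<^sub>v unit_vec n 0 = cnj \<mu> \<cdot>\<^sub>v (V *\<^sub>v (U *\<^sub>v u))"
      using mult_mat_vec[OF V mult_mat_vec_carrier[OF Uc u(1)]] by simp
    also have "\<dots> = cnj \<mu> \<cdot>\<^sub>v (complex_of_real l \<cdot>\<^sub>v (U *\<^sub>v u))"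
      unfolding VU[OF u(1)] ev using mult_mat_vec[OF Uc u(1)] by simp
    also have "\<dots> = complex_of_real l \<cdot>\<^sub>v (cnj \<mu> \<cdot>\<^sub>v (U *\<^sub>v u))" by (simp add: smult_smult_assoc mult.commute)
    also have "cnj \<mu> \<cdot>\<^sub>v (U *\<^sub>v u) = unit_vec n 0" unfolding U(2) using \<mu> by (simp add: smult_smult_assoc mult.commute)
    finally show ?thesis .
  qed
  have overlap: "(cmod (u \<bullet>c x))\<^sup>2 = (cmod ((U *\<^sub>v x) $ 0))\<^sup>2" if x: "x \<in> carrier_vec n" for x
  proof -
    have Ux: "U *\<^sub>v x \<in> carrier_vec n" using Uc x by simp
    have "u \<bullet>c x = (\<mu> \<cdot>\<^sub>v unit_vec n 0) \<bullet>c (U *\<^sub>v x)"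
      using rotation_cscalar_prod[OF U(1) u(1) x] U(2) by simp
    also have "\<dots> = \<mu> * cnj ((U *\<^sub>v x) $ 0)"
      using cscalar_prod_smult(1)[OF unit_vec_carrier Ux, of \<mu> 0] cscalar_prod_unit_vec[OF Ux n] by simp
    finally show ?thesis using U(3) by (simp add: norm_mult)
  qed
  define K where "K x = Re (\<Sum>i\<in>{1..<n}. \<Sum>j\<in>{1..<n}. V $$ (i, j) * x j * cnj (x i))" for x
  define F where "F x = indicator {x. (cmod (x $ 0))\<^sup>2 > a * sq_norm_cvec x} x *
        ennreal (exp (c * (Re ((V *\<^sub>v x) \<bullet>c x) / sq_norm_cvec x)))" for x
  define G where "G x = ennreal (exp (c * (l * a + (1 - a) * (Re ((V *\<^sub>v x) \<bullet>c x) / sq_norm_cvec x))))" for x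
  have Kx: "Re ((V *\<^sub>v x) \<bullet>c x) = l * (cmod (x $ 0))\<^sup>2 + K (\<lambda>i\<in>{1..<n}. x $ i)" if "x \<in> carrier_vec n" for x
    unfolding hermitian_axis_form[OF V Vherm n Vev that] K_def by simp
  note [measurable] = cvec_measurable_sq_norm[OF measurable_ident_sets[OF refl], of n]
    quadratic_form_measurable[OF V] borel_cvec_index[OF n]
  have Fm: "F \<in> borel_measurable (borel_cvec n)" unfolding F_def by measurable
  have Gm: "G \<in> borel_measurable (borel_cvec n)" unfolding G_def by measurable
  have main: "(\<integral>\<^sup>+x. F x \<partial>std_cnormal n) = ennreal ((1 - a) ^ (n - 1)) * (\<integral>\<^sup>+x. G x \<partial>std_cnormal n)"
  proof (rule nn_integral_cap_axis[OF a n _ _ Fm _ Gm])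
    show "K \<in> borel_measurable (PiM {1..<n} (\<lambda>_. lborel))" unfolding K_def
      by (intro measurable_compose[OF _ borel_measurable_Re] borel_measurable_sum borel_measurable_times
          borel_measurable_cnj measurable_compose[OF measurable_component_singleton[where M = "\<lambda>_. lborel"] measurable_ident_sets]) auto
    show "K (\<lambda>i\<in>{1..<n}. complex_of_real s * x i) = s\<^sup>2 * K x" for s x
      unfolding K_def by (simp add: sum_distrib_left power2_eq_square mult_ac)
  qed (auto simp: F_def G_def Kx)
  have "(\<integral>\<^sup>+x. F (U *\<^sub>v x) \<partial>std_cnormal n) = ennreal ((1 - a) ^ (n - 1)) * (\<integral>\<^sup>+x. G (U *\<^sub>v x) \<partial>std_cnormal n)"
    unfolding nn_integral_std_cnormal_rotation[OF U(1) Fm] nn_integral_std_cnormal_rotation[OF U(1) Gm] by (rule main)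
  then show ?thesis
    by (simp add: F_def G_def form overlap sq_norm_cvec_rotation[OF U(1)] indicator_def cong: nn_integral_cong_simp)
qed

section \<open>Averaging over the spike direction\<close>

lemma cmat_index_measurable:
  assumes "f \<in> M \<rightarrow>\<^sub>M borel_cmat n m" "i < n" "j < m"
  shows "(\<lambda>x. f x $$ (i, j)) \<in> borel_measurable M"
proof -
  have "(\<lambda>A. \<lambda>p\<in>{..<n} \<times> {..<m}. A $$ p) \<in> borel_cmat n m \<rightarrow>\<^sub>M PiM ({..<n} \<times> {..<m}) (\<lambda>_. borel)"
    unfolding borel_cmat_def by (rule measurable_vimage_algebra1) (auto simp: space_PiM)
  from measurable_compose[OF assms(1) measurable_compose[OF this measurable_component_singleton[of "(i, j)"]]] assms(2,3)
  show ?thesis by simp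
qed

lemma cmat_carrier:
  "f \<in> M \<rightarrow>\<^sub>M borel_cmat n m \<Longrightarrow> x \<in> space M \<Longrightarrow> f x \<in> carrier_mat n m"
  using measurable_space[of f M "borel_cmat n m" x] by (simp add: space_borel_cmat)

lemma cvec_carrier:
  "f \<in> M \<rightarrow>\<^sub>M borel_cvec n \<Longrightarrow> x \<in> space M \<Longrightarrow> f x \<in> carrier_vec n"
  using measurable_space[of f M "borel_cvec n" x] by (simp add: space_borel_cvec)

lemma cmat_measurable_mult:
  assumes f: "f \<in> M \<rightarrow>\<^sub>M borel_cmat n n" and g: "g \<in> M \<rightarrow>\<^sub>M borel_cmat n n"
  shows "(\<lambda>x. f x * g x) \<in> M \<rightarrow>\<^sub>M borel_cmat n n"
proof (rule measurable_borel_cmatI)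
  fix i j assume ij: "i < n" "j < n"
  have "(\<lambda>x. \<Sum>k<n. f x $$ (i, k) * g x $$ (k, j)) \<in> borel_measurable M"
    by (intro borel_measurable_sum borel_measurable_times cmat_index_measurable[OF f] cmat_index_measurable[OF g]) (use ij in auto)
  then show "(\<lambda>x. (f x * g x) $$ (i, j)) \<in> borel_measurable M"
    by (rule measurable_cong[THEN iffD1, rotated])
       (simp add: mat_mult_index_sum[OF cmat_carrier[OF f] cmat_carrier[OF g] ij])
qed (use cmat_carrier[OF f] cmat_carrier[OF g] in \<open>auto intro!: mult_carrier_mat\<close>)

lemma cmat_measurable_mtrace:
  assumes "f \<in> M \<rightarrow>\<^sub>M borel_cmat n n"
  shows "(\<lambda>x. mtrace n (f x)) \<in> borel_measurable M"
  unfolding mtrace_def by (intro borel_measurable_sum cmat_index_measurable[OF assms]) auto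

lemma cmat_measurable_pow:
  assumes f: "f \<in> M \<rightarrow>\<^sub>M borel_cmat n n"
  shows "(\<lambda>x. f x ^\<^sub>m k) \<in> M \<rightarrow>\<^sub>M borel_cmat n n"
proof (induction k)
  case 0
  have "(\<lambda>x. 1\<^sub>m n) \<in> M \<rightarrow>\<^sub>M borel_cmat n n" by (simp add: space_borel_cmat)
  then show ?case
    by (rule measurable_cong[THEN iffD1, rotated]) (use cmat_carrier[OF f] in auto)
next
  case (Suc k)
  then show ?case using cmat_measurable_mult[OF Suc f] by simp
qed

lemma cmat_measurable_trace_shift:
  assumes f: "f \<in> M \<rightarrow>\<^sub>M borel_cmat n n"
  shows "(\<lambda>x. trace_shift n (f x)) \<in> M \<rightarrow>\<^sub>M borel_cmat n n"
proof (rule measurable_borel_cmatI)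
  fix i j assume ij: "i < n" "j < n"
  have "(\<lambda>x. (mtrace n (f x * f x) + 1) * (if i = j then 1 else 0) - f x $$ (i, j)) \<in> borel_measurable M"
    by (intro borel_measurable_diff borel_measurable_times borel_measurable_add borel_measurable_const
        cmat_measurable_mtrace[OF cmat_measurable_mult[OF f f]] cmat_index_measurable[OF f ij])
  then show "(\<lambda>x. trace_shift n (f x) $$ (i, j)) \<in> borel_measurable M"
    by (rule measurable_cong[THEN iffD1, rotated]) (simp add: trace_shift_def ij carrier_matD[OF cmat_carrier[OF f]])
qed (auto simp: trace_shift_def intro!: minus_carrier_mat cmat_carrier[OF f])

lemma cmat_measurable_form:
  assumes f: "f \<in> M \<rightarrow>\<^sub>M borel_cmat n n" and q: "q \<in> M \<rightarrow>\<^sub>M borel_cvec n"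
  shows "(\<lambda>x. (f x *\<^sub>v q x) \<bullet>c q x) \<in> borel_measurable M"
proof (rule cvec_measurable_cscalar_prod[OF _ q], rule measurable_borel_cvecI)
  fix i assume i: "i < n"
  have "(\<lambda>x. \<Sum>j<n. f x $$ (i, j) * q x $ j) \<in> borel_measurable M"
    by (intro borel_measurable_sum borel_measurable_times cmat_index_measurable[OF f]
        measurable_compose[OF q borel_cvec_index]) (use i in auto)
  then show "(\<lambda>x. (f x *\<^sub>v q x) $ i) \<in> borel_measurable M"
    by (rule measurable_cong[THEN iffD1, rotated])
       (simp add: mult_mat_vec_sum[OF cmat_carrier[OF f] cvec_carrier[OF q] i])
qed (use cmat_carrier[OF f] cvec_carrier[OF q] in \<open>auto intro!: mult_mat_vec_carrier\<close>)

lemma measurable_min_overlap: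
  assumes f: "f \<in> M \<rightarrow>\<^sub>M borel_cmat n n" and q: "q \<in> M \<rightarrow>\<^sub>M borel_cvec n"
  shows "(\<lambda>x. min_overlap n (f x) (q x)) \<in> borel_measurable M"
  unfolding min_overlap_def
  by (intro borel_measurable_lim_metric borel_measurable_divide measurable_compose[OF _ borel_measurable_Re]
      cmat_measurable_mtrace[OF cmat_measurable_pow[OF cmat_measurable_trace_shift[OF f]]]
      cmat_measurable_form[OF cmat_measurable_pow[OF cmat_measurable_trace_shift[OF f]] q])

lemma measurable_min_eig:
  assumes f: "f \<in> M \<rightarrow>\<^sub>M borel_cmat n n"
  shows "(\<lambda>x. min_eig n (f x)) \<in> borel_measurable M"
  unfolding min_eig_def
  by (intro borel_measurable_lim_metric borel_measurable_divide borel_measurable_diff borel_measurable_add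
      borel_measurable_const measurable_compose[OF _ borel_measurable_Re]
      cmat_measurable_mtrace[OF cmat_measurable_pow[OF cmat_measurable_trace_shift[OF f]]]
      cmat_measurable_mtrace[OF cmat_measurable_mult[OF f f]])

text \<open>The law \<open>\<C>\<N>\<^sub>n(0, I + \<theta> v v\<^sup>\<dagger>)\<close> has density \<open>exp (c |v\<^sup>\<dagger> x|\<^sup>2) / (1 + \<theta>)\<close> with respect to
  \<open>\<C>\<N>\<^sub>n(0, I)\<close>, where \<open>c = \<theta> / (1 + \<theta>)\<close>; this is its product over the columns.\<close>

definition spike_energy :: "nat \<Rightarrow> (nat \<Rightarrow> complex vec) \<Rightarrow> complex vec \<Rightarrow> real" where
  "spike_energy m X q = (\<Sum>k<m. (cmod (X k \<bullet>c q))\<^sup>2)"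

definition spike_weight :: "real \<Rightarrow> nat \<Rightarrow> (nat \<Rightarrow> complex vec) \<Rightarrow> complex vec \<Rightarrow> ennreal" where
  "spike_weight \<theta> m X q = ennreal (exp (\<theta> / (1 + \<theta>) * spike_energy m X q) / (1 + \<theta>) ^ m)"

lemma spike_energy_measurable:
  assumes f: "\<And>k. k < m \<Longrightarrow> (\<lambda>x. f x k) \<in> M \<rightarrow>\<^sub>M borel_cvec n" and q: "q \<in> M \<rightarrow>\<^sub>M borel_cvec n"
  shows "(\<lambda>x. spike_energy m (f x) (q x)) \<in> borel_measurable M"
  unfolding spike_energy_def
  by (intro borel_measurable_sum borel_measurable_power borel_measurable_norm[THEN measurable_compose[rotated]]
      cvec_measurable_cscalar_prod[OF f q]) auto

lemma spike_weight_measurable: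
  assumes f: "\<And>k. k < m \<Longrightarrow> (\<lambda>x. f x k) \<in> M \<rightarrow>\<^sub>M borel_cvec n" and q: "q \<in> M \<rightarrow>\<^sub>M borel_cvec n"
  shows "(\<lambda>x. spike_weight \<theta> m (f x) (q x)) \<in> borel_measurable M"
  using spike_energy_measurable[OF assms] unfolding spike_weight_def by measurable

lemma col_carrier: "X \<in> space (cnormal_cols n m) \<Longrightarrow> k < m \<Longrightarrow> X k \<in> carrier_vec n"
  by (auto simp: space_PiM)

lemma spike_energy_rotation:
  assumes "rotation n U" "X \<in> space (cnormal_cols n m)" "q \<in> carrier_vec n"
  shows "spike_energy m (\<lambda>k\<in>{..<m}. U *\<^sub>v X k) (U *\<^sub>v q) = spike_energy m X q"
  unfolding spike_energy_def using assms
  by (intro sum.cong) (auto simp: rotation_cscalar_prod col_carrier)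

lemma spike_energy_phase:
  assumes "cmod \<mu> = 1" "X \<in> space (cnormal_cols n m)" "q \<in> carrier_vec n"
  shows "spike_energy m X (\<mu> \<cdot>\<^sub>v q) = spike_energy m X q"
  unfolding spike_energy_def using assms
  by (intro sum.cong) (auto simp: cscalar_prod_smult[OF col_carrier] norm_mult)

lemma nn_integral_cnormal_cols_rotation:
  assumes U: "rotation n U" and H: "H \<in> borel_measurable (cnormal_cols n m)"
  shows "(\<integral>\<^sup>+X. H (\<lambda>k\<in>{..<m}. U *\<^sub>v X k) \<partial>cnormal_cols n m) = (\<integral>\<^sup>+X. H X \<partial>cnormal_cols n m)"
proof -
  have p: "product_prob_space (\<lambda>_::nat. std_cnormal n)"
    by (intro product_prob_spaceI prob_space_std_cnormal)
  have m: "(\<lambda>x. U *\<^sub>v x) \<in> std_cnormal n \<rightarrow>\<^sub>M std_cnormal n" using rotation_measurable[OF U] by simp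
  have "distr (cnormal_cols n m) (cnormal_cols n m) (compose {..<m} (\<lambda>x. U *\<^sub>v x))
      = PiM {..<m} (\<lambda>_. distr (std_cnormal n) (std_cnormal n) (\<lambda>x. U *\<^sub>v x))"
    by (rule distr_PiM_finite_prob_space[OF _ p p m]) auto
  also have "\<dots> = cnormal_cols n m" unfolding distr_std_cnormal_rotation[OF U] ..
  finally have d: "distr (cnormal_cols n m) (cnormal_cols n m) (compose {..<m} (\<lambda>x. U *\<^sub>v x)) = cnormal_cols n m" .
  have "(\<integral>\<^sup>+X. H X \<partial>cnormal_cols n m) = (\<integral>\<^sup>+X. H X \<partial>distr (cnormal_cols n m) (cnormal_cols n m) (compose {..<m} (\<lambda>x. U *\<^sub>v x)))"
    unfolding d ..
  also have "\<dots> = (\<integral>\<^sup>+X. H (compose {..<m} (\<lambda>x. U *\<^sub>v x) X) \<partial>cnormal_cols n m)"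
    unfolding compose_def
    by (intro nn_integral_distr measurable_restrict measurable_compose[OF measurable_component_singleton[of _ "{..<m}" "\<lambda>_. std_cnormal n"] m])
      (simp_all add: H)
  finally show ?thesis by (simp add: compose_def)
qed

text \<open>Uniform on the unit sphere when \<open>x\<close> is standard Gaussian. The zero vector
  is sent to zero, because division by zero gives zero.\<close>

definition direction :: "complex vec \<Rightarrow> complex vec" where
  "direction x = complex_of_real (1 / sqrt (sq_norm_cvec x)) \<cdot>\<^sub>v x"

lemma direction_carrier: "x \<in> carrier_vec n \<Longrightarrow> direction x \<in> carrier_vec n"
  by (simp add: direction_def)

lemma direction_unit:
  "sq_norm_cvec x \<noteq> 0 \<Longrightarrow> direction x \<bullet>c direction x = 1"
proof -
  assume n: "sq_norm_cvec x \<noteq> 0"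
  then have p: "0 < sq_norm_cvec x" using sq_norm_cvec_nonneg[of x] by linarith
  define s where "s = 1 / sqrt (sq_norm_cvec x)"
  have "direction x \<bullet>c direction x = complex_of_real (s * s * sq_norm_cvec x)"
    unfolding direction_def s_def[symmetric]
    by (subst cscalar_prod_smult[of _ "dim_vec x"], simp_all, subst cscalar_prod_smult[of _ "dim_vec x"], simp_all add: cscalar_prod_self)
  also have "s * s * sq_norm_cvec x = 1"
    using p by (simp add: s_def field_simps)
  finally show ?thesis by simp
qed

lemma cmod_direction:
  assumes "x \<in> carrier_vec n" "y \<in> carrier_vec n"
  shows "(cmod (y \<bullet>c direction x))\<^sup>2 = (cmod (y \<bullet>c x))\<^sup>2 / sq_norm_cvec x"
  unfolding direction_def using assms
  by (subst cscalar_prod_smult[of _ n]) (auto simp: norm_mult norm_divide power_divide)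

lemma direction_measurable: "direction \<in> borel_cvec n \<rightarrow>\<^sub>M borel_cvec n"
proof (rule measurable_borel_cvecI)
  fix i assume i: "i < n"
  note [measurable] = cvec_measurable_sq_norm[OF measurable_ident_sets[OF refl], of n] borel_cvec_index[OF i]
  have "(\<lambda>x. complex_of_real (1 / sqrt (sq_norm_cvec x)) * x $ i) \<in> borel_measurable (borel_cvec n)"
    by measurable
  then show "(\<lambda>x. direction x $ i) \<in> borel_measurable (borel_cvec n)"
    by (rule measurable_cong[THEN iffD1, rotated]) (use i in \<open>auto simp: direction_def space_borel_cvec\<close>)
qed (auto simp: direction_def space_borel_cvec)

text \<open>Turns the energy into the Rayleigh quotient of the cap identity. At x = 0 both sides are
  zero.\<close>

lemma spike_energy_direction:
  assumes X: "X \<in> space (cnormal_cols n m)" and x: "x \<in> carrier_vec n"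
  shows "spike_energy m X (direction x) = Re ((gram n m X *\<^sub>v x) \<bullet>c x) / sq_norm_cvec x"
  unfolding spike_energy_def gram_form[OF x] Re_complex_of_real sum_divide_distrib
  by (intro sum.cong refl cmod_direction[OF x] col_carrier[OF X]) auto

text \<open>A rotation-invariant weighted integral does not depend on the spike direction, so the spike may
  be replaced by the direction of an independent Gaussian vector.\<close>

lemma nn_integral_spike_average:
  assumes v: "v \<in> carrier_vec n" "v \<bullet>c v = 1" and n: "0 < n"
    and F: "case_prod F \<in> borel_measurable (cnormal_cols n m \<Otimes>\<^sub>M borel_cvec n)"
    and rot: "\<And>U q. rotation n U \<Longrightarrow> q \<in> carrier_vec n \<Longrightarrow>
        AE X in cnormal_cols n m. F (\<lambda>k\<in>{..<m}. U *\<^sub>v X k) (U *\<^sub>v q) = F X q"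
    and phase: "\<And>\<mu> q. cmod \<mu> = 1 \<Longrightarrow> q \<in> carrier_vec n \<Longrightarrow> AE X in cnormal_cols n m. F X (\<mu> \<cdot>\<^sub>v q) = F X q"
  shows "(\<integral>\<^sup>+X. spike_weight \<theta> m X v * F X v \<partial>cnormal_cols n m) =
    (\<integral>\<^sup>+X. (\<integral>\<^sup>+x. spike_weight \<theta> m X (direction x) * F X (direction x) \<partial>std_cnormal n) \<partial>cnormal_cols n m)"
proof -
  interpret C: prob_space "cnormal_cols n m" by (rule prob_space_cnormal_cols)
  interpret S: prob_space "std_cnormal n" by (rule prob_space_std_cnormal)
  interpret CS: pair_sigma_finite "std_cnormal n" "cnormal_cols n m" ..
  define \<Phi> where "\<Phi> q = (\<integral>\<^sup>+X. spike_weight \<theta> m X q * F X q \<partial>cnormal_cols n m)" for q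
  have meas: "(\<lambda>X. spike_weight \<theta> m X q * F X q) \<in> borel_measurable (cnormal_cols n m)" if q: "q \<in> carrier_vec n" for q
  proof (intro borel_measurable_times_ennreal spike_weight_measurable[where f = "\<lambda>X. X"])
    show "(\<lambda>X. F X q) \<in> borel_measurable (cnormal_cols n m)"
      using measurable_compose[OF measurable_Pair2'[of q "borel_cvec n"] F] q by (simp add: space_borel_cvec)
    show "(\<lambda>x. q) \<in> cnormal_cols n m \<rightarrow>\<^sub>M borel_cvec n" using q by (simp add: space_borel_cvec)
    show "(\<lambda>X. X k) \<in> cnormal_cols n m \<rightarrow>\<^sub>M borel_cvec n" if "k < m" for k by (rule col_measurable[OF that])
  qed
  have \<Phi>rot: "\<Phi> (U *\<^sub>v q) = \<Phi> q" if U: "rotation n U" and q: "q \<in> carrier_vec n" for U q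
  proof -
    have Uq: "U *\<^sub>v q \<in> carrier_vec n" using rotation_carrier[OF U] q by simp
    have "\<Phi> (U *\<^sub>v q) = (\<integral>\<^sup>+X. spike_weight \<theta> m (\<lambda>k\<in>{..<m}. U *\<^sub>v X k) (U *\<^sub>v q) * F (\<lambda>k\<in>{..<m}. U *\<^sub>v X k) (U *\<^sub>v q) \<partial>cnormal_cols n m)"
      unfolding \<Phi>_def by (rule nn_integral_cnormal_cols_rotation[OF U meas[OF Uq], symmetric])
    also have "\<dots> = \<Phi> q" unfolding \<Phi>_def
    \<comment> \<open>The weight is exactly invariant, as it depends on inner products only. For
      \<open>F\<close> invariance is demanded only almost everywhere, because the spectral limits
      are under control only where the spectrum is simple.\<close>
    proof (rule nn_integral_cong_AE, rule AE_mp[OF rot[OF U q]], rule AE_I2, rule impI)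
      fix X assume X: "X \<in> space (cnormal_cols n m)"
        and e: "F (\<lambda>k\<in>{..<m}. U *\<^sub>v X k) (U *\<^sub>v q) = F X q"
      show "spike_weight \<theta> m (\<lambda>k\<in>{..<m}. U *\<^sub>v X k) (U *\<^sub>v q) * F (\<lambda>k\<in>{..<m}. U *\<^sub>v X k) (U *\<^sub>v q) = spike_weight \<theta> m X q * F X q"
        unfolding e spike_weight_def spike_energy_rotation[OF U X q] ..
    qed
    finally show ?thesis .
  qed
  \<comment> \<open>Rotations reach the first axis from every unit vector, so \<Phi> is constant on
    the sphere; averaging a constant over random directions then changes nothing.\<close>
  have \<Phi>axis: "\<Phi> q = \<Phi> (unit_vec n 0)" if q: "q \<in> carrier_vec n" "q \<bullet>c q = 1" for q
  proof -
    obtain U \<mu> where U: "rotation n U" "U *\<^sub>v q = \<mu> \<cdot>\<^sub>v unit_vec n 0" "cmod \<mu> = 1"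
      by (rule rotation_unit_vec[OF q])
    have "\<Phi> q = \<Phi> (\<mu> \<cdot>\<^sub>v unit_vec n 0)" using \<Phi>rot[OF U(1) q(1)] U(2) by simp
    also have "\<dots> = \<Phi> (unit_vec n 0)" unfolding \<Phi>_def
    proof (rule nn_integral_cong_AE, rule AE_mp[OF phase[OF U(3) unit_vec_carrier[of n 0]]], rule AE_I2, rule impI)
      fix X assume X: "X \<in> space (cnormal_cols n m)"
        and e: "F X (\<mu> \<cdot>\<^sub>v unit_vec n 0) = F X (unit_vec n 0)"
      show "spike_weight \<theta> m X (\<mu> \<cdot>\<^sub>v unit_vec n 0) * F X (\<mu> \<cdot>\<^sub>v unit_vec n 0) = spike_weight \<theta> m X (unit_vec n 0) * F X (unit_vec n 0)"
        unfolding e spike_weight_def spike_energy_phase[OF U(3) X unit_vec_carrier] ..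
    qed
    finally show ?thesis .
  qed
  have dir: "(\<lambda>p. direction (fst p)) \<in> std_cnormal n \<Otimes>\<^sub>M cnormal_cols n m \<rightarrow>\<^sub>M borel_cvec n"
    by (rule measurable_compose[OF measurable_fst[of "std_cnormal n"]]) (simp add: direction_measurable)
  have colm: "(\<lambda>p. snd p k) \<in> std_cnormal n \<Otimes>\<^sub>M cnormal_cols n m \<rightarrow>\<^sub>M borel_cvec n" if "k < m" for k
    by (rule measurable_compose[OF measurable_snd col_measurable[OF that]])
  have joint: "(\<lambda>(x, X). spike_weight \<theta> m X (direction x) * F X (direction x)) \<in> borel_measurable (std_cnormal n \<Otimes>\<^sub>M cnormal_cols n m)"
    unfolding split_beta'
  proof (rule borel_measurable_times_ennreal)
    show "(\<lambda>p. spike_weight \<theta> m (snd p) (direction (fst p))) \<in> borel_measurable (std_cnormal n \<Otimes>\<^sub>M cnormal_cols n m)"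
      by (rule spike_weight_measurable[where f = snd and q = "\<lambda>p. direction (fst p)", OF colm dir])
    have "(\<lambda>p. (snd p, direction (fst p))) \<in> std_cnormal n \<Otimes>\<^sub>M cnormal_cols n m \<rightarrow>\<^sub>M cnormal_cols n m \<Otimes>\<^sub>M borel_cvec n"
      by (rule measurable_Pair[OF measurable_snd dir])
    from measurable_compose[OF this F] show "(\<lambda>p. F (snd p) (direction (fst p))) \<in> borel_measurable (std_cnormal n \<Otimes>\<^sub>M cnormal_cols n m)"
      by simp
  qed
  have "(\<integral>\<^sup>+X. (\<integral>\<^sup>+x. spike_weight \<theta> m X (direction x) * F X (direction x) \<partial>std_cnormal n) \<partial>cnormal_cols n m)
      = (\<integral>\<^sup>+x. \<Phi> (direction x) \<partial>std_cnormal n)"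
    unfolding \<Phi>_def by (rule CS.Fubini'[OF joint])
  also have "\<dots> = (\<integral>\<^sup>+x. \<Phi> v \<partial>std_cnormal n)"
  proof (rule nn_integral_cong_AE, rule AE_mp[OF AE_std_cnormal_nonzero[OF n]], rule AE_I2, rule impI)
    fix x assume x: "x \<in> space (std_cnormal n)" "sq_norm_cvec x \<noteq> 0"
    show "\<Phi> (direction x) = \<Phi> v"
      using \<Phi>axis[OF v] \<Phi>axis[OF direction_carrier direction_unit] x by simp
  qed
  also have "\<dots> = \<Phi> v" using S.emeasure_space_1 by simp
  finally show ?thesis unfolding \<Phi>_def ..
qed

section \<open>Rotations and the bottom of the spectrum\<close>

lemma gram_mult_vec:
  assumes X: "\<And>k. k < m \<Longrightarrow> X k \<in> carrier_vec n" and y: "y \<in> carrier_vec n" and i: "i < n"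
  shows "(gram n m X *\<^sub>v y) $ i = (\<Sum>k<m. (y \<bullet>c X k) * X k $ i)"
proof -
  have "(gram n m X *\<^sub>v y) $ i = (\<Sum>j<n. \<Sum>k<m. y $ j * cnj (X k $ j) * X k $ i)"
    unfolding mult_mat_vec_sum[OF gram_carrier y i] using i
    by (intro sum.cong refl) (auto simp: gram_index sum_distrib_left sum_distrib_right mult_ac)
  also have "\<dots> = (\<Sum>k<m. (\<Sum>j<n. y $ j * cnj (X k $ j)) * X k $ i)"
    by (subst sum.swap) (simp add: sum_distrib_right)
  also have "\<dots> = (\<Sum>k<m. (y \<bullet>c X k) * X k $ i)"
    using X by (intro sum.cong refl) (simp add: cscalar_prod_sum[OF X])
  finally show ?thesis .
qed

lemma gram_rotation_vec:
  assumes U: "rotation n U" and X: "\<And>k. k < m \<Longrightarrow> X k \<in> carrier_vec n" and y: "y \<in> carrier_vec n"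
  shows "gram n m (\<lambda>k\<in>{..<m}. U *\<^sub>v X k) *\<^sub>v (U *\<^sub>v y) = U *\<^sub>v (gram n m X *\<^sub>v y)"
proof (rule eq_vecI)
  note Uc = rotation_carrier[OF U]
  have g: "gram n m X *\<^sub>v y \<in> carrier_vec n" by (rule mult_mat_vec_carrier[OF gram_carrier y])
  fix i assume "i < dim_vec (U *\<^sub>v (gram n m X *\<^sub>v y))"
  then have i: "i < n" using Uc by simp
  have "(gram n m (\<lambda>k\<in>{..<m}. U *\<^sub>v X k) *\<^sub>v (U *\<^sub>v y)) $ i = (\<Sum>k<m. (y \<bullet>c X k) * (U *\<^sub>v X k) $ i)"
    using X Uc y i by (subst gram_mult_vec) (auto simp: rotation_cscalar_prod[OF U] intro!: sum.cong)
  also have "\<dots> = (\<Sum>k<m. \<Sum>p<n. U $$ (i, p) * ((y \<bullet>c X k) * X k $ p))"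
    using X i by (intro sum.cong refl) (simp add: mult_mat_vec_sum[OF Uc] sum_distrib_left mult_ac)
  also have "\<dots> = (\<Sum>p<n. U $$ (i, p) * (gram n m X *\<^sub>v y) $ p)"
    by (subst sum.swap) (simp add: sum_distrib_left[symmetric] gram_mult_vec[OF X y])
  also have "\<dots> = (U *\<^sub>v (gram n m X *\<^sub>v y)) $ i" by (rule mult_mat_vec_sum[OF Uc g i, symmetric])
  finally show "(gram n m (\<lambda>k\<in>{..<m}. U *\<^sub>v X k) *\<^sub>v (U *\<^sub>v y)) $ i = (U *\<^sub>v (gram n m X *\<^sub>v y)) $ i" .
qed (use rotation_carrier[OF U] in \<open>auto simp: gram_def\<close>)

lemma spectral_gram_rotation:
  assumes U: "rotation n U" and X: "\<And>k. k < m \<Longrightarrow> X k \<in> carrier_vec n" and sp: "spectral n (gram n m X) l u"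
  shows "spectral n (gram n m (\<lambda>k\<in>{..<m}. U *\<^sub>v X k)) l (\<lambda>i. U *\<^sub>v u i)"
proof -
  note Uc = rotation_carrier[OF U]
  have u: "u i \<in> carrier_vec n" "gram n m X *\<^sub>v u i = complex_of_real (l i) \<cdot>\<^sub>v u i" if "i < n" for i
    using sp that by (auto simp: spectral_def)
  have "gram n m (\<lambda>k\<in>{..<m}. U *\<^sub>v X k) *\<^sub>v (U *\<^sub>v u i) = complex_of_real (l i) \<cdot>\<^sub>v (U *\<^sub>v u i)" if "i < n" for i
    using gram_rotation_vec[OF U X u(1)[OF that]] u(2)[OF that] mult_mat_vec[OF Uc u(1)[OF that]] by simp
  moreover have "(U *\<^sub>v u i) \<bullet>c (U *\<^sub>v u j) = (if i = j then 1 else 0)" if "i < n" "j < n" for i j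
    using rotation_cscalar_prod[OF U u(1)[OF that(1)] u(1)[OF that(2)]] sp that by (auto simp: spectral_def)
  ultimately show ?thesis
    using sp u(1) Uc mult_mat_vec_carrier[OF Uc u(1)] by (auto simp: spectral_def)
qed

text \<open>The index of the smallest eigenvalue is determined by \<open>l\<close> alone, and
  \<open>l\<close> is common to both matrices.\<close>

lemma min_spectral_rotation:
  assumes U: "rotation n U" and n: "0 < n" and sp: "spectral n W l u" and sp': "spectral n W' l (\<lambda>i. U *\<^sub>v u i)"
    and q: "q \<in> carrier_vec n"
  shows "min_overlap n W' (U *\<^sub>v q) = min_overlap n W q" "min_eig n W' = min_eig n W"
proof -
  obtain p where p: "p < n" "\<And>j. j < n \<Longrightarrow> j \<noteq> p \<Longrightarrow> l p < l j"
    "\<And>q. q \<in> carrier_vec n \<Longrightarrow> min_overlap n W q = (cmod (u p \<bullet>c q))\<^sup>2" "min_eig n W = l p"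
    by (rule spectral_min[OF sp n]) (rule that, assumption+)
  obtain p' where p': "p' < n" "\<And>j. j < n \<Longrightarrow> j \<noteq> p' \<Longrightarrow> l p' < l j"
    "\<And>q. q \<in> carrier_vec n \<Longrightarrow> min_overlap n W' q = (cmod ((U *\<^sub>v u p') \<bullet>c q))\<^sup>2" "min_eig n W' = l p'"
    by (rule spectral_min[OF sp' n]) (rule that, assumption+)
  have "p' = p" using p(1,2) p'(1,2) less_asym by metis
  moreover have "u p \<in> carrier_vec n" using sp p(1) by (auto simp: spectral_def)
  ultimately show "min_overlap n W' (U *\<^sub>v q) = min_overlap n W q" "min_eig n W' = min_eig n W"
    using p(3)[OF q] p'(3)[OF mult_mat_vec_carrier[OF rotation_carrier[OF U] q]] p(4) p'(4)
      rotation_cscalar_prod[OF U _ q] by auto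
qed

text \<open>Rayleigh's principle: the squared overlaps of a unit vector with the eigenbasis add up
  to one, so the form is a weighted mean of the eigenvalues.\<close>

lemma min_eig_le_form:
  assumes sp: "spectral n W l u" and n: "0 < n" and q: "q \<in> carrier_vec n" "q \<bullet>c q = 1"
  shows "min_eig n W \<le> Re ((W *\<^sub>v q) \<bullet>c q)"
proof -
  obtain p where p: "p < n" "\<And>j. j < n \<Longrightarrow> j \<noteq> p \<Longrightarrow> l p < l j" "min_eig n W = l p"
    by (rule spectral_min[OF sp n]) (rule that, assumption+)
  have u: "\<And>i. i < n \<Longrightarrow> u i \<in> carrier_vec n" and W: "W \<in> carrier_mat n n"
    and on: "\<And>i j. i < n \<Longrightarrow> j < n \<Longrightarrow> u i \<bullet>c u j = (if i = j then 1 else 0)"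
    and ev: "\<And>k. k < n \<Longrightarrow> W *\<^sub>v u k = complex_of_real (l k) \<cdot>\<^sub>v u k"
    using sp by (auto simp: spectral_def)
  have "(1\<^sub>m n *\<^sub>v q) \<bullet>c q = (\<Sum>k<n. 1 * complex_of_real ((cmod (u k \<bullet>c q))\<^sup>2))"
    by (rule orthonormal_diag_form[OF u on _ _ q(1)]) (use u in auto)
  then have "complex_of_real (\<Sum>k<n. (cmod (u k \<bullet>c q))\<^sup>2) = 1" using q by simp
  then have one: "(\<Sum>k<n. (cmod (u k \<bullet>c q))\<^sup>2) = 1" by (metis of_real_eq_1_iff)
  have "l p = (\<Sum>k<n. l p * (cmod (u k \<bullet>c q))\<^sup>2)" using one by (simp add: sum_distrib_left[symmetric])
  also have "\<dots> \<le> (\<Sum>k<n. l k * (cmod (u k \<bullet>c q))\<^sup>2)"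
    using p(2) by (intro sum_mono mult_right_mono) (auto, metis order.refl order_less_imp_le)
  also have "\<dots> = Re ((W *\<^sub>v q) \<bullet>c q)"
    using orthonormal_diag_form[OF u on W ev q(1)] by simp
  finally show ?thesis using p(3) by simp
qed

lemma min_eig_gram_nonneg:
  assumes sp: "spectral n (gram n m X) l u" and n: "0 < n"
  shows "0 \<le> min_eig n (gram n m X)"
proof -
  obtain p where p: "p < n" "min_eig n (gram n m X) = l p"
    by (rule spectral_min[OF sp n]) (rule that, assumption+)
  have u: "u p \<in> carrier_vec n" "u p \<bullet>c u p = 1" "gram n m X *\<^sub>v u p = complex_of_real (l p) \<cdot>\<^sub>v u p"
    using sp p(1) by (auto simp: spectral_def)
  have "complex_of_real (l p) = (gram n m X *\<^sub>v u p) \<bullet>c u p"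
    unfolding u(3) using u by (simp add: cscalar_prod_smult)
  also have "\<dots> = complex_of_real (\<Sum>k<m. (cmod (X k \<bullet>c u p))\<^sup>2)" by (rule gram_form[OF u(1)])
  finally have "l p = (\<Sum>k<m. (cmod (X k \<bullet>c u p))\<^sup>2)" using of_real_eq_iff by blast
  then show ?thesis unfolding p(2) by (auto intro: sum_nonneg)
qed

lemma min_eig_le_spike_energy:
  assumes sp: "spectral n (gram n m X) l u" and n: "0 < n" and q: "q \<in> carrier_vec n" "q \<bullet>c q = 1"
  shows "min_eig n (gram n m X) \<le> spike_energy m X q"
  using min_eig_le_form[OF sp n q] unfolding gram_form[OF q(1)] spike_energy_def by simp

lemma AE_min_rotation:
  assumes U: "rotation n U" and n: "0 < n" "n \<le> m" and q: "q \<in> carrier_vec n"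
  shows "AE X in cnormal_cols n m.
    min_overlap n (gram n m (\<lambda>k\<in>{..<m}. U *\<^sub>v X k)) (U *\<^sub>v q) = min_overlap n (gram n m X) q \<and>
    min_eig n (gram n m (\<lambda>k\<in>{..<m}. U *\<^sub>v X k)) = min_eig n (gram n m X)"
proof (rule AE_mp[OF AE_spectral_gram[OF n(2)]], rule AE_I2, rule impI, elim exE)
  fix X l u assume X: "X \<in> space (cnormal_cols n m)" and sp: "spectral n (gram n m X) l u"
  show "min_overlap n (gram n m (\<lambda>k\<in>{..<m}. U *\<^sub>v X k)) (U *\<^sub>v q) = min_overlap n (gram n m X) q \<and>
    min_eig n (gram n m (\<lambda>k\<in>{..<m}. U *\<^sub>v X k)) = min_eig n (gram n m X)"
    using min_spectral_rotation[OF U n(1) sp spectral_gram_rotation[OF U col_carrier[OF X] sp] q] by auto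
qed

lemma AE_min_overlap_phase:
  assumes \<mu>: "cmod \<mu> = 1" and n: "0 < n" "n \<le> m" and q: "q \<in> carrier_vec n"
  shows "AE X in cnormal_cols n m. min_overlap n (gram n m X) (\<mu> \<cdot>\<^sub>v q) = min_overlap n (gram n m X) q"
proof (rule AE_mp[OF AE_spectral_gram[OF n(2)]], rule AE_I2, rule impI, elim exE)
  fix X l u assume sp: "spectral n (gram n m X) l u"
  obtain p where p: "p < n" "\<And>q. q \<in> carrier_vec n \<Longrightarrow> min_overlap n (gram n m X) q = (cmod (u p \<bullet>c q))\<^sup>2"
    by (rule spectral_min[OF sp n(1)]) (rule that, assumption+)
  have "u p \<in> carrier_vec n" using sp p(1) by (auto simp: spectral_def)
  then show "min_overlap n (gram n m X) (\<mu> \<cdot>\<^sub>v q) = min_overlap n (gram n m X) q"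
    using p(2)[of q] p(2)[of "\<mu> \<cdot>\<^sub>v q"] q \<mu> by (simp add: cscalar_prod_smult norm_mult)
qed

text \<open>The spike is randomized for the indicator \<open>F\<close>, the cap identity is applied
  for each fixed \<open>X\<close>, and the randomization is undone for the exponential
  \<open>G\<close>. Both sides thus return to the fixed spike \<open>v\<close>, and the result is
  exact for finite \<open>n\<close>.\<close>

theorem spike_overlap_identity:
  assumes v: "v \<in> carrier_vec n" "v \<bullet>c v = 1" and n: "0 < n" "n \<le> m" and a: "0 \<le> a" "a < 1" and \<theta>: "0 \<le> \<theta>"
  shows "(\<integral>\<^sup>+X. spike_weight \<theta> m X v * indicator {X. min_overlap n (gram n m X) v > a} X \<partial>cnormal_cols n m) =
    ennreal ((1 - a) ^ (n - 1)) * (\<integral>\<^sup>+X. spike_weight \<theta> m X v *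
      ennreal (exp (- (\<theta> / (1 + \<theta>) * a) * (spike_energy m X v - min_eig n (gram n m X)))) \<partial>cnormal_cols n m)"
proof -
  let ?C = "cnormal_cols n m" and ?c = "\<theta> / (1 + \<theta>)"
  define F where "F X q = (indicator {X. min_overlap n (gram n m X) q > a} X :: ennreal)" for X q
  define G where "G X q = ennreal (exp (- (?c * a) * (spike_energy m X q - min_eig n (gram n m X))))" for X q
  have g: "(\<lambda>p. gram n m (fst p)) \<in> ?C \<Otimes>\<^sub>M borel_cvec n \<rightarrow>\<^sub>M borel_cmat n n"
    by (rule measurable_compose[OF measurable_fst gram_in_borel_cmat])
  have col: "(\<lambda>p. fst p k) \<in> ?C \<Otimes>\<^sub>M borel_cvec n \<rightarrow>\<^sub>M borel_cvec n" if "k < m" for k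
    by (rule measurable_compose[OF measurable_fst col_measurable[OF that]])
  note [measurable] = measurable_min_overlap[OF g measurable_snd] measurable_min_eig[OF g]
    spike_energy_measurable[OF col measurable_snd]
  have Fm: "case_prod F \<in> borel_measurable (?C \<Otimes>\<^sub>M borel_cvec n)"
    unfolding F_def split_beta' indicator_def mem_Collect_eq by measurable
  have Gm: "case_prod G \<in> borel_measurable (?C \<Otimes>\<^sub>M borel_cvec n)"
    unfolding G_def split_beta' by measurable
  have FA: "(\<integral>\<^sup>+X. spike_weight \<theta> m X v * F X v \<partial>?C) =
    (\<integral>\<^sup>+X. (\<integral>\<^sup>+x. spike_weight \<theta> m X (direction x) * F X (direction x) \<partial>std_cnormal n) \<partial>?C)"
  proof (rule nn_integral_spike_average[OF v n(1) Fm])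
    show "AE X in ?C. F (\<lambda>k\<in>{..<m}. U *\<^sub>v X k) (U *\<^sub>v q) = F X q" if "rotation n U" "q \<in> carrier_vec n" for U q
      using AE_min_rotation[OF that(1) n that(2)] by (rule AE_mp) (auto intro!: AE_I2 simp: F_def indicator_def)
    show "AE X in ?C. F X (\<mu> \<cdot>\<^sub>v q) = F X q" if "cmod \<mu> = 1" "q \<in> carrier_vec n" for \<mu> q
      using AE_min_overlap_phase[OF that(1) n that(2)] by (rule AE_mp) (auto intro!: AE_I2 simp: F_def indicator_def)
  qed
  have GA: "(\<integral>\<^sup>+X. spike_weight \<theta> m X v * G X v \<partial>?C) =
    (\<integral>\<^sup>+X. (\<integral>\<^sup>+x. spike_weight \<theta> m X (direction x) * G X (direction x) \<partial>std_cnormal n) \<partial>?C)"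
  proof (rule nn_integral_spike_average[OF v n(1) Gm])
    show "AE X in ?C. G (\<lambda>k\<in>{..<m}. U *\<^sub>v X k) (U *\<^sub>v q) = G X q" if "rotation n U" "q \<in> carrier_vec n" for U q
      using AE_min_rotation[OF that(1) n that(2)]
      by (rule AE_mp) (auto intro!: AE_I2 simp: G_def spike_energy_rotation[OF that(1) _ that(2)])
    show "AE X in ?C. G X (\<mu> \<cdot>\<^sub>v q) = G X q" if "cmod \<mu> = 1" "q \<in> carrier_vec n" for \<mu> q
      by (rule AE_I2) (simp add: G_def spike_energy_phase[OF that(1) _ that(2)])
  qed
  define E where "E X = (\<integral>\<^sup>+x. spike_weight \<theta> m X (direction x) * G X (direction x) \<partial>std_cnormal n)" for X
  have inner: "(\<integral>\<^sup>+x. spike_weight \<theta> m X (direction x) * F X (direction x) \<partial>std_cnormal n) = ennreal ((1 - a) ^ (n - 1)) * E X"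
    if X: "X \<in> space ?C" and sp: "spectral n (gram n m X) l u" for X l u
  proof -
    let ?W = "gram n m X"
    let ?\<rho> = "\<lambda>x. Re ((?W *\<^sub>v x) \<bullet>c x) / sq_norm_cvec x"
    let ?d = "ennreal (1 / (1 + \<theta>) ^ m)"
    obtain p where p: "p < n" "\<And>q. q \<in> carrier_vec n \<Longrightarrow> min_overlap n ?W q = (cmod (u p \<bullet>c q))\<^sup>2" "min_eig n ?W = l p"
      by (rule spectral_min[OF sp n(1)]) (rule that, assumption+)
    have u: "u p \<in> carrier_vec n" "u p \<bullet>c u p = 1" "?W *\<^sub>v u p = complex_of_real (l p) \<cdot>\<^sub>v u p"
      using sp p(1) by (auto simp: spectral_def)
    have w: "spike_weight \<theta> m X (direction x) = ?d * ennreal (exp (?c * ?\<rho> x))" if "x \<in> carrier_vec n" for x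
      using \<theta> by (simp add: spike_weight_def spike_energy_direction[OF X that] ennreal_mult[symmetric])
    \<comment> \<open>At x = 0 both indicators are zero: the overlap is zero, while the inequalities
      \<open>a < 0\<close> and \<open>a * 0 < 0\<close> fail.\<close>
    have Fd: "F X (direction x) = indicator {x. (cmod (u p \<bullet>c x))\<^sup>2 > a * sq_norm_cvec x} x" if x: "x \<in> carrier_vec n" for x
    proof (cases "sq_norm_cvec x = 0")
      case True
      have "min_overlap n ?W (direction x) = 0"
        using p(2)[OF direction_carrier[OF x]] cmod_direction[OF x u(1)] True by simp
      moreover have "u p \<bullet>c x = 0"
        using True sq_norm_cvec_eq_0[OF x] u(1) by simp
      ultimately show ?thesis using a True by (simp add: F_def indicator_def)
    next
      case False
      then have "0 < sq_norm_cvec x" using sq_norm_cvec_nonneg[of x] by linarith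
      then show ?thesis
        by (simp add: F_def p(2)[OF direction_carrier[OF x]] cmod_direction[OF x u(1)] indicator_def pos_less_divide_eq)
    qed
    have Gd: "spike_weight \<theta> m X (direction x) * G X (direction x) =
        ?d * ennreal (exp (?c * (l p * a + (1 - a) * ?\<rho> x)))" if x: "x \<in> carrier_vec n" for x
    proof -
      \<comment> \<open>The exponent delivered by the cap identity is the exponent of the weight
        minus \<open>k * a * (r - l p)\<close>; the gap between energy and smallest eigenvalue
        originates here.\<close>
      have "k * r + - (k * a) * (r - l p) = k * (l p * a + (1 - a) * r)" for k r :: real by (simp add: algebra_simps)
      then have e: "?c * r + - (?c * a) * (r - l p) = ?c * (l p * a + (1 - a) * r)" for r .
      show ?thesis unfolding w[OF x] G_def p(3) spike_energy_direction[OF X x] mult.assoc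
        by (simp only: ennreal_mult[symmetric, OF exp_ge_zero exp_ge_zero] exp_add[symmetric] e)
    qed
    note [measurable] = cvec_measurable_sq_norm[OF measurable_ident_sets[OF refl], of n]
      quadratic_form_measurable[OF gram_carrier, of n m X]
    have up: "(\<lambda>x. u p \<bullet>c x) \<in> borel_measurable (borel_cvec n)"
      by (rule cvec_measurable_cscalar_prod[OF _ measurable_ident_sets[OF refl]]) (simp add: space_borel_cvec u(1))
    note [measurable] = up
    have "(\<integral>\<^sup>+x. spike_weight \<theta> m X (direction x) * F X (direction x) \<partial>std_cnormal n)
        = (\<integral>\<^sup>+x. ?d * (indicator {x. (cmod (u p \<bullet>c x))\<^sup>2 > a * sq_norm_cvec x} x * ennreal (exp (?c * ?\<rho> x))) \<partial>std_cnormal n)"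
      by (intro nn_integral_cong) (simp add: w Fd mult_ac)
    also have "\<dots> = ?d * (\<integral>\<^sup>+x. indicator {x. (cmod (u p \<bullet>c x))\<^sup>2 > a * sq_norm_cvec x} x * ennreal (exp (?c * ?\<rho> x)) \<partial>std_cnormal n)"
      by (intro nn_integral_cmult) (simp add: indicator_def, measurable)
    also have "\<dots> = ?d * (ennreal ((1 - a) ^ (n - 1)) * (\<integral>\<^sup>+x. ennreal (exp (?c * (l p * a + (1 - a) * ?\<rho> x))) \<partial>std_cnormal n))"
      unfolding nn_integral_cap[OF a gram_carrier gram_adjoint u] ..
    also have "\<dots> = ennreal ((1 - a) ^ (n - 1)) * (\<integral>\<^sup>+x. ?d * ennreal (exp (?c * (l p * a + (1 - a) * ?\<rho> x))) \<partial>std_cnormal n)"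
      by (subst nn_integral_cmult) (simp, measurable, simp add: mult_ac)
    also have "(\<integral>\<^sup>+x. ?d * ennreal (exp (?c * (l p * a + (1 - a) * ?\<rho> x))) \<partial>std_cnormal n) = E X"
      unfolding E_def by (intro nn_integral_cong) (simp add: Gd)
    finally show ?thesis .
  qed
  have "(\<integral>\<^sup>+X. spike_weight \<theta> m X v * F X v \<partial>?C) = (\<integral>\<^sup>+X. ennreal ((1 - a) ^ (n - 1)) * E X \<partial>?C)"
    unfolding FA
    by (rule nn_integral_cong_AE, rule AE_mp[OF AE_spectral_gram[OF n(2)]], rule AE_I2, rule impI, elim exE, rule inner)
  also have "\<dots> = ennreal ((1 - a) ^ (n - 1)) * (\<integral>\<^sup>+X. E X \<partial>?C)"
  proof (rule nn_integral_cmult)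
    interpret S: prob_space "std_cnormal n" by (rule prob_space_std_cnormal)
    have dir: "(\<lambda>p. direction (snd p)) \<in> ?C \<Otimes>\<^sub>M std_cnormal n \<rightarrow>\<^sub>M borel_cvec n"
      by (rule measurable_compose[OF measurable_snd[of ?C]]) (simp add: direction_measurable)
    have colm: "(\<lambda>p. fst p k) \<in> ?C \<Otimes>\<^sub>M std_cnormal n \<rightarrow>\<^sub>M borel_cvec n" if "k < m" for k
      by (rule measurable_compose[OF measurable_fst col_measurable[OF that]])
    have "(\<lambda>p. spike_weight \<theta> m (fst p) (direction (snd p)) * G (fst p) (direction (snd p))) \<in> borel_measurable (?C \<Otimes>\<^sub>M std_cnormal n)"
    proof (rule borel_measurable_times_ennreal)
      show "(\<lambda>p. spike_weight \<theta> m (fst p) (direction (snd p))) \<in> borel_measurable (?C \<Otimes>\<^sub>M std_cnormal n)"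
        by (rule spike_weight_measurable[where f = fst and q = "\<lambda>p. direction (snd p)", OF colm dir])
      have "(\<lambda>p. (fst p, direction (snd p))) \<in> ?C \<Otimes>\<^sub>M std_cnormal n \<rightarrow>\<^sub>M ?C \<Otimes>\<^sub>M borel_cvec n"
        by (rule measurable_Pair[OF measurable_fst dir])
      from measurable_compose[OF this Gm] show "(\<lambda>p. G (fst p) (direction (snd p))) \<in> borel_measurable (?C \<Otimes>\<^sub>M std_cnormal n)"
        by simp
    qed
    then show "E \<in> borel_measurable ?C" unfolding E_def
      by (intro S.borel_measurable_nn_integral) (simp add: split_beta')
  qed
  also have "(\<integral>\<^sup>+X. E X \<partial>?C) = (\<integral>\<^sup>+X. spike_weight \<theta> m X v * G X v \<partial>?C)" unfolding GA E_def ..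
  finally show ?thesis unfolding F_def G_def .
qed

section \<open>The spiked Gaussian\<close>

abbreviation spike_cov :: "nat \<Rightarrow> real \<Rightarrow> complex vec \<Rightarrow> complex mat" where
  "spike_cov n \<theta> v \<equiv> 1\<^sub>m n + complex_of_real \<theta> \<cdot>\<^sub>m outer_prod v v"

lemma spike_mat_index:
  "v \<in> carrier_vec n \<Longrightarrow> i < n \<Longrightarrow> j < n \<Longrightarrow>
    spike_cov n t v $$ (i, j) = (if i = j then 1 else 0) + t * (v $ i * cnj (v $ j))"
  by (auto simp: outer_prod_def)

lemma spike_mat_carrier: "v \<in> carrier_vec n \<Longrightarrow> spike_cov n t v \<in> carrier_mat n n"
  by (auto simp: outer_prod_def)

text \<open>For a unit vector the outer product is a projection, so the family is closed under
  multiplication. Solving \<open>s + t + s * t = 0\<close> with \<open>s = \<theta>\<close> gives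
  the parameter \<open>- (\<theta> / (1 + \<theta>))\<close> of the inverse.\<close>

lemma spike_mat_mult:
  assumes v: "v \<in> carrier_vec n" "v \<bullet>c v = 1"
  shows "spike_cov n s v * spike_cov n t v = spike_cov n (s + t + s * t) v"
proof (rule eq_matI)
  note c = spike_mat_carrier[OF v(1)]
  fix i j assume "i < dim_row (spike_cov n (s + t + s * t) v)" "j < dim_col (spike_cov n (s + t + s * t) v)"
  then have ij: "i < n" "j < n" using v by (auto simp: outer_prod_def)
  have "(\<Sum>k<n. cnj (v $ k) * v $ k) = 1"
    using v(2) by (simp add: cscalar_prod_sum[OF v(1)] mult.commute)
  then have vv: "(\<Sum>k<n. complex_of_real s * (v $ i * cnj (v $ k)) * (complex_of_real t * (v $ k * cnj (v $ j))))
      = complex_of_real (s * t) * (v $ i * cnj (v $ j))"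
  proof -
    have "(\<Sum>k<n. complex_of_real s * (v $ i * cnj (v $ k)) * (complex_of_real t * (v $ k * cnj (v $ j))))
        = complex_of_real (s * t) * (v $ i * cnj (v $ j)) * (\<Sum>k<n. cnj (v $ k) * v $ k)"
      unfolding sum_distrib_left by (intro sum.cong refl) simp
    then show ?thesis using \<open>(\<Sum>k<n. cnj (v $ k) * v $ k) = 1\<close> by simp
  qed
  have "(spike_cov n s v * spike_cov n t v) $$ (i, j) = (\<Sum>k<n.
      (if k = i then (if i = j then 1 else 0) + complex_of_real t * (v $ k * cnj (v $ j)) else 0) +
      (if k = j then complex_of_real s * (v $ i * cnj (v $ k)) else 0) +
      complex_of_real s * (v $ i * cnj (v $ k)) * (complex_of_real t * (v $ k * cnj (v $ j))))"
    unfolding mat_mult_index_sum[OF c c ij]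
    using ij by (intro sum.cong refl) (auto simp: spike_mat_index[OF v(1)] algebra_simps)
  also have "\<dots> = spike_cov n (s + t + s * t) v $$ (i, j)"
    unfolding sum.distrib vv spike_mat_index[OF v(1) ij] using ij by (simp add: algebra_simps)
  finally show "(spike_cov n s v * spike_cov n t v) $$ (i, j) = spike_cov n (s + t + s * t) v $$ (i, j)" .
qed (use v in \<open>auto simp: outer_prod_def\<close>)

lemma spike_cov_inverse:
  assumes v: "v \<in> carrier_vec n" "v \<bullet>c v = 1" and \<theta>: "0 \<le> \<theta>"
  shows "the (mat_inverse (spike_cov n \<theta> v)) = spike_cov n (- (\<theta> / (1 + \<theta>))) v"
proof -
  let ?S = "spike_cov n \<theta> v" and ?P = "spike_cov n (- (\<theta> / (1 + \<theta>))) v"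
  have S: "?S \<in> carrier_mat n n" and P: "?P \<in> carrier_mat n n" using spike_mat_carrier[OF v(1)] by blast+
  have z: "\<theta> + - (\<theta> / (1 + \<theta>)) + \<theta> * - (\<theta> / (1 + \<theta>)) = 0" using \<theta> by (simp add: field_simps)
  have one: "spike_cov n 0 v = 1\<^sub>m n" using v by (intro eq_matI) (auto simp: outer_prod_def)
  have SP: "?S * ?P = 1\<^sub>m n" unfolding spike_mat_mult[OF v] z by (rule one)
  have PS: "?P * ?S = 1\<^sub>m n" by (rule mat_mult_left_right_inverse[OF S P SP])
  \<comment> \<open>This guarantees that \<open>mat_inverse\<close> returns some \<open>B\<close>;
    uniqueness of inverses then identifies \<open>B\<close> with \<open>?P\<close>.\<close>
  have "?S \<in> Units (ring_mat TYPE(complex) n ())"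
    using S P SP PS by (auto simp: Units_def ring_mat_def)
  then obtain B where B: "mat_inverse ?S = Some B"
    using mat_inverse(1)[OF S, of "()"] by (cases "mat_inverse ?S") auto
  from mat_inverse(2)[OF S B] have BS: "B * ?S = 1\<^sub>m n" and Bc: "B \<in> carrier_mat n n" by auto
  have "B = B * (?S * ?P)" unfolding SP using Bc by simp
  also have "\<dots> = (B * ?S) * ?P" by (rule assoc_mult_mat[OF Bc S P, symmetric])
  also have "\<dots> = ?P" unfolding BS by (rule left_mult_one_mat[OF P])
  finally show ?thesis using B by simp
qed

lemma spike_form:
  assumes v: "v \<in> carrier_vec n" and x: "x \<in> carrier_vec n"
  shows "Re ((spike_cov n t v *\<^sub>v x) \<bullet>c x) = sq_norm_cvec x + t * (cmod (x \<bullet>c v))\<^sup>2"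
proof -
  have Px: "(spike_cov n t v *\<^sub>v x) $ i = x $ i + complex_of_real t * (x \<bullet>c v) * v $ i" if i: "i < n" for i
  proof -
    have "(spike_cov n t v *\<^sub>v x) $ i = (\<Sum>j<n. (if j = i then x $ j else 0) + complex_of_real t * v $ i * (x $ j * cnj (v $ j)))"
      unfolding mult_mat_vec_sum[OF spike_mat_carrier[OF v] x i] using i
      by (intro sum.cong refl) (auto simp: spike_mat_index[OF v] algebra_simps)
    also have "\<dots> = x $ i + complex_of_real t * (x \<bullet>c v) * v $ i"
      unfolding sum.distrib sum_distrib_left[symmetric] cscalar_prod_sum[OF v] using i by simp
    finally show ?thesis .
  qed
  have "(spike_cov n t v *\<^sub>v x) \<bullet>c x = (\<Sum>i<n. x $ i * cnj (x $ i)) + complex_of_real t * (x \<bullet>c v) * (\<Sum>i<n. v $ i * cnj (x $ i))"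
    unfolding cscalar_prod_sum[OF x] sum_distrib_left sum.distrib[symmetric]
    by (intro sum.cong refl) (simp add: Px algebra_simps)
  also have "(\<Sum>i<n. v $ i * cnj (x $ i)) = cnj (x \<bullet>c v)"
    unfolding cscalar_prod_sum[OF v] cnj_sum by (simp add: mult.commute)
  also have "(\<Sum>i<n. x $ i * cnj (x $ i)) = complex_of_real (sq_norm_cvec x)"
    unfolding cscalar_prod_self[symmetric] cscalar_prod_sum[OF x] ..
  also have "complex_of_real t * (x \<bullet>c v) * cnj (x \<bullet>c v) = complex_of_real (t * (cmod (x \<bullet>c v))\<^sup>2)"
    by (simp add: complex_norm_square del: of_real_power)
  finally show ?thesis by simp
qed

text \<open>A rotation of \<open>v\<close> onto the first axis diagonalizes the covariance with
  entries 1 + \<theta>, 1, ..., 1; the phase cancels in the outer product.\<close>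

lemma det_spike_cov:
  assumes v: "v \<in> carrier_vec n" "v \<bullet>c v = 1"
  shows "det (spike_cov n \<theta> v) = complex_of_real (1 + \<theta>)"
proof -
  obtain U \<mu> where U: "rotation n U" "U *\<^sub>v v = \<mu> \<cdot>\<^sub>v unit_vec n 0" "cmod \<mu> = 1" and n: "0 < n"
    by (rule rotation_unit_vec[OF v])
  note Uc = rotation_carrier[OF U(1)]
  have Uc': "mat_adjoint U \<in> carrier_mat n n" using Uc by auto
  have iso: "isometry n U" using U(1) by (simp add: rotation_def)
  note UU = isometry_adjoint[OF iso]
  have \<mu>: "\<mu> * cnj \<mu> = 1" using U(3) complex_norm_square[of \<mu>] by simp
  define D where "D = mat n n (\<lambda>(i, j). if i = j then (if i = 0 then complex_of_real (1 + \<theta>) else 1) else 0)"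
  have D: "D \<in> carrier_mat n n" by (simp add: D_def)
  have DU: "(D * U) $$ (k, j) = U $$ (k, j) + (if k = 0 then complex_of_real \<theta> * U $$ (k, j) else 0)" if "k < n" "j < n" for k j
  proof -
    have "(D * U) $$ (k, j) = (\<Sum>l<n. if l = k then (if k = 0 then complex_of_real (1 + \<theta>) else 1) * U $$ (l, j) else 0)"
      unfolding mat_mult_index_sum[OF D Uc that] using that by (intro sum.cong refl) (auto simp: D_def)
    then show ?thesis using that by (auto simp: algebra_simps)
  qed
  have vi: "v $ i = \<mu> * cnj (U $$ (0, i))" if i: "i < n" for i
  proof -
    have "v = mat_adjoint U *\<^sub>v (U *\<^sub>v v)"
      using assoc_mult_mat_vec[OF Uc' Uc v(1)] UU(1) v(1) by simp
    then have "v $ i = (mat_adjoint U *\<^sub>v (\<mu> \<cdot>\<^sub>v unit_vec n 0)) $ i" unfolding U(2) by simp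
    also have "\<dots> = (\<mu> \<cdot>\<^sub>v (mat_adjoint U *\<^sub>v unit_vec n 0)) $ i"
      by (simp add: mult_mat_vec[OF Uc' unit_vec_carrier])
    also have "\<dots> = \<mu> * cnj (U $$ (0, i))"
      using i n Uc mult_mat_unit_vec_index[OF Uc' i n] by simp
    finally show ?thesis .
  qed
  have DUc: "D * U \<in> carrier_mat n n" using D Uc by simp
  have S: "spike_cov n \<theta> v = mat_adjoint U * (D * U)"
  proof (rule eq_matI)
    fix i j assume "i < dim_row (mat_adjoint U * (D * U))" "j < dim_col (mat_adjoint U * (D * U))"
    then have ij: "i < n" "j < n" using Uc by auto
    have "(mat_adjoint U * (D * U)) $$ (i, j)
        = (\<Sum>k<n. mat_adjoint U $$ (i, k) * U $$ (k, j) + (if k = 0 then complex_of_real \<theta> * (cnj (U $$ (k, i)) * U $$ (k, j)) else 0))"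
      unfolding mat_mult_index_sum[OF Uc' DUc ij] using ij Uc n
      by (intro sum.cong refl) (auto simp: DU algebra_simps)
    also have "\<dots> = (mat_adjoint U * U) $$ (i, j) + complex_of_real \<theta> * (cnj (U $$ (0, i)) * U $$ (0, j))"
      unfolding sum.distrib mat_mult_index_sum[OF Uc' Uc ij] using n by simp
    also have "cnj (U $$ (0, i)) * U $$ (0, j) = \<mu> * cnj \<mu> * (cnj (U $$ (0, i)) * U $$ (0, j))" unfolding \<mu> by simp
    also have "\<dots> = v $ i * cnj (v $ j)" using ij by (simp add: vi mult_ac)
    finally show "spike_cov n \<theta> v $$ (i, j) = (mat_adjoint U * (D * U)) $$ (i, j)"
      using ij unfolding UU spike_mat_index[OF v(1) ij] by simp
  qed (use Uc v in \<open>auto simp: outer_prod_def\<close>)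
  have "det (spike_cov n \<theta> v) = det (mat_adjoint U) * (det D * det U)"
    unfolding S det_mult[OF Uc' DUc] det_mult[OF D Uc] ..
  also have "\<dots> = det (mat_adjoint U * U) * det D" unfolding det_mult[OF Uc' Uc] by simp
  also have "det (mat_adjoint U * U) = 1" unfolding UU by simp
  also have "det D = prod_list (diag_mat D)"
    by (rule det_upper_triangular[OF _ D]) (auto simp: D_def)
  also have "diag_mat D = map (\<lambda>i. if i = 0 then complex_of_real (1 + \<theta>) else 1) [0..<n]"
    by (auto simp: diag_mat_def D_def)
  also have "prod_list \<dots> = complex_of_real (1 + \<theta>)"
  proof -
    have "map (\<lambda>i. if i = 0 then complex_of_real (1 + \<theta>) else 1) [0..<n] = complex_of_real (1 + \<theta>) # map (\<lambda>_. 1) [1..<n]"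
      using n by (subst upt_conv_Cons) auto
    moreover have "prod_list (map (\<lambda>_. 1 :: complex) xs) = 1" for xs :: "nat list" by (induction xs) auto
    ultimately show ?thesis by simp
  qed
  finally show ?thesis by simp
qed

text \<open>The inverse covariance lowers the quadratic form by \<theta> / (1 + \<theta>) times the
  squared overlap with \<open>v\<close>, and the determinant contributes the normalization 1 +
  \<theta>.\<close>

lemma complex_normal_spike:
  assumes v: "v \<in> carrier_vec n" "v \<bullet>c v = 1" and \<theta>: "0 \<le> \<theta>"
  shows "complex_normal n (spike_cov n \<theta> v) =
    density (std_cnormal n) (\<lambda>x. ennreal (exp (\<theta> / (1 + \<theta>) * (cmod (x \<bullet>c v))\<^sup>2) / (1 + \<theta>)))"
proof -
  have xv: "(\<lambda>x. x \<bullet>c v) \<in> borel_measurable (borel_cvec n)"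
    by (rule cvec_measurable_cscalar_prod[OF measurable_ident_sets[OF refl]]) (simp add: space_borel_cvec v(1))
  note [measurable] = xv cvec_measurable_sq_norm[OF measurable_ident_sets[OF refl], of n]
  have "complex_normal n (spike_cov n \<theta> v) = density (lborel_cvec n) (\<lambda>x.
      ennreal (exp (- sq_norm_cvec x) / pi ^ n) * ennreal (exp (\<theta> / (1 + \<theta>) * (cmod (x \<bullet>c v))\<^sup>2) / (1 + \<theta>)))"
    unfolding complex_normal_def spike_cov_inverse[OF v \<theta>] det_spike_cov[OF v]
  proof (rule density_cong)
    have "(\<lambda>x. Re ((spike_cov n (- (\<theta> / (1 + \<theta>))) v *\<^sub>v x) \<bullet>c x)) \<in> borel_measurable (borel_cvec n)"
      by (rule measurable_compose[OF quadratic_form_measurable[OF spike_mat_carrier[OF v(1)]] borel_measurable_Re])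
    note [measurable] = this
    show "(\<lambda>x. ennreal (exp (- Re ((spike_cov n (- (\<theta> / (1 + \<theta>))) v *\<^sub>v x) \<bullet>c x)) / (pi ^ n * Re (complex_of_real (1 + \<theta>))))) \<in> borel_measurable (lborel_cvec n)"
      unfolding measurable_lborel_cvec by measurable
    show "(\<lambda>x. ennreal (exp (- sq_norm_cvec x) / pi ^ n) * ennreal (exp (\<theta> / (1 + \<theta>) * (cmod (x \<bullet>c v))\<^sup>2) / (1 + \<theta>))) \<in> borel_measurable (lborel_cvec n)"
      unfolding measurable_lborel_cvec by measurable
    show "AE x in lborel_cvec n. ennreal (exp (- Re ((spike_cov n (- (\<theta> / (1 + \<theta>))) v *\<^sub>v x) \<bullet>c x)) / (pi ^ n * Re (complex_of_real (1 + \<theta>)))) =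
        ennreal (exp (- sq_norm_cvec x) / pi ^ n) * ennreal (exp (\<theta> / (1 + \<theta>) * (cmod (x \<bullet>c v))\<^sup>2) / (1 + \<theta>))"
    proof (rule AE_I2)
      fix x assume "x \<in> space (lborel_cvec n)"
      then have x: "x \<in> carrier_vec n" by simp
      have "exp (- Re ((spike_cov n (- (\<theta> / (1 + \<theta>))) v *\<^sub>v x) \<bullet>c x)) = exp (- sq_norm_cvec x) * exp (\<theta> / (1 + \<theta>) * (cmod (x \<bullet>c v))\<^sup>2)"
        unfolding spike_form[OF v(1) x] exp_add[symmetric] by simp
      then show "ennreal (exp (- Re ((spike_cov n (- (\<theta> / (1 + \<theta>))) v *\<^sub>v x) \<bullet>c x)) / (pi ^ n * Re (complex_of_real (1 + \<theta>)))) =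
        ennreal (exp (- sq_norm_cvec x) / pi ^ n) * ennreal (exp (\<theta> / (1 + \<theta>) * (cmod (x \<bullet>c v))\<^sup>2) / (1 + \<theta>))"
        using \<theta> by (simp only: ennreal_mult[symmetric, OF divide_nonneg_nonneg divide_nonneg_nonneg] exp_ge_zero) (simp add: ennreal_mult[symmetric])
    qed
  qed
  also have "\<dots> = density (std_cnormal n) (\<lambda>x. ennreal (exp (\<theta> / (1 + \<theta>) * (cmod (x \<bullet>c v))\<^sup>2) / (1 + \<theta>)))"
    unfolding std_cnormal_def by (rule density_density_eq[symmetric]) (simp_all, measurable)
  finally show ?thesis .
qed

section \<open>Gaussian integrals along fixed directions\<close>

lemma rotation_cscalar_prod_axis:
  assumes U: "rotation n U" "U *\<^sub>v a = \<mu> \<cdot>\<^sub>v unit_vec n 0" "cmod \<mu> = 1" and n: "0 < n"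
    and a: "a \<in> carrier_vec n" and x: "x \<in> carrier_vec n"
  shows "cmod (x \<bullet>c a) = cmod ((U *\<^sub>v x) $ 0)"
proof -
  have Ux: "U *\<^sub>v x \<in> carrier_vec n" using rotation_carrier[OF U(1)] x by simp
  have "x \<bullet>c a = (U *\<^sub>v x) \<bullet>c (\<mu> \<cdot>\<^sub>v unit_vec n 0)"
    using rotation_cscalar_prod[OF U(1) x a] U(2) by simp
  also have "\<dots> = cnj \<mu> * (U *\<^sub>v x) $ 0"
    using cscalar_prod_smult(2)[OF Ux unit_vec_carrier, of \<mu> 0] cscalar_prod_unit_vec_right[OF Ux n] by simp
  finally show ?thesis using U(3) by (simp add: norm_mult)
qed

lemma nn_integral_std_cnormal_axis:
  assumes v: "v \<in> carrier_vec n" "v \<bullet>c v = 1" and h: "h \<in> borel_measurable borel"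
  shows "(\<integral>\<^sup>+x. h ((cmod (x \<bullet>c v))\<^sup>2) \<partial>std_cnormal n) = (\<integral>\<^sup>+x. h ((cmod (x $ 0))\<^sup>2) \<partial>std_cnormal n)"
proof -
  obtain U \<mu> where U: "rotation n U" "U *\<^sub>v v = \<mu> \<cdot>\<^sub>v unit_vec n 0" "cmod \<mu> = 1" and n: "0 < n"
    by (rule rotation_unit_vec[OF v])
  note rotation_cscalar_prod_axis[OF U n v(1)]
  then have "(\<integral>\<^sup>+x. h ((cmod (x \<bullet>c v))\<^sup>2) \<partial>std_cnormal n) = (\<integral>\<^sup>+x. h ((cmod ((U *\<^sub>v x) $ 0))\<^sup>2) \<partial>std_cnormal n)"
    by (intro nn_integral_cong) simp
  also have "\<dots> = (\<integral>\<^sup>+x. h ((cmod (x $ 0))\<^sup>2) \<partial>std_cnormal n)"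
    by (rule nn_integral_std_cnormal_rotation[OF U(1)]) (use borel_cvec_index[OF n] h in measurable)
  finally show ?thesis .
qed

text \<open>The squared overlap with a unit vector is exponential with mean one. After a rotation
  only the factor of coordinate 0 differs from one, and it converges because 1 - s > 0.\<close>

lemma nn_integral_std_cnormal_exp:
  assumes v: "v \<in> carrier_vec n" "v \<bullet>c v = 1" and s: "s < 1"
  shows "(\<integral>\<^sup>+x. ennreal (exp (s * (cmod (x \<bullet>c v))\<^sup>2)) \<partial>std_cnormal n) = ennreal (1 / (1 - s))"
proof -
  have n: "0 < n" using v by (cases n) (auto simp: scalar_prod_def)
  let ?f = "\<lambda>i z. ennreal (exp (- (if i = 0 then 1 - s else 1) * (cmod z)\<^sup>2) / pi)"
  have ins: "{..<n} = insert 0 {1..<n}" using n by auto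
  have "(\<integral>\<^sup>+x. ennreal (exp (s * (cmod (x \<bullet>c v))\<^sup>2)) \<partial>std_cnormal n) = (\<integral>\<^sup>+x. ennreal (exp (s * (cmod (x $ 0))\<^sup>2)) \<partial>std_cnormal n)"
    by (rule nn_integral_std_cnormal_axis[OF v, of "\<lambda>r. ennreal (exp (s * r))"]) measurable
  also have "\<dots> = (\<integral>\<^sup>+x. (\<Prod>i<n. ?f i (x $ i)) \<partial>lborel_cvec n)"
  proof (subst nn_integral_std_cnormal)
    show "(\<lambda>x. ennreal (exp (s * (cmod (x $ 0))\<^sup>2))) \<in> borel_measurable (borel_cvec n)"
      using borel_cvec_index[OF n] by measurable
    show "(\<integral>\<^sup>+x. ennreal (exp (- sq_norm_cvec x) / pi ^ n) * ennreal (exp (s * (cmod (x $ 0))\<^sup>2)) \<partial>lborel_cvec n)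
        = (\<integral>\<^sup>+x. (\<Prod>i<n. ?f i (x $ i)) \<partial>lborel_cvec n)"
    proof (rule nn_integral_cong)
      fix x assume "x \<in> space (lborel_cvec n)"
      then have x: "x \<in> carrier_vec n" by simp
      show "ennreal (exp (- sq_norm_cvec x) / pi ^ n) * ennreal (exp (s * (cmod (x $ 0))\<^sup>2)) = (\<Prod>i<n. ?f i (x $ i))"
        unfolding std_cnormal_density_prod[OF x] ins using n
        by (simp add: ennreal_mult[symmetric] exp_add[symmetric] algebra_simps cong: prod.cong_simp)
           (simp add: mult.assoc[symmetric] mult.commute ennreal_mult[symmetric] exp_add[symmetric] algebra_simps)
    qed
  qed
  also have "\<dots> = (\<Prod>i<n. (\<integral>\<^sup>+z. ?f i z \<partial>lborel))"
    by (rule nn_integral_lborel_cvec_prod) measurable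
  also have "\<dots> = (\<Prod>i<n. ennreal (if i = 0 then 1 / (1 - s) else 1))"
  proof (intro prod.cong refl)
    fix i
    let ?b = "if i = 0 then 1 - s else 1"
    have b: "0 < ?b" using s by simp
    have "(\<integral>\<^sup>+z. ?f i z \<partial>lborel) = (\<integral>\<^sup>+(z::complex). ennreal (exp (- ?b * (cmod z)\<^sup>2)) \<partial>lborel) / ennreal pi"
      by (subst nn_integral_divide[symmetric]) (auto intro!: nn_integral_cong simp: divide_ennreal)
    also have "\<dots> = ennreal (1 / ?b)"
      unfolding nn_integral_complex_gaussian[OF b] using b by (subst divide_ennreal) auto
    finally show "(\<integral>\<^sup>+z. ?f i z \<partial>lborel) = ennreal (if i = 0 then 1 / (1 - s) else 1)" by simp
  qed
  also have "\<dots> = ennreal (1 / (1 - s))" unfolding ins by simp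
  finally show ?thesis .
qed

text \<open>Independence of orthogonal components: once \<open>a\<close> is rotated onto the first
  axis, the image \<open>w\<close> of \<open>v\<close> has \<open>w $ 0 = 0\<close>, so the second
  factor ignores coordinate 0, whose squared modulus has mean one.\<close>

lemma nn_integral_std_cnormal_orthogonal_moment:
  assumes v: "v \<in> carrier_vec n" and a: "a \<in> carrier_vec n" "a \<bullet>c a = 1" and orth: "a \<bullet>c v = 0"
    and h[measurable]: "h \<in> borel_measurable borel"
  shows "(\<integral>\<^sup>+x. ennreal ((cmod (x \<bullet>c a))\<^sup>2) * h (x \<bullet>c v) \<partial>std_cnormal n) = (\<integral>\<^sup>+x. h (x \<bullet>c v) \<partial>std_cnormal n)"
proof -
  obtain U \<mu> where U: "rotation n U" "U *\<^sub>v a = \<mu> \<cdot>\<^sub>v unit_vec n 0" "cmod \<mu> = 1" and n: "0 < n"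
    by (rule rotation_unit_vec[OF a])
  note Uc = rotation_carrier[OF U(1)]
  define w where "w = U *\<^sub>v v"
  have w: "w \<in> carrier_vec n" using Uc v by (simp add: w_def)
  have "0 = (\<mu> \<cdot>\<^sub>v unit_vec n 0) \<bullet>c w"
    using rotation_cscalar_prod[OF U(1) a(1) v] orth unfolding U(2) w_def by simp
  also have "\<dots> = \<mu> * cnj (w $ 0)"
    using cscalar_prod_smult(1)[OF unit_vec_carrier w] cscalar_prod_unit_vec[OF w n] by simp
  finally have w0: "w $ 0 = 0" using U(3) by auto
  note xa = rotation_cscalar_prod_axis[OF U n a(1)]
  have xv: "x \<bullet>c v = (U *\<^sub>v x) \<bullet>c w" if x: "x \<in> carrier_vec n" for x
    using rotation_cscalar_prod[OF U(1) x v] by (simp add: w_def)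
  have wm: "(\<lambda>x. x \<bullet>c w) \<in> borel_measurable (borel_cvec n)"
    by (rule cvec_measurable_cscalar_prod[OF measurable_ident_sets[OF refl]]) (simp add: space_borel_cvec w)
  note [measurable] = wm borel_cvec_index[OF n]
  have m1: "(\<lambda>y. ennreal ((cmod (y $ 0))\<^sup>2) * h (y \<bullet>c w)) \<in> borel_measurable (borel_cvec n)"
    and m2: "(\<lambda>y. h (y \<bullet>c w)) \<in> borel_measurable (borel_cvec n)"
    by measurable
  let ?P = "PiM {1..<n} (\<lambda>_::nat. lborel :: complex measure)"
  define T where "T x = (\<Sum>i\<in>{1..<n}. (cmod (x i))\<^sup>2)" for x :: "nat \<Rightarrow> complex"
  define Y where "Y x = (\<Sum>i\<in>{1..<n}. x i * cnj (w $ i))" for x :: "nat \<Rightarrow> complex"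
  have ins: "{..<n} = insert 0 {1..<n}" using n by auto
  have sq: "sq_norm_cvec (vec n (x(0 := z))) = (cmod z)\<^sup>2 + T x" for x z
    unfolding sq_norm_cvec_def dim_vec T_def ins using n by (subst sum.insert) auto
  have Yw: "vec n (x(0 := z)) \<bullet>c w = Y x" for x z
    unfolding cscalar_prod_sum[OF w] Y_def ins using n w0 by (subst sum.insert) auto
  define C where "C x = ennreal (exp (- T x) / pi ^ n) * h (Y x)" for x
  have dens: "ennreal (exp (- sq_norm_cvec (vec n (x(0 := z)))) / pi ^ n)
      = ennreal (exp (- (cmod z)\<^sup>2)) * ennreal (exp (- T x) / pi ^ n)" for x z
    unfolding sq minus_add_distrib exp_add by (simp add: ennreal_mult[symmetric])
  have "(\<integral>\<^sup>+x. ennreal ((cmod (x \<bullet>c a))\<^sup>2) * h (x \<bullet>c v) \<partial>std_cnormal n)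
      = (\<integral>\<^sup>+x. ennreal ((cmod ((U *\<^sub>v x) $ 0))\<^sup>2) * h ((U *\<^sub>v x) \<bullet>c w) \<partial>std_cnormal n)"
    by (intro nn_integral_cong) (simp add: xa xv)
  also have "\<dots> = (\<integral>\<^sup>+y. ennreal ((cmod (y $ 0))\<^sup>2) * h (y \<bullet>c w) \<partial>std_cnormal n)"
    by (rule nn_integral_std_cnormal_rotation[OF U(1) m1])
  also have "\<dots> = (\<integral>\<^sup>+x. (\<integral>\<^sup>+z. ennreal ((cmod z)\<^sup>2 * exp (- (cmod z)\<^sup>2)) * C x \<partial>lborel) \<partial>?P)"
    unfolding nn_integral_std_cnormal[OF m1]
      nn_integral_lborel_cvec_axis[OF borel_measurable_times_ennreal[OF std_cnormal_density_measurable m1] n]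
    using n by (intro nn_integral_cong) (simp add: dens Yw C_def ennreal_mult mult_ac)
  also have "\<dots> = (\<integral>\<^sup>+x. ennreal pi * C x \<partial>?P)"
    by (simp add: nn_integral_multc nn_integral_complex_gaussian_moment)
  also have "\<dots> = (\<integral>\<^sup>+x. (\<integral>\<^sup>+z. ennreal (exp (- 1 * (cmod z)\<^sup>2)) * C x \<partial>lborel) \<partial>?P)"
    using nn_integral_complex_gaussian[of 1] by (simp add: nn_integral_multc)
  also have "\<dots> = (\<integral>\<^sup>+y. h (y \<bullet>c w) \<partial>std_cnormal n)"
    unfolding nn_integral_std_cnormal[OF m2]
      nn_integral_lborel_cvec_axis[OF borel_measurable_times_ennreal[OF std_cnormal_density_measurable m2] n]
    using n by (intro nn_integral_cong) (simp add: dens Yw C_def mult_ac)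
  also have "\<dots> = (\<integral>\<^sup>+x. h ((U *\<^sub>v x) \<bullet>c w) \<partial>std_cnormal n)"
    by (rule nn_integral_std_cnormal_rotation[OF U(1) m2, symmetric])
  also have "\<dots> = (\<integral>\<^sup>+x. h (x \<bullet>c v) \<partial>std_cnormal n)"
    by (intro nn_integral_cong) (simp add: xv)
  finally show ?thesis .
qed

section \<open>The law of the spiked columns\<close>

abbreviation spike_normal :: "nat \<Rightarrow> real \<Rightarrow> complex vec \<Rightarrow> complex vec measure" where
  "spike_normal n \<theta> v \<equiv> complex_normal n (spike_cov n \<theta> v)"

context
  fixes n :: nat and \<theta> :: real and v :: "complex vec"
  assumes v: "v \<in> carrier_vec n" "v \<bullet>c v = 1" and \<theta>: "0 \<le> \<theta>"
begin

lemma spike_normal_space [simp]: "space (spike_normal n \<theta> v) = carrier_vec n"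
  and spike_normal_sets [measurable_cong]: "sets (spike_normal n \<theta> v) = sets (borel_cvec n)"
  by (simp_all add: complex_normal_def sets_lborel_cvec)

lemma measurable_spike_normal: "measurable (spike_normal n \<theta> v) N = measurable (borel_cvec n) N"
  by (rule measurable_cong_sets) (auto simp: spike_normal_sets)

lemma spike_overlap_measurable: "(\<lambda>x. x \<bullet>c v) \<in> borel_measurable (borel_cvec n)"
  by (rule cvec_measurable_cscalar_prod[OF measurable_ident_sets[OF refl]]) (simp add: space_borel_cvec v(1))

lemma spike_density_measurable:
  "(\<lambda>x. ennreal (exp (\<theta> / (1 + \<theta>) * (cmod (x \<bullet>c v))\<^sup>2) / (1 + \<theta>))) \<in> borel_measurable (borel_cvec n)"
  using spike_overlap_measurable by measurable

lemma nn_integral_spike_normal: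
  assumes "f \<in> borel_measurable (borel_cvec n)"
  shows "(\<integral>\<^sup>+x. f x \<partial>spike_normal n \<theta> v) =
    (\<integral>\<^sup>+x. ennreal (exp (\<theta> / (1 + \<theta>) * (cmod (x \<bullet>c v))\<^sup>2) / (1 + \<theta>)) * f x \<partial>std_cnormal n)"
  unfolding complex_normal_spike[OF v \<theta>] using assms spike_density_measurable
  by (subst nn_integral_density) auto

text \<open>The tilt defining the spike and the factor \<open>exp (- s r)\<close> merge into one
  exponential with parameter \<theta> / (1 + \<theta>) - s < 1. The case s = 0 gives total mass
  one.\<close>

lemma nn_integral_spike_normal_exp:
  assumes s: "0 \<le> s"
  shows "(\<integral>\<^sup>+x. ennreal (exp (- s * (cmod (x \<bullet>c v))\<^sup>2)) \<partial>spike_normal n \<theta> v) = ennreal (1 / (1 + s * (1 + \<theta>)))"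
proof -
  let ?c = "\<theta> / (1 + \<theta>)"
  note [measurable] = spike_overlap_measurable
  have c: "1 - ?c = 1 / (1 + \<theta>)" using \<theta> by (simp add: field_simps)
  have lt: "?c - s < 1" using c s \<theta> by (smt (verit) divide_pos_pos)
  have "(\<integral>\<^sup>+x. ennreal (exp (- s * (cmod (x \<bullet>c v))\<^sup>2)) \<partial>spike_normal n \<theta> v)
      = (\<integral>\<^sup>+x. ennreal (1 / (1 + \<theta>)) * ennreal (exp ((?c - s) * (cmod (x \<bullet>c v))\<^sup>2)) \<partial>std_cnormal n)"
  proof (subst nn_integral_spike_normal, measurable, rule nn_integral_cong)
    fix x
    have "exp (?c * (cmod (x \<bullet>c v))\<^sup>2) * exp (- s * (cmod (x \<bullet>c v))\<^sup>2) = exp ((?c - s) * (cmod (x \<bullet>c v))\<^sup>2)"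
    proof -
      have "k * r + - s * r = (k - s) * r" for k r :: real by (simp add: algebra_simps)
      then show ?thesis unfolding exp_add[symmetric] by metis
    qed
    then show "ennreal (exp (?c * (cmod (x \<bullet>c v))\<^sup>2) / (1 + \<theta>)) * ennreal (exp (- s * (cmod (x \<bullet>c v))\<^sup>2))
        = ennreal (1 / (1 + \<theta>)) * ennreal (exp ((?c - s) * (cmod (x \<bullet>c v))\<^sup>2))"
      using \<theta> by (simp only: ennreal_mult[symmetric] exp_ge_zero divide_nonneg_nonneg add_nonneg_nonneg zero_le_one times_divide_eq_left mult_1_left)
  qed
  also have "\<dots> = ennreal (1 / (1 + \<theta>)) * ennreal (1 / (1 - (?c - s)))"
    by (subst nn_integral_cmult, simp, measurable) (simp only: nn_integral_std_cnormal_exp[OF v lt])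
  also have "\<dots> = ennreal (1 / (1 + \<theta>) * (1 / (1 - (?c - s))))"
    using \<theta> lt by (intro ennreal_mult[symmetric]) auto
  also have "1 - (?c - s) = (1 + s * (1 + \<theta>)) / (1 + \<theta>)"
  proof -
    have "1 - (?c - s) = (1 - ?c) + s" by simp
    also have "\<dots> = (1 + s * (1 + \<theta>)) / (1 + \<theta>)"
    proof -
      have "1 + \<theta> \<noteq> 0" using \<theta> by linarith
      then show ?thesis unfolding c by (simp add: add_divide_distrib)
    qed
    finally show ?thesis .
  qed
  also have "1 / (1 + \<theta>) * (1 / ((1 + s * (1 + \<theta>)) / (1 + \<theta>))) = 1 / (1 + s * (1 + \<theta>))"
  proof -
    have "1 / k * (1 / (A / k)) = 1 / A" if "k \<noteq> 0" for k A :: real using that by simp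
    moreover have "1 + \<theta> \<noteq> 0" using \<theta> by linarith
    ultimately show ?thesis by blast
  qed
  finally show ?thesis .
qed

lemma prob_space_spike_normal: "prob_space (spike_normal n \<theta> v)"
proof
  show "emeasure (spike_normal n \<theta> v) (space (spike_normal n \<theta> v)) = 1"
    using nn_integral_spike_normal_exp[of 0] by simp
qed

text \<open>The spike tilts only the component along \<open>v\<close>; orthogonal components keep
  variance one. The mean of the smallest eigenvalue is thereby bounded uniformly in
  \<theta>.\<close>

lemma nn_integral_spike_normal_orthogonal:
  assumes a: "a \<in> carrier_vec n" "a \<bullet>c a = 1" and orth: "a \<bullet>c v = 0"
  shows "(\<integral>\<^sup>+x. ennreal ((cmod (x \<bullet>c a))\<^sup>2) \<partial>spike_normal n \<theta> v) = 1"
proof -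
  have am: "(\<lambda>x. x \<bullet>c a) \<in> borel_measurable (borel_cvec n)"
    by (rule cvec_measurable_cscalar_prod[OF measurable_ident_sets[OF refl]]) (simp add: space_borel_cvec a(1))
  then have am': "(\<lambda>x. ennreal ((cmod (x \<bullet>c a))\<^sup>2)) \<in> borel_measurable (borel_cvec n)" by measurable
  interpret prob_space "spike_normal n \<theta> v" by (rule prob_space_spike_normal)
  let ?h = "\<lambda>z. ennreal (exp (\<theta> / (1 + \<theta>) * (cmod z)\<^sup>2) / (1 + \<theta>))"
  have "(\<integral>\<^sup>+x. ennreal ((cmod (x \<bullet>c a))\<^sup>2) \<partial>spike_normal n \<theta> v) = (\<integral>\<^sup>+x. ennreal ((cmod (x \<bullet>c a))\<^sup>2) * ?h (x \<bullet>c v) \<partial>std_cnormal n)"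
    unfolding nn_integral_spike_normal[OF am'] by (rule nn_integral_cong) (rule mult.commute)
  also have "\<dots> = (\<integral>\<^sup>+x. ?h (x \<bullet>c v) \<partial>std_cnormal n)"
    by (rule nn_integral_std_cnormal_orthogonal_moment[OF v(1) a orth]) measurable
  also have "\<dots> = (\<integral>\<^sup>+x. 1 \<partial>spike_normal n \<theta> v)"
    by (subst nn_integral_spike_normal) auto
  also have "\<dots> = 1" using emeasure_space_1 by simp
  finally show ?thesis .
qed

abbreviation spike_cols :: "nat \<Rightarrow> (nat \<Rightarrow> complex vec) measure" where
  "spike_cols m \<equiv> PiM {..<m} (\<lambda>_. spike_normal n \<theta> v)"

lemma sets_spike_cols: "sets (spike_cols m) = sets (cnormal_cols n m)"
  by (intro sets_PiM_cong) (simp_all add: spike_normal_sets sets_std_cnormal)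

lemma measurable_spike_cols: "measurable (spike_cols m) N = measurable (cnormal_cols n m) N"
  by (rule measurable_cong_sets[OF sets_spike_cols refl])

lemma spike_weight_prod:
  "spike_weight \<theta> m X v = (\<Prod>k<m. ennreal (exp (\<theta> / (1 + \<theta>) * (cmod (X k \<bullet>c v))\<^sup>2) / (1 + \<theta>)))"
  using \<theta> by (simp add: spike_weight_def spike_energy_def prod_ennreal prod_dividef exp_sum sum_distrib_left)

lemma spike_weight_cols_measurable: "(\<lambda>X. spike_weight \<theta> m X v) \<in> borel_measurable (cnormal_cols n m)"
  by (rule spike_weight_measurable[where f = "\<lambda>X. X", OF col_measurable]) (auto simp: space_borel_cvec v(1))

lemma spike_cols_density:
  "spike_cols m = density (cnormal_cols n m) (\<lambda>X. spike_weight \<theta> m X v)"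
proof -
  interpret S: product_sigma_finite "\<lambda>_::nat. spike_normal n \<theta> v"
    by (intro product_sigma_finite.intro prob_space_imp_sigma_finite prob_space_spike_normal)
  interpret C: product_sigma_finite "\<lambda>_::nat. std_cnormal n" by (rule product_sigma_finite_std_cnormal)
  let ?h = "\<lambda>x. ennreal (exp (\<theta> / (1 + \<theta>) * (cmod (x \<bullet>c v))\<^sup>2) / (1 + \<theta>))"
  have "density (cnormal_cols n m) (\<lambda>X. spike_weight \<theta> m X v) = spike_cols m"
  proof (rule S.PiM_eqI)
    show "sets (density (cnormal_cols n m) (\<lambda>X. spike_weight \<theta> m X v)) = sets (spike_cols m)"
      by (simp add: sets_spike_cols)
    fix A assume A: "\<And>i. i \<in> {..<m} \<Longrightarrow> A i \<in> sets (spike_normal n \<theta> v)"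
    then have Ab: "A i \<in> sets (borel_cvec n)" if "i < m" for i using that by (simp add: spike_normal_sets)
    have AP: "Pi\<^sub>E {..<m} A \<in> sets (cnormal_cols n m)"
      using Ab by (intro sets_PiM_I_finite) (auto simp: sets_std_cnormal)
    have "emeasure (density (cnormal_cols n m) (\<lambda>X. spike_weight \<theta> m X v)) (Pi\<^sub>E {..<m} A)
        = (\<integral>\<^sup>+X. spike_weight \<theta> m X v * indicator (Pi\<^sub>E {..<m} A) X \<partial>cnormal_cols n m)"
      by (rule emeasure_density[OF spike_weight_cols_measurable AP])
    also have "\<dots> = (\<integral>\<^sup>+X. (\<Prod>k<m. ?h (X k) * indicator (A k) (X k)) \<partial>cnormal_cols n m)"
    proof (rule nn_integral_cong)
      fix X assume X: "X \<in> space (cnormal_cols n m)"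
      have "indicator (Pi\<^sub>E {..<m} A) X = (\<Prod>k<m. indicator (A k) (X k) :: ennreal)"
        using X by (auto simp: indicator_def space_PiM PiE_iff prod_zero_iff)
      then show "spike_weight \<theta> m X v * indicator (Pi\<^sub>E {..<m} A) X = (\<Prod>k<m. ?h (X k) * indicator (A k) (X k))"
        unfolding spike_weight_prod prod.distrib by simp
    qed
    also have "\<dots> = (\<Prod>k<m. (\<integral>\<^sup>+x. ?h x * indicator (A k) x \<partial>std_cnormal n))"
      using Ab spike_density_measurable by (intro C.product_nn_integral_prod) auto
    also have "\<dots> = (\<Prod>k<m. emeasure (spike_normal n \<theta> v) (A k))"
      unfolding complex_normal_spike[OF v \<theta>] using Ab spike_density_measurable
      by (intro prod.cong refl emeasure_density[symmetric]) (auto simp: sets_std_cnormal)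
    finally show "emeasure (density (cnormal_cols n m) (\<lambda>X. spike_weight \<theta> m X v)) (Pi\<^sub>E {..<m} A)
        = (\<Prod>k\<in>{..<m}. emeasure (spike_normal n \<theta> v) (A k))" .
  qed simp
  then show ?thesis ..
qed

lemma nn_integral_spike_cols:
  assumes "H \<in> borel_measurable (cnormal_cols n m)"
  shows "(\<integral>\<^sup>+X. H X \<partial>spike_cols m) = (\<integral>\<^sup>+X. spike_weight \<theta> m X v * H X \<partial>cnormal_cols n m)"
  unfolding spike_cols_density using assms spike_weight_cols_measurable by (subst nn_integral_density) auto

lemma nn_integral_spike_cols_exp:
  assumes s: "0 \<le> s"
  shows "(\<integral>\<^sup>+X. ennreal (exp (- s * spike_energy m X v)) \<partial>spike_cols m) = ennreal (1 / (1 + s * (1 + \<theta>)) ^ m)"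
proof -
  interpret S: product_sigma_finite "\<lambda>_::nat. spike_normal n \<theta> v"
    by (intro product_sigma_finite.intro prob_space_imp_sigma_finite prob_space_spike_normal)
  have "(\<integral>\<^sup>+X. ennreal (exp (- s * spike_energy m X v)) \<partial>spike_cols m)
      = (\<integral>\<^sup>+X. (\<Prod>k<m. ennreal (exp (- s * (cmod (X k \<bullet>c v))\<^sup>2))) \<partial>spike_cols m)"
    by (intro nn_integral_cong) (simp add: spike_energy_def prod_ennreal exp_sum sum_distrib_left sum_negf[symmetric])
  also have "\<dots> = (\<Prod>k<m. (\<integral>\<^sup>+x. ennreal (exp (- s * (cmod (x \<bullet>c v))\<^sup>2)) \<partial>spike_normal n \<theta> v))"
    using spike_overlap_measurable
    by (intro S.product_nn_integral_prod) (simp_all add: measurable_spike_normal)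
  also have "\<dots> = (\<Prod>k<m. ennreal (1 / (1 + s * (1 + \<theta>))))"
    by (intro prod.cong refl nn_integral_spike_normal_exp[OF s])
  also have "\<dots> = ennreal (1 / (1 + s * (1 + \<theta>)) ^ m)"
    using s \<theta> by (simp add: ennreal_power power_one_over)
  finally show ?thesis .
qed

section \<open>The mean of the smallest eigenvalue\<close>

lemma orthogonal_unit_vec_exists:
  assumes n: "2 \<le> n" and X: "\<And>k. k < n - 2 \<Longrightarrow> X k \<in> carrier_vec n"
  obtains a where "a \<in> carrier_vec n" "a \<bullet>c a = 1" "a \<bullet>c v = 0" "\<And>k. k < n - 2 \<Longrightarrow> X k \<bullet>c a = 0"
proof -
  \<comment> \<open>The n - 1 orthogonality conditions as rows, padded by a zero row to a square
    matrix. Its determinant vanishes, and a kernel vector is what is sought.\<close>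
  define A where "A = mat n n (\<lambda>(k, i). if k < n - 2 then cnj (X k $ i) else if k = n - 2 then cnj (v $ i) else 0)"
  have A: "A \<in> carrier_mat n n" by (simp add: A_def)
  have row0: "A $$ (n - 1, i) = 0" if "i < n" for i using n that by (auto simp: A_def)
  have "det A = 0"
  proof -
    have "(\<Prod>i = 0..<n. A $$ (i, p i)) = 0" if "p permutes {0..<n}" for p
      using n row0[of "p (n - 1)"] permutes_in_image[OF that, of "n - 1"] by (intro prod_zero) (auto intro!: bexI[of _ "n - 1"])
    then show ?thesis using A by (auto simp: det_def intro!: sum.neutral)
  qed
  then obtain b where b: "b \<in> carrier_vec n" "b \<noteq> 0\<^sub>v n" "A *\<^sub>v b = 0\<^sub>v n"
    using det_0_iff_vec_prod_zero[OF A] by auto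
  have Ab: "(\<Sum>i<n. A $$ (k, i) * b $ i) = 0" if "k < n" for k
    using mult_mat_vec_sum[OF A b(1) that] b(3) that by simp
  have bX: "b \<bullet>c X k = 0" if k: "k < n - 2" for k
    unfolding cscalar_prod_sum[OF X[OF k]] using Ab[of k] k by (simp add: A_def mult.commute)
  have bv: "b \<bullet>c v = 0"
    unfolding cscalar_prod_sum[OF v(1)] using Ab[of "n - 2"] n by (simp add: A_def mult.commute)
  have sq: "sq_norm_cvec b \<noteq> 0" using b sq_norm_cvec_eq_0 by blast
  show ?thesis
  proof (rule that)
    show d: "direction b \<in> carrier_vec n" by (rule direction_carrier[OF b(1)])
    show "direction b \<bullet>c direction b = 1" by (rule direction_unit[OF sq])
    show "direction b \<bullet>c v = 0" unfolding direction_def using bv cscalar_prod_smult(1)[OF b(1) v(1)] by simp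
    fix k assume k: "k < n - 2"
    have "X k \<bullet>c b = cnj (b \<bullet>c X k)"
      unfolding cscalar_prod_sum[OF b(1)] cscalar_prod_sum[OF X[OF k]] cnj_sum by (simp add: mult.commute)
    then show "X k \<bullet>c direction b = 0" unfolding direction_def using bX[OF k] cscalar_prod_smult(2)[OF X[OF k] b(1)] by simp
  qed
qed

text \<open>A unit vector orthogonal to \<open>v\<close> and to the first \<open>n - 2\<close> columns is an admissible test vector for
  the smallest eigenvalue, and it is independent of the remaining columns.\<close>

lemma nn_integral_min_eig_le:
  assumes n: "2 \<le> n" "n \<le> m"
  shows "(\<integral>\<^sup>+X. ennreal (min_eig n (gram n m X)) \<partial>spike_cols m) \<le> ennreal (real (m - (n - 2)))"
proof -
  let ?M = "\<lambda>_::nat. spike_normal n \<theta> v"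
  let ?I = "{..<n - 2}" and ?J = "{n - 2..<m}"
  interpret P: prob_space "spike_normal n \<theta> v" by (rule prob_space_spike_normal)
  interpret S: product_prob_space ?M by standard
  interpret PI: prob_space "PiM ?I ?M" by (intro prob_space_PiM prob_space_spike_normal)
  interpret PJ: prob_space "PiM ?J ?M" by (intro prob_space_PiM prob_space_spike_normal)
  have IJ: "{..<m} = ?I \<union> ?J" "?I \<inter> ?J = {}" using n by auto
  \<comment> \<open>Setting the value to zero where the discriminant vanishes makes the bound below
    valid for every \<open>X\<close>, so that null sets do not have to be followed through the
    sections of the product.\<close>
  define H where "H X = ennreal (if disc n (gram n m X) \<noteq> 0 then min_eig n (gram n m X) else 0)" for X
  have dm: "(\<lambda>X. disc n (gram n m X)) \<in> borel_measurable (cnormal_cols n m)"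
    by (intro borel_measurable_disc gram_index_measurable)
  have Hm: "H \<in> borel_measurable (cnormal_cols n m)"
    unfolding H_def using dm measurable_min_eig[OF gram_in_borel_cmat] by measurable
  have aed: "AE X in spike_cols m. disc n (gram n m X) \<noteq> 0"
    unfolding spike_cols_density using AE_disc_gram[OF n(2)] spike_weight_cols_measurable by (subst AE_density) auto
  have "(\<integral>\<^sup>+X. ennreal (min_eig n (gram n m X)) \<partial>spike_cols m) = (\<integral>\<^sup>+X. H X \<partial>PiM (?I \<union> ?J) ?M)"
    unfolding IJ(1)[symmetric] using aed by (intro nn_integral_cong_AE) (auto simp: H_def)
  also have "\<dots> = (\<integral>\<^sup>+x. (\<integral>\<^sup>+y. H (merge ?I ?J (x, y)) \<partial>PiM ?J ?M) \<partial>PiM ?I ?M)"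
    by (rule S.product_nn_integral_fold[OF IJ(2)]) (use Hm in \<open>simp_all add: IJ(1)[symmetric] measurable_spike_cols\<close>)
  also have "\<dots> \<le> (\<integral>\<^sup>+x. ennreal (real (m - (n - 2))) \<partial>PiM ?I ?M)"
  proof (rule nn_integral_mono)
    fix x assume x: "x \<in> space (PiM ?I ?M)"
    then have xc: "x k \<in> carrier_vec n" if "k < n - 2" for k using that by (auto simp: space_PiM)
    obtain a where a: "a \<in> carrier_vec n" "a \<bullet>c a = 1" "a \<bullet>c v = 0" "\<And>k. k < n - 2 \<Longrightarrow> x k \<bullet>c a = 0"
      using orthogonal_unit_vec_exists[OF n(1), of x] xc by blast
    have am: "(\<lambda>x. ennreal ((cmod (x \<bullet>c a))\<^sup>2)) \<in> borel_measurable (borel_cvec n)"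
    proof -
      have [measurable]: "(\<lambda>x. x \<bullet>c a) \<in> borel_measurable (borel_cvec n)"
        by (rule cvec_measurable_cscalar_prod[OF measurable_ident_sets[OF refl]]) (simp add: space_borel_cvec a(1))
      show ?thesis by measurable
    qed
    have ym: "(\<lambda>y. ennreal ((cmod (y k \<bullet>c a))\<^sup>2)) \<in> borel_measurable (PiM ?J ?M)" if "k \<in> ?J" for k
      by (rule measurable_compose[OF measurable_component_singleton[OF that]]) (simp add: measurable_spike_normal am)
    have "(\<integral>\<^sup>+y. H (merge ?I ?J (x, y)) \<partial>PiM ?J ?M) \<le> (\<integral>\<^sup>+y. (\<Sum>k\<in>?J. ennreal ((cmod (y k \<bullet>c a))\<^sup>2)) \<partial>PiM ?J ?M)"
    proof (rule nn_integral_mono)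
      fix y
      let ?X = "merge ?I ?J (x, y)"
      show "H ?X \<le> (\<Sum>k\<in>?J. ennreal ((cmod (y k \<bullet>c a))\<^sup>2))"
      proof (cases "disc n (gram n m ?X) = 0")
        case False
        then obtain l u where sp: "spectral n (gram n m ?X) l u"
          using hermitian_spectral[OF gram_carrier gram_adjoint] by blast
        have "min_eig n (gram n m ?X) \<le> spike_energy m ?X a"
          using n by (intro min_eig_le_spike_energy[OF sp _ a(1,2)]) simp
        also have "\<dots> = (\<Sum>k\<in>?J. (cmod (y k \<bullet>c a))\<^sup>2)"
          unfolding spike_energy_def IJ(1) using IJ(2) a(4)
          by (subst sum.union_disjoint) (auto simp: merge_def intro!: sum.cong)
        finally show ?thesis using False by (simp add: H_def ennreal_leI)
      qed (simp add: H_def)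
    qed
    also have "\<dots> = (\<Sum>k\<in>?J. (\<integral>\<^sup>+y. ennreal ((cmod (y k \<bullet>c a))\<^sup>2) \<partial>PiM ?J ?M))"
      by (rule nn_integral_sum[OF ym])
    \<comment> \<open>Each column outside the first n - 2 has mean squared overlap one with
      \<open>a\<close>, since \<open>a\<close> is orthogonal to \<open>v\<close> and depends on
      \<open>x\<close> alone.\<close>
    also have "\<dots> = (\<Sum>k\<in>?J. 1)"
    proof (intro sum.cong refl)
      fix k assume k: "k \<in> ?J"
      have "(\<integral>\<^sup>+y. ennreal ((cmod (y k \<bullet>c a))\<^sup>2) \<partial>PiM ?J ?M)
          = (\<integral>\<^sup>+x. ennreal ((cmod (x \<bullet>c a))\<^sup>2) \<partial>distr (PiM ?J ?M) (spike_normal n \<theta> v) (\<lambda>y. y k))"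
        by (rule nn_integral_distr[symmetric]) (use k am in \<open>auto simp: measurable_spike_normal\<close>)
      also have "distr (PiM ?J ?M) (spike_normal n \<theta> v) (\<lambda>y. y k) = spike_normal n \<theta> v"
        by (rule distr_PiM_component[OF _ k]) (rule prob_space_spike_normal)
      also have "(\<integral>\<^sup>+x. ennreal ((cmod (x \<bullet>c a))\<^sup>2) \<partial>spike_normal n \<theta> v) = 1"
        by (rule nn_integral_spike_normal_orthogonal[OF a(1-3)])
      finally show "(\<integral>\<^sup>+y. ennreal ((cmod (y k \<bullet>c a))\<^sup>2) \<partial>PiM ?J ?M) = 1" .
    qed
    also have "\<dots> = ennreal (real (m - (n - 2)))" by (simp add: ennreal_of_nat_eq_real_of_nat)
    finally show "(\<integral>\<^sup>+y. H (merge ?I ?J (x, y)) \<partial>PiM ?J ?M) \<le> ennreal (real (m - (n - 2)))" .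
  qed
  also have "\<dots> = ennreal (real (m - (n - 2)))" using PI.emeasure_space_1 by simp
  finally show ?thesis .
qed

end

section \<open>The chi-squared limit\<close>

text \<open>Two real Lebesgue coordinates are read as one complex one, so that a function of the sum
  of squares can be integrated by the law of the squared modulus.\<close>

lemma nn_integral_complex_pair:
  assumes [measurable]: "h \<in> borel_measurable borel"
  shows "(\<integral>\<^sup>+(z::complex). h ((cmod z)\<^sup>2) \<partial>lborel) = (\<integral>\<^sup>+x. (\<integral>\<^sup>+y. h (x\<^sup>2 + y\<^sup>2) \<partial>lborel) \<partial>lborel)"
proof -
  interpret P: product_sigma_finite "\<lambda>_::complex. lborel :: real measure" by standard
  let ?S = "\<lambda>f::complex \<Rightarrow> real. \<Sum>b\<in>Basis. f b *\<^sub>R b"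
  have l: "(lborel :: complex measure) = distr (PiM Basis (\<lambda>_. lborel)) borel ?S"
    unfolding lborel_def[where 'a=complex] by (simp only: lborel_eq_real[symmetric])
  have B: "Basis = {1, \<i>}" by (simp add: Basis_complex_def)
  have S: "(cmod (?S f))\<^sup>2 = (f 1)\<^sup>2 + (f \<i>)\<^sup>2" for f
    by (simp add: B cmod_power2)
  have "(\<integral>\<^sup>+(z::complex). h ((cmod z)\<^sup>2) \<partial>lborel) = (\<integral>\<^sup>+f. h ((f 1)\<^sup>2 + (f \<i>)\<^sup>2) \<partial>PiM {1, \<i>} (\<lambda>_. lborel))"
    unfolding l by (subst nn_integral_distr) (simp_all add: S B[symmetric])
  also have "\<dots> = (\<integral>\<^sup>+z. h ((fst z)\<^sup>2 + (snd z)\<^sup>2) \<partial>(lborel \<Otimes>\<^sub>M lborel))"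
    by (rule P.product_nn_integral_pair[of "\<lambda>x y. h (x\<^sup>2 + y\<^sup>2)"]) (simp_all add: complex_eq_iff)
  also have "\<dots> = (\<integral>\<^sup>+x. (\<integral>\<^sup>+y. h (x\<^sup>2 + y\<^sup>2) \<partial>lborel) \<partial>lborel)"
    by (subst lborel.nn_integral_fst[symmetric]) simp_all
  finally show ?thesis .
qed

text \<open>The joint density of two standard normals depends only on the sum of squares, whose law
  under planar Lebesgue measure has constant density pi; what remains is the tail of an exponential
  law with rate 1/2.\<close>

lemma chi_squared_2_tail:
  assumes r: "0 \<le> r"
  shows "emeasure (chi_squared 2) {r<..} = ennreal (exp (- r / 2))"
proof -
  let ?N = "density lborel (\<lambda>x. ennreal (std_normal_density x))"
  interpret N: prob_space ?N by (rule prob_space_normal_density) simp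
  interpret P: product_sigma_finite "\<lambda>_::nat. ?N" by standard
  have two: "{..<2} = {0, 1::nat}" by auto
  define h where "h s = ennreal (exp (- (1/2) * s)) * indicator {r<..} s" for s
  have hm[measurable]: "h \<in> borel_measurable borel" unfolding h_def by measurable
  have "emeasure (chi_squared 2) {r<..} = (\<integral>\<^sup>+x. indicator {r<..} (\<Sum>i<2. (x i)\<^sup>2) \<partial>PiM {..<2} (\<lambda>_::nat. ?N))"
    unfolding chi_squared_def
    by (subst nn_integral_indicator[symmetric], simp, subst nn_integral_distr) (auto simp: borel_measurable_indicator)
  also have "\<dots> = (\<integral>\<^sup>+x. indicator {r<..} ((x 0)\<^sup>2 + (x 1)\<^sup>2) \<partial>PiM {0, 1} (\<lambda>_::nat. ?N))"
    unfolding two by simp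
  also have "\<dots> = (\<integral>\<^sup>+z. indicator {r<..} ((fst z)\<^sup>2 + (snd z)\<^sup>2) \<partial>(?N \<Otimes>\<^sub>M ?N))"
    by (rule P.product_nn_integral_pair[of "\<lambda>x y. indicator {r<..} (x\<^sup>2 + y\<^sup>2)"]) simp_all
  also have "\<dots> = (\<integral>\<^sup>+x. (\<integral>\<^sup>+y. indicator {r<..} (x\<^sup>2 + y\<^sup>2) \<partial>?N) \<partial>?N)"
    by (subst N.nn_integral_fst[symmetric]) simp_all
  also have "\<dots> = (\<integral>\<^sup>+x. ennreal (std_normal_density x) * (\<integral>\<^sup>+y. ennreal (std_normal_density y) * indicator {r<..} (x\<^sup>2 + y\<^sup>2) \<partial>lborel) \<partial>lborel)"
    by (simp add: nn_integral_density)
  also have "\<dots> = (\<integral>\<^sup>+x. (\<integral>\<^sup>+y. ennreal (1 / (2 * pi)) * h (x\<^sup>2 + y\<^sup>2) \<partial>lborel) \<partial>lborel)"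
  proof (rule nn_integral_cong)
    fix x :: real
    have "ennreal (std_normal_density x) * (ennreal (std_normal_density y) * indicator {r<..} (x\<^sup>2 + y\<^sup>2)) = ennreal (1 / (2 * pi)) * h (x\<^sup>2 + y\<^sup>2)" for y
    proof -
      have "std_normal_density x * std_normal_density y = 1 / (2 * pi) * exp (- (1/2) * (x\<^sup>2 + y\<^sup>2))"
        by (simp add: std_normal_density_def exp_add[symmetric] real_sqrt_mult[symmetric] algebra_simps)
      then have "ennreal (std_normal_density x) * ennreal (std_normal_density y) = ennreal (1 / (2 * pi)) * ennreal (exp (- (1/2) * (x\<^sup>2 + y\<^sup>2)))"
        by (simp only: ennreal_mult[symmetric] normal_density_nonneg exp_ge_zero divide_nonneg_nonneg zero_le_one mult_nonneg_nonneg pi_ge_zero zero_le_numeral)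
      then show ?thesis unfolding h_def mult.assoc[symmetric] by simp
    qed
    then show "ennreal (std_normal_density x) * (\<integral>\<^sup>+y. ennreal (std_normal_density y) * indicator {r<..} (x\<^sup>2 + y\<^sup>2) \<partial>lborel)
        = (\<integral>\<^sup>+y. ennreal (1 / (2 * pi)) * h (x\<^sup>2 + y\<^sup>2) \<partial>lborel)"
      by (subst nn_integral_cmult[symmetric]) simp_all
  qed
  also have "\<dots> = ennreal (1 / (2 * pi)) * (\<integral>\<^sup>+x. (\<integral>\<^sup>+y. h (x\<^sup>2 + y\<^sup>2) \<partial>lborel) \<partial>lborel)"
    by (simp add: nn_integral_cmult)
  also have "(\<integral>\<^sup>+x. (\<integral>\<^sup>+y. h (x\<^sup>2 + y\<^sup>2) \<partial>lborel) \<partial>lborel) = ennreal pi * (\<integral>\<^sup>+s. h s * indicator {0..} s \<partial>lborel)"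
    by (simp only: nn_integral_complex_pair[OF hm, symmetric] nn_integral_cmod_square[OF hm])
  also have "(\<integral>\<^sup>+s. h s * indicator {0..} s \<partial>lborel) = (\<integral>\<^sup>+s. ennreal (exp (- (1/2) * s)) * indicator {r..} s \<partial>lborel)"
    by (rule nn_integral_cong_AE, rule AE_mp[OF AE_lborel_singleton[of r]], rule AE_I2)
       (use r in \<open>auto simp: h_def indicator_def\<close>)
  also have "\<dots> = ennreal (exp (- (1/2) * r) / (1/2))" by (rule nn_integral_exp_tail) simp
  also have "ennreal (1 / (2 * pi)) * (ennreal pi * ennreal (exp (- (1/2) * r) / (1/2))) = ennreal (exp (- r / 2))"
    by (simp add: ennreal_mult[symmetric])
  finally show ?thesis .
qed

lemma prob_space_chi_squared: "prob_space (chi_squared k)"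
proof -
  have "prob_space (density lborel (\<lambda>x. ennreal (std_normal_density x)))" by (rule prob_space_normal_density) simp
  then have "prob_space (PiM {..<k} (\<lambda>_::nat. density lborel (\<lambda>x. ennreal (std_normal_density x))))" by (intro prob_space_PiM)
  then show ?thesis unfolding chi_squared_def by (intro prob_space.prob_space_distr) simp_all
qed

lemma cdf_chi_squared_2_scaled:
  assumes b: "0 < b"
  shows "cdf (distr (chi_squared 2) borel (\<lambda>x. x / (2 * b))) t = (if t < 0 then 0 else 1 - exp (- b * t))"
proof -
  interpret prob_space "chi_squared 2" by (rule prob_space_chi_squared)
  have sets: "sets (chi_squared 2) = sets borel" "space (chi_squared 2) = UNIV" by (simp_all add: chi_squared_def)
  have "cdf (distr (chi_squared 2) borel (\<lambda>x. x / (2 * b))) t = prob ((\<lambda>x. x / (2 * b)) -` {..t} \<inter> UNIV)"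
    unfolding cdf_def by (subst measure_distr) (simp_all add: sets cong: measurable_cong_sets)
  also have "(\<lambda>x. x / (2 * b)) -` {..t} \<inter> UNIV = UNIV - {2 * b * t<..}"
    using b by (auto simp: field_simps)
  also have "prob (UNIV - {2 * b * t<..}) = 1 - prob {2 * b * t<..}"
    using prob_compl[of "{2 * b * t<..}"] by (simp add: sets)
  also have "\<dots> = (if t < 0 then 0 else 1 - exp (- b * t))"
  proof (cases "t < 0")
    \<comment> \<open>For negative arguments the tail formula does not apply; the tail beyond 0
      already has full mass.\<close>
    case True
    have "ennreal (exp (- 0 / 2)) = emeasure (chi_squared 2) {0<..}" by (rule chi_squared_2_tail[symmetric]) simp
    also have "\<dots> \<le> emeasure (chi_squared 2) {2 * b * t<..}"
      using True b mult_pos_neg[of b t] by (intro emeasure_mono) (auto simp: sets)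
    finally have "1 \<le> prob {2 * b * t<..}" by (simp add: emeasure_eq_measure)
    then show ?thesis using True by (simp add: antisym)
  next
    case False
    then have "emeasure (chi_squared 2) {2 * b * t<..} = ennreal (exp (- (2 * b * t) / 2))"
      using b by (intro chi_squared_2_tail) simp
    then show ?thesis using False by (simp add: emeasure_eq_measure)
  qed
  finally show ?thesis .
qed

text \<open>The Jacobian of the cap contributes \<open>exp (- t)\<close> and the Laplace transform
  of the spike energy \<open>exp (- \<theta> * t)\<close>. Replacing the exponents n - 1 and n +
  \<alpha> by n costs factors that tend to one.\<close>

lemma gap_limit:
  fixes t \<theta> :: real and \<alpha> :: nat
  shows "(\<lambda>n. (1 - t / real n) ^ (n - 1) * (1 / (1 + \<theta> * (t / real n)) ^ (n + \<alpha>))) \<longlonglongrightarrow> exp (- (1 + \<theta>) * t)"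
proof -
  have e1: "(\<lambda>n. (1 - t / real n) ^ n) \<longlonglongrightarrow> exp (- t)"
    using tendsto_exp_limit_sequentially[of "- t"] by simp
  have e2: "(\<lambda>n. (1 + \<theta> * (t / real n)) ^ n) \<longlonglongrightarrow> exp (\<theta> * t)"
    using tendsto_exp_limit_sequentially[of "\<theta> * t"] by simp
  have z: "(\<lambda>n. t / real n) \<longlonglongrightarrow> 0" by (rule lim_const_over_n)
  have "(\<lambda>n. (1 - t / real n) ^ n / (1 - t / real n) * (1 / ((1 + \<theta> * (t / real n)) ^ n * (1 + \<theta> * (t / real n)) ^ \<alpha>)))
      \<longlonglongrightarrow> exp (- t) / (1 - 0) * (1 / (exp (\<theta> * t) * (1 + \<theta> * 0) ^ \<alpha>))"
    by (intro tendsto_intros e1 e2 z) simp_all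
  also have "exp (- t) / (1 - 0) * (1 / (exp (\<theta> * t) * (1 + \<theta> * 0) ^ \<alpha>)) = exp (- (1 + \<theta>) * t)"
    by (simp add: exp_minus[symmetric] exp_add[symmetric] inverse_eq_divide[symmetric] algebra_simps)
  finally have l: "(\<lambda>n. (1 - t / real n) ^ n / (1 - t / real n) * (1 / ((1 + \<theta> * (t / real n)) ^ n * (1 + \<theta> * (t / real n)) ^ \<alpha>)))
      \<longlonglongrightarrow> exp (- (1 + \<theta>) * t)" .
  have "eventually (\<lambda>n. t / real n < 1) sequentially" by (rule order_tendstoD(2)[OF z]) simp
  then have "eventually (\<lambda>n. (1 - t / real n) ^ n / (1 - t / real n) * (1 / ((1 + \<theta> * (t / real n)) ^ n * (1 + \<theta> * (t / real n)) ^ \<alpha>))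
      = (1 - t / real n) ^ (n - 1) * (1 / (1 + \<theta> * (t / real n)) ^ (n + \<alpha>))) sequentially"
    using eventually_gt_at_top[of 0]
  proof eventually_elim
    case (elim n)
    then obtain k where "n = Suc k" by (cases n) auto
    then show ?case using elim by (simp add: power_add mult_ac)
  qed
  then show ?thesis by (rule Lim_transform_eventually[OF l])
qed

section \<open>Tail bounds for a realization of the Wishart law\<close>

lemma complex_wishart_gram:
  "complex_wishart n m S = distr (PiM {..<m} (\<lambda>_. complex_normal n S)) (borel_cmat n n) (gram n m)"
  unfolding complex_wishart_def
proof (rule distr_cong[OF refl refl])
  fix X assume "X \<in> space (PiM {..<m} (\<lambda>_. complex_normal n S))"
  then have "X k \<in> carrier_vec n" if "k < m" for k
    using that by (auto simp: space_PiM complex_normal_def)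
  then have d: "dim_vec (X k) = n" if "k < m" for k using that by auto
  show "(let A = mat_of_cols n (map X [0..<m]) in A * mat_adjoint A) = gram n m X"
    by (rule eq_matI) (auto simp: Let_def gram_def scalar_prod_def atLeast0LessThan mat_of_cols_index d intro!: sum.cong)
qed

lemma exp_gap_lower:
  fixes s R l :: real
  shows "0 \<le> s \<Longrightarrow> 0 \<le> l \<Longrightarrow> exp (- s * R) \<le> exp (- s * (R - l))"
  by (simp add: mult_left_mono)

text \<open>From \<open>exp (- s * (R - l)) \<le> 1\<close> and
  \<open>1 - exp (- (s * l)) \<le> s * l\<close>. The error is linear in \<open>l\<close>, so the
  joint law of \<open>R\<close> and \<open>l\<close> is replaced by the mean of
  \<open>l\<close>.\<close>

lemma exp_gap_upper:
  fixes s R l :: real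
  assumes "0 \<le> s" "0 \<le> l" "l \<le> R"
  shows "exp (- s * (R - l)) \<le> exp (- s * R) + s * l"
proof -
  have "exp (- s * (R - l)) - exp (- s * R) = exp (- s * (R - l)) * (1 - exp (- (s * l)))"
    by (simp add: algebra_simps exp_add[symmetric])
  also have "\<dots> \<le> 1 * (s * l)"
    using assms exp_ge_add_one_self[of "- (s * l)"] by (intro mult_mono) auto
  finally show ?thesis by simp
qed

text \<open>Only the law of \<open>W\<close> is prescribed, whereas the identity speaks of explicit
  columns. The tail is therefore expressed almost surely through \<open>min_overlap\<close>, a
  function of \<open>W\<close>, and moved along that law to the Gram matrix of the spiked
  columns.\<close>

lemma spike_tail_bounds:
  fixes \<theta> :: real and \<alpha> n :: nat and v :: "complex vec" and W :: "'a \<Rightarrow> complex mat" and u :: "'a \<Rightarrow> complex vec"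
  assumes \<theta>: "\<theta> \<ge> 0" and n: "2 \<le> n" and M: "prob_space M"
    and v: "v \<in> carrier_vec n" "v \<bullet>c v = 1"
    and W: "W \<in> M \<rightarrow>\<^sub>M borel_cmat n n"
    and law: "distr M (borel_cmat n n) W = complex_wishart n (n + \<alpha>) (spike_cov n \<theta> v)"
    and u: "AE \<omega> in M. u \<omega> \<bullet>c u \<omega> = 1 \<and> eigenvector (W \<omega>) (u \<omega>) (complex_of_real (smallest_eigenvalue (W \<omega>)))"
    and um: "(\<lambda>\<omega>. (cmod (u \<omega> \<bullet>c v))\<^sup>2) \<in> borel_measurable M"
    and a: "0 \<le> a" "a < 1"
  defines "p \<equiv> measure M {\<omega> \<in> space M. (cmod (u \<omega> \<bullet>c v))\<^sup>2 > a}"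
    and "L \<equiv> 1 / (1 + \<theta> * a) ^ (n + \<alpha>)"
  shows "(1 - a) ^ (n - 1) * L \<le> p" "p \<le> (1 - a) ^ (n - 1) * (L + \<theta> * a * (\<alpha> + 2))"
proof -
  let ?m = "n + \<alpha>" and ?s = "\<theta> / (1 + \<theta>) * a"
  let ?C = "spike_cols n \<theta> v ?m"
  interpret M: prob_space M by fact
  have n0: "0 < n" and nm: "n \<le> ?m" using n by auto
  have s0: "0 \<le> ?s" using \<theta> a by simp
  \<comment> \<open>With this the Laplace transform of the energy at \<open>?s\<close> becomes
    exactly \<open>L\<close>.\<close>
  have s1: "1 + ?s * (1 + \<theta>) = 1 + \<theta> * a"
  proof -
    have "1 + \<theta> \<noteq> 0" using \<theta> by linarith
    then show ?thesis by simp
  qed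
  have gm: "gram n ?m \<in> ?C \<rightarrow>\<^sub>M borel_cmat n n"
    using gram_in_borel_cmat by (simp add: measurable_spike_cols[OF v \<theta>])
  have law': "distr M (borel_cmat n n) W = distr ?C (borel_cmat n n) (gram n ?m)"
    unfolding law complex_wishart_gram ..
  have aeC: "AE X in ?C. disc n (gram n ?m X) \<noteq> 0"
    unfolding spike_cols_density[OF v \<theta>]
    using AE_disc_gram[OF nm] spike_weight_cols_measurable[OF v \<theta>] by (subst AE_density) auto
  \<comment> \<open>Hermitian with simple spectrum, written as a measurable condition on the matrix
    alone: this almost sure property of Gram matrices can then be transported to \<open>W\<close>
    through equality of laws.\<close>
  define good where "good A \<longleftrightarrow> disc n A \<noteq> 0 \<and> (\<forall>i<n. \<forall>j<n. cnj (A $$ (j, i)) = A $$ (i, j))" for A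
  have goodm: "Measurable.pred (borel_cmat n n) good"
  proof -
    have id: "(\<lambda>A. A) \<in> borel_cmat n n \<rightarrow>\<^sub>M borel_cmat n n" by simp
    have [measurable]: "(\<lambda>A. disc n A) \<in> borel_measurable (borel_cmat n n)"
      by (intro borel_measurable_disc cmat_index_measurable[OF id])
    have "Measurable.pred (borel_cmat n n) (\<lambda>A. cnj (A $$ (j, i)) = A $$ (i, j))" if "i < n" "j < n" for i j
    proof -
      have [measurable]: "(\<lambda>A. A $$ (i, j)) \<in> borel_measurable (borel_cmat n n)"
        "(\<lambda>A. cnj (A $$ (j, i))) \<in> borel_measurable (borel_cmat n n)"
        using that by (auto intro!: cmat_index_measurable[OF id] borel_measurable_cnj)
      show ?thesis by measurable
    qed
    then have [measurable]: "Measurable.pred (borel_cmat n n) (\<lambda>A. \<forall>i\<in>{..<n}. \<forall>j\<in>{..<n}. cnj (A $$ (j, i)) = A $$ (i, j))"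
      by (intro pred_intros_finite) auto
    have "good = (\<lambda>A. disc n A \<noteq> 0 \<and> (\<forall>i\<in>{..<n}. \<forall>j\<in>{..<n}. cnj (A $$ (j, i)) = A $$ (i, j)))"
      by (auto simp: good_def fun_eq_iff)
    then show ?thesis by simp
  qed
  have "AE X in ?C. good (gram n ?m X)"
    using aeC by (rule AE_mp) (auto intro!: AE_I2 simp: good_def gram_index cnj_sum mult.commute)
  then have "AE A in distr M (borel_cmat n n) W. good A"
    unfolding law' using goodm by (subst AE_distr_iff[OF gm]) (auto simp: pred_def)
  then have aeM: "AE \<omega> in M. good (W \<omega>)" by (rule AE_distrD[OF W])
  have overlap: "AE \<omega> in M. (cmod (u \<omega> \<bullet>c v))\<^sup>2 = min_overlap n (W \<omega>) v"
  proof (rule AE_mp[OF aeM], rule AE_mp[OF u], rule AE_I2, intro impI)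
    fix \<omega> assume \<omega>: "\<omega> \<in> space M" and g: "good (W \<omega>)"
      and e: "u \<omega> \<bullet>c u \<omega> = 1 \<and> eigenvector (W \<omega>) (u \<omega>) (complex_of_real (smallest_eigenvalue (W \<omega>)))"
    have Wc: "W \<omega> \<in> carrier_mat n n" by (rule cmat_carrier[OF W \<omega>])
    have "mat_adjoint (W \<omega>) = W \<omega>" using Wc g by (intro eq_matI) (auto simp: good_def)
    then obtain l w where sp: "spectral n (W \<omega>) l w"
      using hermitian_spectral[OF Wc] g by (auto simp: good_def)
    obtain q where q: "q < n" "\<And>x. x \<in> carrier_vec n \<Longrightarrow> min_overlap n (W \<omega>) x = (cmod (w q \<bullet>c x))\<^sup>2"
      "smallest_eigenvalue (W \<omega>) = l q" "\<And>x. eigenvector (W \<omega>) x (complex_of_real (l q)) \<Longrightarrow> \<exists>c. x = c \<cdot>\<^sub>v w q"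
      by (rule spectral_min[OF sp n0]) (rule that, assumption+)
    have w: "w q \<in> carrier_vec n" "w q \<bullet>c w q = 1" using sp q(1) by (auto simp: spectral_def)
    \<comment> \<open>Simplicity makes the given eigenvector a multiple of \<open>w q\<close>, and
      both being unit vectors forces modulus one on the factor.\<close>
    obtain c where c: "u \<omega> = c \<cdot>\<^sub>v w q" using q(4) e unfolding q(3) by blast
    have "c * cnj c = 1" using e unfolding c using w by (simp add: cscalar_prod_smult mult.commute)
    then have "complex_of_real ((cmod c)\<^sup>2) = 1" by (simp only: complex_norm_square)
    then have "(cmod c)\<^sup>2 = 1" by (metis of_real_eq_1_iff)
    then show "(cmod (u \<omega> \<bullet>c v))\<^sup>2 = min_overlap n (W \<omega>) v"
      unfolding q(2)[OF v(1)] c using w(1) v(1) by (simp add: cscalar_prod_smult norm_mult power_mult_distrib)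
  qed
  let ?F = "\<lambda>A. indicator {A. min_overlap n A v > a} A :: ennreal"
  have Fm: "?F \<in> borel_measurable (borel_cmat n n)"
  proof -
    have [measurable]: "(\<lambda>A. min_overlap n A v) \<in> borel_measurable (borel_cmat n n)"
      by (rule measurable_min_overlap) (simp_all add: space_borel_cvec v(1))
    show ?thesis unfolding indicator_def mem_Collect_eq by measurable
  qed
  let ?G = "\<lambda>X. ennreal (exp (- ?s * (spike_energy ?m X v - min_eig n (gram n ?m X))))"
  have Rm: "(\<lambda>X. spike_energy ?m X v) \<in> borel_measurable (cnormal_cols n ?m)"
    by (rule spike_energy_measurable[where f = "\<lambda>X. X", OF col_measurable]) (auto simp: space_borel_cvec v(1))
  have lm: "(\<lambda>X. min_eig n (gram n ?m X)) \<in> borel_measurable (cnormal_cols n ?m)"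
    by (rule measurable_min_eig[OF gram_in_borel_cmat])
  note [measurable] = Rm lm
  have Gm: "?G \<in> borel_measurable (cnormal_cols n ?m)" by measurable
  define J where "J = (\<integral>\<^sup>+X. ?G X \<partial>?C)"
  have "ennreal p = emeasure M {\<omega> \<in> space M. (cmod (u \<omega> \<bullet>c v))\<^sup>2 > a}"
    unfolding p_def by (rule M.emeasure_eq_measure[symmetric])
  also have "\<dots> = (\<integral>\<^sup>+\<omega>. indicator {\<omega> \<in> space M. (cmod (u \<omega> \<bullet>c v))\<^sup>2 > a} \<omega> \<partial>M)"
    by (rule nn_integral_indicator[OF borel_measurable_less[OF borel_measurable_const um], symmetric])
  also have "\<dots> = (\<integral>\<^sup>+\<omega>. ?F (W \<omega>) \<partial>M)"
    by (rule nn_integral_cong_AE, rule AE_mp[OF overlap], rule AE_I2) (simp add: indicator_def)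
  also have "\<dots> = (\<integral>\<^sup>+A. ?F A \<partial>distr M (borel_cmat n n) W)"
    by (rule nn_integral_distr[OF W, symmetric]) (use Fm in simp)
  also have "\<dots> = (\<integral>\<^sup>+X. ?F (gram n ?m X) \<partial>?C)"
    unfolding law' by (rule nn_integral_distr[OF gm]) (use Fm in simp)
  also have "\<dots> = (\<integral>\<^sup>+X. spike_weight \<theta> ?m X v * indicator {X. min_overlap n (gram n ?m X) v > a} X \<partial>cnormal_cols n ?m)"
    by (subst nn_integral_spike_cols[OF v \<theta> measurable_compose[OF gram_in_borel_cmat Fm]]) (simp add: indicator_def)
  also have "\<dots> = ennreal ((1 - a) ^ (n - 1)) * J"
    unfolding spike_overlap_identity[OF v n0 nm a \<theta>] J_def nn_integral_spike_cols[OF v \<theta> Gm] ..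
  finally have pJ: "ennreal p = ennreal ((1 - a) ^ (n - 1)) * J" .
  have gap: "AE X in ?C. 0 \<le> min_eig n (gram n ?m X) \<and> min_eig n (gram n ?m X) \<le> spike_energy ?m X v"
  proof (rule AE_mp[OF aeC], rule AE_I2, rule impI)
    fix X assume "disc n (gram n ?m X) \<noteq> 0"
    then obtain l w where sp: "spectral n (gram n ?m X) l w"
      using hermitian_spectral[OF gram_carrier gram_adjoint] by blast
    show "0 \<le> min_eig n (gram n ?m X) \<and> min_eig n (gram n ?m X) \<le> spike_energy ?m X v"
      using min_eig_gram_nonneg[OF sp n0] min_eig_le_spike_energy[OF sp n0 v] by simp
  qed
  have Lexp: "(\<integral>\<^sup>+X. ennreal (exp (- ?s * spike_energy ?m X v)) \<partial>?C) = ennreal L"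
    unfolding nn_integral_spike_cols_exp[OF v \<theta> s0] s1 L_def ..
  have L0: "0 \<le> L" using \<theta> a by (simp add: L_def)
  have q0: "0 \<le> (1 - a) ^ (n - 1)" using a by simp
  have "ennreal L \<le> J"
    unfolding Lexp[symmetric] J_def
  proof (rule nn_integral_mono_AE, rule AE_mp[OF gap], rule AE_I2, rule impI)
    fix X assume "0 \<le> min_eig n (gram n ?m X) \<and> min_eig n (gram n ?m X) \<le> spike_energy ?m X v"
    then show "ennreal (exp (- ?s * spike_energy ?m X v)) \<le> ?G X"
      using s0 by (intro ennreal_leI exp_gap_lower) auto
  qed
  then have "ennreal ((1 - a) ^ (n - 1)) * ennreal L \<le> ennreal p"
    unfolding pJ by (rule mult_left_mono) simp
  then show "(1 - a) ^ (n - 1) * L \<le> p"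
    unfolding ennreal_mult[OF q0 L0, symmetric] by (subst (asm) ennreal_le_iff) (simp_all add: p_def)
  have "J \<le> (\<integral>\<^sup>+X. ennreal (exp (- ?s * spike_energy ?m X v)) + ennreal ?s * ennreal (min_eig n (gram n ?m X)) \<partial>?C)"
    unfolding J_def
  proof (rule nn_integral_mono_AE, rule AE_mp[OF gap], rule AE_I2, rule impI)
    fix X assume g: "0 \<le> min_eig n (gram n ?m X) \<and> min_eig n (gram n ?m X) \<le> spike_energy ?m X v"
    then have "?G X \<le> ennreal (exp (- ?s * spike_energy ?m X v) + ?s * min_eig n (gram n ?m X))"
      using s0 by (intro ennreal_leI exp_gap_upper) auto
    also have "\<dots> = ennreal (exp (- ?s * spike_energy ?m X v)) + ennreal ?s * ennreal (min_eig n (gram n ?m X))"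
      using g s0 by (simp only: ennreal_plus[OF exp_ge_zero mult_nonneg_nonneg] ennreal_mult)
    finally show "?G X \<le> ennreal (exp (- ?s * spike_energy ?m X v)) + ennreal ?s * ennreal (min_eig n (gram n ?m X))" .
  qed
  also have "\<dots> = ennreal L + ennreal ?s * (\<integral>\<^sup>+X. ennreal (min_eig n (gram n ?m X)) \<partial>?C)"
  proof -
    have m1: "(\<lambda>X. ennreal (exp (- ?s * spike_energy ?m X v))) \<in> borel_measurable ?C"
      and m2: "(\<lambda>X. ennreal (min_eig n (gram n ?m X))) \<in> borel_measurable ?C"
      unfolding measurable_spike_cols[OF v \<theta>] by measurable
    show ?thesis using nn_integral_add[OF m1 borel_measurable_times_ennreal[OF borel_measurable_const m2], of "ennreal ?s"]
      unfolding nn_integral_cmult[OF m2] Lexp by simp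
  qed
  also have "\<dots> \<le> ennreal L + ennreal ?s * ennreal (real (?m - (n - 2)))"
    by (intro add_mono mult_left_mono nn_integral_min_eig_le[OF v \<theta> n nm]) simp_all
  \<comment> \<open>The number of remaining columns is (n + \<alpha>) - (n - 2) = \<alpha> + 2,
    where n \<ge> 2 keeps the natural subtraction exact.\<close>
  also have "\<dots> = ennreal (L + ?s * (\<alpha> + 2))"
    using L0 s0 n by (simp only: ennreal_plus ennreal_mult mult_nonneg_nonneg of_nat_0_le_iff) (simp add: Suc_diff_Suc)
  also have "\<dots> \<le> ennreal (L + \<theta> * a * (\<alpha> + 2))"
  proof -
    have "\<theta> / (1 + \<theta>) \<le> \<theta>" using \<theta> divide_left_mono[of 1 "1 + \<theta>" \<theta>] by simp
    then show ?thesis using a by (intro ennreal_leI add_left_mono mult_right_mono) auto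
  qed
  finally have "J \<le> ennreal (L + \<theta> * a * (\<alpha> + 2))" .
  then have "ennreal p \<le> ennreal ((1 - a) ^ (n - 1)) * ennreal (L + \<theta> * a * (\<alpha> + 2))"
    unfolding pJ by (rule mult_left_mono) simp
  also have "\<dots> = ennreal ((1 - a) ^ (n - 1) * (L + \<theta> * a * (\<alpha> + 2)))"
    using q0 L0 \<theta> a by (intro ennreal_mult[symmetric]) auto
  finally show "p \<le> (1 - a) ^ (n - 1) * (L + \<theta> * a * (\<alpha> + 2))"
    using q0 L0 \<theta> a by (subst (asm) ennreal_le_iff) auto
qed

text \<open>Only the laws for each \<open>n\<close> matter, so every \<open>n\<close> has its own
  probability space. Measurability is asked of the squared overlap because the eigenvector itself is
  determined only up to a phase. Distribution functions are shown to converge at every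
  \<open>t\<close>.\<close>

theorem corollary2:
  fixes \<theta> :: real and \<alpha> :: nat
    and M :: "nat \<Rightarrow> 'a measure"
    and v :: "nat \<Rightarrow> complex vec"
    and W :: "nat \<Rightarrow> 'a \<Rightarrow> complex mat"
    and u :: "nat \<Rightarrow> 'a \<Rightarrow> complex vec"
  assumes "\<theta> \<ge> 0"
    and "\<And>n. n \<ge> 2 \<Longrightarrow> prob_space (M n)"
    and "\<And>n. n \<ge> 2 \<Longrightarrow> v n \<in> carrier_vec n"
    and "\<And>n. n \<ge> 2 \<Longrightarrow> v n \<bullet>c v n = 1"
    and "\<And>n. n \<ge> 2 \<Longrightarrow> W n \<in> M n \<rightarrow>\<^sub>M borel_cmat n n"
    and "\<And>n. n \<ge> 2 \<Longrightarrow> distr (M n) (borel_cmat n n) (W n)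
           = complex_wishart n (n + \<alpha>)
               (1\<^sub>m n + complex_of_real \<theta> \<cdot>\<^sub>m outer_prod (v n) (v n))"
    and "\<And>n. n \<ge> 2 \<Longrightarrow> AE \<omega> in M n. u n \<omega> \<bullet>c u n \<omega> = 1 \<and>
           eigenvector (W n \<omega>) (u n \<omega>) (complex_of_real (smallest_eigenvalue (W n \<omega>)))"
    and "\<And>n. n \<ge> 2 \<Longrightarrow> (\<lambda>\<omega>. (cmod (u n \<omega> \<bullet>c v n))\<^sup>2) \<in> borel_measurable (M n)"
  shows "weak_conv_m
           (\<lambda>n. distr (M n) borel (\<lambda>\<omega>. real n * (cmod (u n \<omega> \<bullet>c v n))\<^sup>2))
           (distr (chi_squared 2) borel (\<lambda>x. x / (2 * (1 + \<theta>))))"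
  unfolding weak_conv_m_def weak_conv_def
proof (intro allI impI)
  fix t :: real
  let ?Z = "\<lambda>n \<omega>. (cmod (u n \<omega> \<bullet>c v n))\<^sup>2"
  let ?cdf = "\<lambda>n. cdf (distr (M n) borel (\<lambda>\<omega>. real n * ?Z n \<omega>)) t"
  have cdf: "?cdf n = measure (M n) {\<omega> \<in> space (M n). real n * ?Z n \<omega> \<le> t}" if "n \<ge> 2" for n
  proof -
    note [measurable] = assms(8)[OF that]
    show ?thesis unfolding cdf_def
      by (subst measure_distr) (auto intro!: arg_cong[where f = "measure (M n)"])
  qed
  have lim: "cdf (distr (chi_squared 2) borel (\<lambda>x. x / (2 * (1 + \<theta>)))) t = (if t < 0 then 0 else 1 - exp (- (1 + \<theta>) * t))"
    using assms(1) by (intro cdf_chi_squared_2_scaled) simp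
  show "?cdf \<longlonglongrightarrow> cdf (distr (chi_squared 2) borel (\<lambda>x. x / (2 * (1 + \<theta>)))) t"
  proof (cases "t < 0")
    case True
    have "?cdf n = 0" if "n \<ge> 2" for n
    proof -
      have "{\<omega> \<in> space (M n). real n * ?Z n \<omega> \<le> t} = {}"
        using True by (auto simp: not_le intro: less_le_trans)
      then show ?thesis unfolding cdf[OF that] by (simp only: measure_empty)
    qed
    \<comment> \<open>The terms n = 0 and n = 1 are unconstrained, hence the start at 2.\<close>
    then have "eventually (\<lambda>n. ?cdf n = 0) sequentially"
      by (intro eventually_sequentiallyI[of 2])
    then show ?thesis unfolding lim using True by (simp add: tendsto_eventually)
  next
    case False
    define A where "A n = (1 - t / real n) ^ (n - 1)" for n
    define L where "L n = 1 / (1 + \<theta> * (t / real n)) ^ (n + \<alpha>)" for n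
    define E where "E n = \<theta> * (t / real n) * (\<alpha> + 2)" for n
    have z: "(\<lambda>n. t / real n) \<longlonglongrightarrow> 0" by (rule lim_const_over_n)
    have z1: "eventually (\<lambda>n. t / real n < 1) sequentially" by (rule order_tendstoD(2)[OF z]) simp
    have AL: "(\<lambda>n. A n * L n) \<longlonglongrightarrow> exp (- (1 + \<theta>) * t)"
      unfolding A_def L_def by (rule gap_limit)
    \<comment> \<open>The tail bounds are used at \<open>a = t / n\<close>, which is below one for
      large \<open>n\<close>. The common factor \<open>A n \<le> 1\<close> is dropped from the
      error, leaving \<open>E n\<close>, of order 1 / n.\<close>
    have bounds: "eventually (\<lambda>n. 1 - (A n * L n + E n) \<le> ?cdf n \<and> ?cdf n \<le> 1 - A n * L n) sequentially"
      using eventually_ge_at_top[of 2] z1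
    proof eventually_elim
      case (elim n)
      interpret prob_space "M n" by (rule assms(2)[OF elim(1)])
      have a: "0 \<le> t / real n" using False by simp
      have "?cdf n = prob (space (M n) - {\<omega> \<in> space (M n). ?Z n \<omega> > t / real n})"
        unfolding cdf[OF elim(1)] using elim(1) by (intro arg_cong[where f = prob]) (auto simp: field_simps)
      also have "\<dots> = 1 - prob {\<omega> \<in> space (M n). ?Z n \<omega> > t / real n}"
        by (rule prob_compl) (rule borel_measurable_less[OF borel_measurable_const assms(8)[OF elim(1)]])
      finally have c: "?cdf n = 1 - prob {\<omega> \<in> space (M n). ?Z n \<omega> > t / real n}" .
      note b = spike_tail_bounds[OF assms(1) elim(1) assms(2)[OF elim(1)] assms(3)[OF elim(1)] assms(4)[OF elim(1)]
          assms(5)[OF elim(1)] assms(6)[OF elim(1)] assms(7)[OF elim(1)] assms(8)[OF elim(1)] a elim(2)]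
      have "0 \<le> E n" unfolding E_def by (intro mult_nonneg_nonneg a assms(1)) simp
      then have "A n * E n \<le> 1 * E n"
        using a elim(2) by (intro mult_right_mono) (auto simp: A_def power_le_one)
      then show ?case
        using b unfolding c A_def[symmetric] L_def[symmetric] E_def[symmetric] by (simp add: distrib_left)
    qed
    have "E \<longlonglongrightarrow> \<theta> * 0 * (\<alpha> + 2)" unfolding E_def by (intro tendsto_intros z)
    then have "(\<lambda>n. 1 - (A n * L n + E n)) \<longlonglongrightarrow> 1 - (exp (- (1 + \<theta>) * t) + 0)"
      by (intro tendsto_diff tendsto_add tendsto_const AL) simp
    moreover have "(\<lambda>n. 1 - A n * L n) \<longlonglongrightarrow> 1 - exp (- (1 + \<theta>) * t)"
      by (intro tendsto_diff tendsto_const AL)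
    ultimately show ?thesis unfolding lim using False bounds
      by (intro tendsto_sandwich[of "\<lambda>n. 1 - (A n * L n + E n)" ?cdf sequentially "\<lambda>n. 1 - A n * L n"])
         (auto elim: eventually_mono)
  qed
qed

end
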